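(* Let $\gamma_0$ be an initial $\ell$-convex Legendre curve with $\ell(\theta,0)=1$. If the algebraic area $A_0$ of $\gamma_0$ is positive, then for $$\lambda(t)=\frac{1}{L}\int_0^{2\pi}\beta^2\,d\theta,$$ the flow $$\frac{\partial\gamma}{\partial t}=\frac{\ell(\beta-\lambda(t))'}{\ell^2+\beta^2}\,\mu+(\beta-\lambda(t))\,\nu,\qquad \frac{\partial\nu}{\partial t}=-\frac{\beta(\beta-\lambda(t))'}{\ell^2+\beta^2}\,\mu$$ starting from $\gamma_0$ exists in the time interval $[0,+\infty)$. Meanwhile, the evolving curve is still $\ell$-convex, preserves the algebraic area, and converges to a circle of radius $\sqrt{A_0/\pi}$ in the $C^\infty$ sense as time $t$ goes to infinity.
   Context: A prime denotes the derivative with respect to the curve parameter $\theta\in\mathbb{S}^1=\mathbb{R}/2\pi\mathbb{Z}$. A (closed) Legendre curve is a map $\gamma:\mathbb{S}^1\to\mathbb{R}^2$ for which there is a smooth unit vector field $\nu:\mathbb{S}^1\to\mathbb{S}^1\subset\mathbb{R}^2$ with $\langle\gamma'(\theta),\nu(\theta)\rangle=0$ for all $\theta$; $\gamma$ may have singular points. Put $\mu=J(\nu)$, where $J$ is the counterclockwise rotation by $\pi/2$. The functions $\ell$ and $\beta$ are defined by $\ell=\langle\nu',\mu\rangle$ and $\gamma'=\beta\mu$. The curve is $\ell$-convex if $\ell>0$. An $\ell$-convex Legendre curve can be reparametrized so that $\ell=1$, and for simplicity attention is restricted to curves with $\ell=1$. For such a curve, $\nu=(\cos\theta,\sin\theta)$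 and $\gamma(\theta)=p(\theta)(\cos\theta,\sin\theta)+p'(\theta)(-\sin\theta,\cos\theta)$, where $p$ is called the support function. Then $\beta=p+p''$, the algebraic length is $L=\int_{\mathbb{S}^1}(p+p'')\,d\theta=\int_{\mathbb{S}^1}p\,d\theta$, and the algebraic area is $A=\frac12\int_{\mathbb{S}^1}p(p+p'')\,d\theta$. In the flow, which evolves the pair $(\gamma,\nu)$, the quantities $\ell,\beta,\mu,\nu,L$ are those of the evolving curve $\gamma(\cdot,t)$.
   Formalization: At each time the flow's ℓ, β, L, λ and θ-derivatives are taken in the ℓ=1 parametrization of the evolving curve, not in the moving parameter θ; with the latter, ℓ does not stay 1 and the claim fails, e.g. for p=1+ε cos 2θ the limit is not a circle. *)

theory Defs
  imports "HOL-Analysis.Analysis"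
begin

(* Functions on the circle R/(2 pi Z) are 2 pi-periodic functions of a real variable. *)

type_synonym curve = "real \<Rightarrow> real ^ 2"

definition vd :: "(real \<Rightarrow> 'a::real_normed_vector) \<Rightarrow> real \<Rightarrow> 'a" where
  "vd f = (\<lambda>\<theta>. vector_derivative f (at \<theta>))"

definition smooth :: "(real \<Rightarrow> 'a::real_normed_vector) \<Rightarrow> bool" where
  "smooth f \<longleftrightarrow> (\<forall>k \<theta>. (vd ^^ k) f differentiable (at \<theta>))"

definition rot :: "real ^ 2 \<Rightarrow> real ^ 2" where
  "rot v = vector [- (v $ 2), v $ 1]"

definition ell :: "curve \<Rightarrow> real \<Rightarrow> real" where
  "ell \<nu> \<theta> = vd \<nu> \<theta> \<bullet> rot (\<nu> \<theta>)"

(* For a Legendre curve gamma' is a multiple of the unit vector mu = rot nu,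
   so this is the function determined by gamma' = beta mu. *)
definition beta :: "curve \<Rightarrow> curve \<Rightarrow> real \<Rightarrow> real" where
  "beta \<gamma> \<nu> \<theta> = vd \<gamma> \<theta> \<bullet> rot (\<nu> \<theta>)"

definition legendre_curve :: "curve \<Rightarrow> curve \<Rightarrow> bool" where
  "legendre_curve \<gamma> \<nu> \<longleftrightarrow>
     smooth \<gamma> \<and> smooth \<nu> \<and>
     (\<forall>\<theta>. \<gamma> (\<theta> + 2 * pi) = \<gamma> \<theta>) \<and> (\<forall>\<theta>. \<nu> (\<theta> + 2 * pi) = \<nu> \<theta>) \<and>
     (\<forall>\<theta>. norm (\<nu> \<theta>) = 1) \<and> (\<forall>\<theta>. vd \<gamma> \<theta> \<bullet> \<nu> \<theta> = 0)"

definition ell_convex :: "curve \<Rightarrow> bool" where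
  "ell_convex \<nu> \<longleftrightarrow> (\<forall>\<theta>. ell \<nu> \<theta> > 0)"

(* gamma = p nu + p' mu when ell = 1. *)
definition support :: "curve \<Rightarrow> curve \<Rightarrow> real \<Rightarrow> real" where
  "support \<gamma> \<nu> \<theta> = \<gamma> \<theta> \<bullet> \<nu> \<theta>"

(* When ell = 1, beta = p + p'', so these are L = int (p + p'') and
   A = 1/2 int p (p + p'').  Written with beta d theta they do not depend on the
   parametrization and make sense for any Legendre curve. *)
definition alg_length :: "curve \<Rightarrow> curve \<Rightarrow> real" where
  "alg_length \<gamma> \<nu> = integral {0..2 * pi} (beta \<gamma> \<nu>)"

definition alg_area :: "curve \<Rightarrow> curve \<Rightarrow> real" where
  "alg_area \<gamma> \<nu> = 1 / 2 * integral {0..2 * pi} (\<lambda>\<theta>. support \<gamma> \<nu> \<theta> * beta \<gamma> \<nu> \<theta>)"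

definition lam :: "curve \<Rightarrow> curve \<Rightarrow> real" where
  "lam \<gamma> \<nu> = 1 / alg_length \<gamma> \<nu> * integral {0..2 * pi} (\<lambda>\<theta>. (beta \<gamma> \<nu> \<theta>)\<^sup>2)"

definition speed :: "curve \<Rightarrow> curve \<Rightarrow> real \<Rightarrow> real" where
  "speed \<gamma> \<nu> \<theta> = beta \<gamma> \<nu> \<theta> - lam \<gamma> \<nu>"

definition flow_gamma :: "curve \<Rightarrow> curve \<Rightarrow> curve" where
  "flow_gamma \<gamma> \<nu> \<theta> =
     (ell \<nu> \<theta> * vd (speed \<gamma> \<nu>) \<theta> / ((ell \<nu> \<theta>)\<^sup>2 + (beta \<gamma> \<nu> \<theta>)\<^sup>2)) *\<^sub>R rot (\<nu> \<theta>)
     + speed \<gamma> \<nu> \<theta> *\<^sub>R \<nu> \<theta>"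

definition flow_nu :: "curve \<Rightarrow> curve \<Rightarrow> curve" where
  "flow_nu \<gamma> \<nu> \<theta> =
     - (beta \<gamma> \<nu> \<theta> * vd (speed \<gamma> \<nu>) \<theta> / ((ell \<nu> \<theta>)\<^sup>2 + (beta \<gamma> \<nu> \<theta>)\<^sup>2)) *\<^sub>R rot (\<nu> \<theta>)"

(* (G, N) is the ell = 1 parametrization of the Legendre curve (gamma, nu).  It is
   unique up to a shift of the parameter.  Since phi' is the function ell of nu, no
   sign of phi' is prescribed: phi is a diffeomorphism iff (gamma, nu) is ell-convex. *)
definition normalization ::
  "curve \<Rightarrow> curve \<Rightarrow> curve \<Rightarrow> curve \<Rightarrow> (real \<Rightarrow> real) \<Rightarrow> bool" where
  "normalization \<gamma> \<nu> G N \<phi> \<longleftrightarrow>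
     legendre_curve G N \<and> (\<forall>\<theta>. ell N \<theta> = 1) \<and>
     smooth \<phi> \<and> (\<forall>\<theta>. \<phi> (\<theta> + 2 * pi) = \<phi> \<theta> + 2 * pi) \<and>
     (\<forall>\<theta>. \<gamma> \<theta> = G (\<phi> \<theta>)) \<and> (\<forall>\<theta>. \<nu> \<theta> = N (\<phi> \<theta>))"

(* Joint smoothness in (t, theta) on [0, infinity) x R: all iterated mixed partial
   derivatives exist and are continuous, one-sided in time at t = 0. *)
coinductive smooth_evolution :: "(real \<Rightarrow> real \<Rightarrow> 'a::real_normed_vector) \<Rightarrow> bool" where
  "continuous_on ({0..} \<times> UNIV) (\<lambda>(t, \<theta>). f t \<theta>) \<Longrightarrow>
   (\<forall>t\<ge>0. \<forall>\<theta>. (f t has_vector_derivative f\<^sub>\<theta> t \<theta>) (at \<theta>)) \<Longrightarrow>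
   (\<forall>t\<ge>0. \<forall>\<theta>. ((\<lambda>s. f s \<theta>) has_vector_derivative f\<^sub>t t \<theta>) (at t within {0..})) \<Longrightarrow>
   smooth_evolution f\<^sub>\<theta> \<Longrightarrow> smooth_evolution f\<^sub>t \<Longrightarrow> smooth_evolution f"

(* The normal speed beta - lambda is not invariant under reparametrization, whereas L, A
   and the support function refer to curves with ell = 1.  Accordingly the velocity of the
   evolving curve at time t is the one computed from its ell = 1 parametrization (G, N),
   at the point phi theta which is carried by theta; the normal angle then sees
   dp/dt = p'' + p - lambda.  (The tangential term of the first equation and the
   right-hand side of the second depend on the parametrization only through the speed.)
   Had the speed been computed in the moving parametrization, in which ell does not stay 1,
   every curve with beta constant would be stationary whatever ell is, and the evolving
   curve would not in general become a circle. *)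
definition flow_solution ::
  "curve \<Rightarrow> curve \<Rightarrow> (real \<Rightarrow> curve) \<Rightarrow> (real \<Rightarrow> curve) \<Rightarrow> bool" where
  "flow_solution \<gamma>\<^sub>0 \<nu>\<^sub>0 \<gamma> \<nu> \<longleftrightarrow>
     \<gamma> 0 = \<gamma>\<^sub>0 \<and> \<nu> 0 = \<nu>\<^sub>0 \<and> smooth_evolution \<gamma> \<and> smooth_evolution \<nu> \<and>
     (\<forall>t\<ge>0. \<exists>G N \<phi>. normalization (\<gamma> t) (\<nu> t) G N \<phi> \<and>
        (\<forall>\<theta>. ((\<lambda>s. \<gamma> s \<theta>) has_vector_derivative flow_gamma G N (\<phi> \<theta>)) (at t within {0..}) \<and>
             ((\<lambda>s. \<nu> s \<theta>) has_vector_derivative flow_nu G N (\<phi> \<theta>)) (at t within {0..})))"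

definition tendsto_smoothly :: "(real \<Rightarrow> curve) \<Rightarrow> curve \<Rightarrow> bool" where
  "tendsto_smoothly \<gamma> g \<longleftrightarrow>
     (\<forall>k. uniform_limit UNIV (\<lambda>t. (vd ^^ k) (\<gamma> t)) ((vd ^^ k) g) at_top)"

(* g runs once counterclockwise, with nonvanishing velocity, around a circle of radius R. *)
definition circle_param :: "real \<Rightarrow> curve \<Rightarrow> bool" where
  "circle_param R g \<longleftrightarrow>
     (\<exists>c \<psi>. smooth \<psi> \<and> (\<forall>\<theta>. \<psi> (\<theta> + 2 * pi) = \<psi> \<theta> + 2 * pi) \<and> (\<forall>\<theta>. vd \<psi> \<theta> > 0) \<and>
        (\<forall>\<theta>. g \<theta> = c + R *\<^sub>R vector [cos (\<psi> \<theta>), sin (\<psi> \<theta>)]))"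

end

theory Submission
  imports Defs
begin

text \<open>Let p(x, t) be the support function of the evolving curve as a function of the normal angle x.
  The flow turns into the linear equation p_t = p_xx + p - lambda(t): the modes of frequency k \<ge> 2 are
  multiplied by exp ((1 - k^2) t), those of frequency 1 are constant, and the mean of p follows up to its
  sign from the conservation of area.
  A point of the curve moves through the normal angles by the scalar equation
  alpha_t = - beta beta_x / (1 + beta^2) (t, alpha), whose right-hand side decays exponentially with all
  its derivatives; so alpha(t) converges smoothly to a diffeomorphism of the circle and the curve to a circle.
  Conversely, along any solution the normal angle lifts to a smooth alpha, and the Fourier coefficients of
  beta, written as integrals over the curve parameter, can be differentiated in time without assuming that
  alpha is a diffeomorphism.  They satisfy the equations above, so beta is the explicit solution, and the
  equations for alpha and gamma determine the rest.\<close>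

subsection \<open>Evolutions with bounded or exponentially decaying derivatives\<close>

text \<open>In the equation for p the only nonlinear term is lambda, and it acts on the mean p0 of p
  alone. The danger is that the length L = 2 pi p0, by which lambda divides, reaches zero. Positive
  area A excludes this: 2 pi p0^2 = 2 A + I, where the contribution I of the frequencies k \<ge> 2
  is nonnegative, so the modulus of p0 is at least sqrt (A / pi). The sign of p0 is free; if it is
  negative, the limit circle is run through with angles shifted by pi. The rate 3 used for decay is
  2^2 - 1, that of the slowest contracting frequency. In the uniqueness part the obstacle is that a
  solution supplies some parametrization with ell = 1 for each time separately, so beta as a
  function of the normal angle comes with no regularity in time. The integral of beta f (alpha) d
  alpha is therefore integrated by parts until beta disappears and only gamma, alpha and alpha_x
  remain, whose time derivatives are known.\<close>

definition decaying :: "real \<Rightarrow> (real \<Rightarrow> real \<Rightarrow> real) \<Rightarrow> bool" where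
  "decaying w f \<longleftrightarrow> continuous_on ({0..} \<times> UNIV) (\<lambda>(t, x). f t x) \<and>
     (\<exists>C. \<forall>t\<ge>0. \<forall>x. \<bar>f t x\<bar> \<le> C * exp (- w * t))"

text \<open>Rate 0 is plain boundedness, so one class covers both the bounded and the decaying
  quantities. The derivatives are quantified existentially and only times t \<ge> 0 count; closure
  properties are then proved by exhibiting derivatives.\<close>

primrec Cdecay :: "nat \<Rightarrow> real \<Rightarrow> (real \<Rightarrow> real \<Rightarrow> real) \<Rightarrow> bool" where
  "Cdecay 0 w f \<longleftrightarrow> decaying w f"
| "Cdecay (Suc n) w f \<longleftrightarrow> decaying w f \<and> (\<exists>fx ft. Cdecay n w fx \<and> Cdecay n w ft \<and>
     (\<forall>t\<ge>0. \<forall>x. (f t has_real_derivative fx t x) (at x)) \<and>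
     (\<forall>t\<ge>0. \<forall>x. ((\<lambda>s. f s x) has_real_derivative ft t x) (at t within {0..})))"

lemma continuous_on_cong_quadrant:
  assumes "continuous_on ({0..} \<times> UNIV) (\<lambda>(t::real, x). f t x)" "\<And>t x. t \<ge> 0 \<Longrightarrow> g t x = f t x"
  shows "continuous_on ({0..} \<times> UNIV) (\<lambda>(t, x). g t x)"
  using assms(1) by (rule continuous_on_eq) (auto simp: assms(2))

lemma has_real_derivative_cong_halfline:
  assumes "(f has_real_derivative D) (at t within {0..})" "t \<ge> 0" "\<And>s. s \<ge> 0 \<Longrightarrow> g s = f s"
  shows "(g has_real_derivative D) (at t within {0..})"
  using assms unfolding has_field_derivative_def
  by (auto intro: has_derivative_transform[where f=f])

lemma decaying_cong:
  assumes "decaying w f" "\<And>t x. t \<ge> 0 \<Longrightarrow> g t x = f t x"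
  shows "decaying w g"
  using assms continuous_on_cong_quadrant[of f g] unfolding decaying_def by auto

lemma CdecayE:
  assumes "Cdecay (Suc n) w f"
  obtains fx ft where "Cdecay n w fx" "Cdecay n w ft"
     "\<And>t x. t \<ge> 0 \<Longrightarrow> (f t has_real_derivative fx t x) (at x)"
     "\<And>t x. t \<ge> 0 \<Longrightarrow> ((\<lambda>s. f s x) has_real_derivative ft t x) (at t within {0..})"
  using assms unfolding Cdecay.simps by blast

lemma CdecayI:
  assumes "decaying w f" "Cdecay n w fx" "Cdecay n w ft"
     "\<And>t x. t \<ge> 0 \<Longrightarrow> (f t has_real_derivative fx t x) (at x)"
     "\<And>t x. t \<ge> 0 \<Longrightarrow> ((\<lambda>s. f s x) has_real_derivative ft t x) (at t within {0..})"
  shows "Cdecay (Suc n) w f"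
  using assms unfolding Cdecay.simps by blast

lemma Cdecay_cong:
  assumes "Cdecay n w f" "\<And>t x. t \<ge> 0 \<Longrightarrow> g t x = f t x"
  shows "Cdecay n w g"
proof (cases n)
  case 0
  then show ?thesis using assms decaying_cong by auto
next
  case (Suc m)
  have ext: "g t = f t" if "t \<ge> 0" for t using assms(2)[OF that] by auto
  from assms(1) have "decaying w f" unfolding Suc by simp
  from assms(1) obtain fx ft where *: "Cdecay m w fx" "Cdecay m w ft"
     "\<And>t x. t \<ge> 0 \<Longrightarrow> (f t has_real_derivative fx t x) (at x)"
     "\<And>t x. t \<ge> 0 \<Longrightarrow> ((\<lambda>s. f s x) has_real_derivative ft t x) (at t within {0..})"
    unfolding Suc by (rule CdecayE) (rule that)
  show ?thesis
    unfolding Suc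
  proof (rule CdecayI[OF decaying_cong[OF \<open>decaying w f\<close> assms(2)] *(1,2)])
    show "((\<lambda>s. g s x) has_real_derivative ft t x) (at t within {0..})" if "t \<ge> 0" for t x
      by (rule has_real_derivative_cong_halfline[OF *(4)[OF that] that]) (simp add: assms(2))
  qed (use * ext in auto)
qed

text \<open>This makes the one-sided time derivative at t = 0 unique, so that \<open>dt\<close>
  below is well determined.\<close>

lemma halfline_nontrivial:
  fixes t :: real
  assumes "t \<ge> 0"
  shows "at t within {0..} \<noteq> bot"
proof -
  have "at_right t \<le> at t within {0..}"
    using assms by (intro at_le) auto
  then show ?thesis
    using trivial_limit_at_right_real[of t] by (metis bot.extremum_uniqueI)
qed

lemma vd_eqI: "(\<And>x. (f has_vector_derivative f' x) (at x)) \<Longrightarrow> vd f = f'"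
  unfolding vd_def by (auto intro: vector_derivative_at)

lemma vd_eqI_real: "(\<And>x. (f has_real_derivative f' x) (at x)) \<Longrightarrow> vd f = f'"
  by (rule vd_eqI) (simp add: has_real_derivative_iff_has_vector_derivative)

definition dt :: "(real \<Rightarrow> real \<Rightarrow> real) \<Rightarrow> real \<Rightarrow> real \<Rightarrow> real" where
  "dt f t x = vector_derivative (\<lambda>s. f s x) (at t within {0..})"

lemma dt_eqI:
  "((\<lambda>s. f s x) has_real_derivative D) (at t within {0..}) \<Longrightarrow> t \<ge> 0 \<Longrightarrow> dt f t x = D"
  unfolding dt_def has_real_derivative_iff_has_vector_derivative
  by (rule vector_derivative_within[OF halfline_nontrivial])

text \<open>Derivatives on the half-line are unique, so the existential witnesses can be traded for
  the canonical \<open>vd\<close> and \<open>dt\<close>. Inductions on the order use them in this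
  form.\<close>

lemma CdecayD:
  assumes "Cdecay (Suc n) w f"
  shows "Cdecay n w (\<lambda>t. vd (f t))" "Cdecay n w (dt f)"
    "t \<ge> 0 \<Longrightarrow> (f t has_real_derivative vd (f t) x) (at x)"
    "t \<ge> 0 \<Longrightarrow> ((\<lambda>s. f s x) has_real_derivative dt f t x) (at t within {0..})"
proof -
  obtain fx ft where f: "Cdecay n w fx" "Cdecay n w ft"
     "\<And>t x. t \<ge> 0 \<Longrightarrow> (f t has_real_derivative fx t x) (at x)"
     "\<And>t x. t \<ge> 0 \<Longrightarrow> ((\<lambda>s. f s x) has_real_derivative ft t x) (at t within {0..})"
    using assms by (rule CdecayE) (rule that)
  have eq: "vd (f t) = fx t" "dt f t x = ft t x" if "t \<ge> 0" for t x
    using vd_eqI_real[OF f(3)[OF that]] dt_eqI[OF f(4)[OF that] that] by simp_all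
  show "Cdecay n w (\<lambda>t. vd (f t))" "Cdecay n w (dt f)"
    using Cdecay_cong[OF f(1), of "\<lambda>t. vd (f t)"] Cdecay_cong[OF f(2), of "dt f"] eq by simp_all
  show "t \<ge> 0 \<Longrightarrow> (f t has_real_derivative vd (f t) x) (at x)"
    "t \<ge> 0 \<Longrightarrow> ((\<lambda>s. f s x) has_real_derivative dt f t x) (at t within {0..})"
    using f(3,4) eq by simp_all
qed

lemma Cdecay_imp_decaying: "Cdecay n w f \<Longrightarrow> decaying w f"
  by (cases n) auto

lemma Cdecay_SucD: "Cdecay (Suc n) w f \<Longrightarrow> Cdecay n w f"
proof (induction n arbitrary: f)
  case 0
  then show ?case by auto
next
  case (Suc n)
  note * = CdecayD[OF Suc.prems]
  show ?case
    using Cdecay_imp_decaying[OF Suc.prems] Suc.IH[OF *(1)] Suc.IH[OF *(2)] *(3,4)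
    by (rule CdecayI)
qed

lemma decayingD:
  assumes "decaying w f"
  obtains C where "C \<ge> 0" "\<And>t x. t \<ge> 0 \<Longrightarrow> \<bar>f t x\<bar> \<le> C * exp (- w * t)"
proof -
  from assms obtain C where C: "\<And>t x. t \<ge> 0 \<Longrightarrow> \<bar>f t x\<bar> \<le> C * exp (- w * t)"
    unfolding decaying_def by blast
  have "C \<ge> 0" using C[of 0 0] by auto
  with C that show ?thesis by blast
qed

lemma decaying_mono:
  assumes "decaying w f" "w' \<le> w"
  shows "decaying w' f"
proof -
  from assms(1) obtain C where C: "C \<ge> 0" "\<And>t x. t \<ge> 0 \<Longrightarrow> \<bar>f t x\<bar> \<le> C * exp (- w * t)"
    by (rule decayingD) (rule that)
  have "\<bar>f t x\<bar> \<le> C * exp (- w' * t)" if "t \<ge> 0" for t x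
    using C(2)[OF that, of x] mult_left_mono[OF _ C(1), of "exp (- w * t)" "exp (- w' * t)"]
      mult_right_mono[OF assms(2) that] by auto
  then show ?thesis using assms(1) unfolding decaying_def by blast
qed

lemma Cdecay_mono: "Cdecay n w f \<Longrightarrow> w' \<le> w \<Longrightarrow> Cdecay n w' f"
proof (induction n arbitrary: f)
  case 0
  then show ?case using decaying_mono by auto
next
  case (Suc n)
  note * = CdecayD[OF Suc.prems(1)]
  show ?case
    using decaying_mono[OF Cdecay_imp_decaying[OF Suc.prems(1)] Suc.prems(2)]
      Suc.IH[OF *(1) Suc.prems(2)] Suc.IH[OF *(2) Suc.prems(2)] *(3,4)
    by (rule CdecayI)
qed

lemma decaying_const: "decaying 0 (\<lambda>t x. c)"
  unfolding decaying_def by (auto intro!: exI[of _ "\<bar>c\<bar>"] simp: case_prod_unfold)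

lemma Cdecay_const: "Cdecay n 0 (\<lambda>t x. c)"
proof (induction n arbitrary: c)
  case 0
  then show ?case using decaying_const by simp
next
  case (Suc n)
  show ?case by (rule CdecayI[OF decaying_const Suc.IH Suc.IH, of c 0 0]) auto
qed

lemma Cdecay_zero: "Cdecay n w (\<lambda>t x. 0)"
proof (induction n)
  case 0
  then show ?case by (auto simp: decaying_def case_prod_unfold intro!: exI[of _ 0])
next
  case (Suc n)
  show ?case by (rule CdecayI[OF _ Suc.IH Suc.IH]) (auto simp: decaying_def case_prod_unfold intro!: exI[of _ 0])
qed

lemma decaying_add:
  assumes "decaying w f" "decaying w g"
  shows "decaying w (\<lambda>t x. f t x + g t x)"
proof -
  obtain C where C: "\<And>t x. t \<ge> 0 \<Longrightarrow> \<bar>f t x\<bar> \<le> C * exp (- w * t)"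
    using assms(1) by (rule decayingD) (rule that)
  obtain C' where C': "\<And>t x. t \<ge> 0 \<Longrightarrow> \<bar>g t x\<bar> \<le> C' * exp (- w * t)"
    using assms(2) by (rule decayingD) (rule that)
  have "\<bar>f t x + g t x\<bar> \<le> (C + C') * exp (- w * t)" if "t \<ge> 0" for t x
    using C[OF that, of x] C'[OF that, of x] by (auto simp: algebra_simps)
  moreover have "continuous_on ({0..} \<times> UNIV) (\<lambda>(t, x). f t x + g t x)"
    using assms unfolding decaying_def case_prod_unfold by (auto intro: continuous_intros)
  ultimately show ?thesis unfolding decaying_def by blast
qed

lemma decaying_mult:
  assumes "decaying w f" "decaying w' g"
  shows "decaying (w + w') (\<lambda>t x. f t x * g t x)"
proof -
  obtain C where C: "C \<ge> 0" "\<And>t x. t \<ge> 0 \<Longrightarrow> \<bar>f t x\<bar> \<le> C * exp (- w * t)"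
    using assms(1) by (rule decayingD) (rule that)
  obtain C' where C': "C' \<ge> 0" "\<And>t x. t \<ge> 0 \<Longrightarrow> \<bar>g t x\<bar> \<le> C' * exp (- w' * t)"
    using assms(2) by (rule decayingD) (rule that)
  have "\<bar>f t x * g t x\<bar> \<le> (C * C') * exp (- (w + w') * t)" if "t \<ge> 0" for t x
  proof -
    have "\<bar>f t x * g t x\<bar> \<le> (C * exp (- w * t)) * (C' * exp (- w' * t))"
      unfolding abs_mult by (intro mult_mono C C' that) (use C in auto)
    also have "\<dots> = (C * C') * exp (- (w + w') * t)"
      by (simp add: algebra_simps flip: exp_add)
    finally show ?thesis .
  qed
  moreover have "continuous_on ({0..} \<times> UNIV) (\<lambda>(t, x). f t x * g t x)"
    using assms unfolding decaying_def case_prod_unfold by (auto intro: continuous_intros)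
  ultimately show ?thesis unfolding decaying_def by blast
qed

lemma Cdecay_add: "Cdecay n w f \<Longrightarrow> Cdecay n w g \<Longrightarrow> Cdecay n w (\<lambda>t x. f t x + g t x)"
proof (induction n arbitrary: f g)
  case 0
  then show ?case using decaying_add by auto
next
  case (Suc n)
  note f = CdecayD[OF Suc.prems(1)]
  note g = CdecayD[OF Suc.prems(2)]
  show ?case
    by (rule CdecayI[OF decaying_add[OF Suc.prems[THEN Cdecay_imp_decaying]]
          Suc.IH[OF f(1) g(1)] Suc.IH[OF f(2) g(2)]])
      (auto intro!: derivative_eq_intros f g)
qed

text \<open>Rates add because the bounds multiply. In the product rule one factor stays
  undifferentiated, hence the step down by \<open>Cdecay_SucD\<close> for that factor.\<close>

lemma Cdecay_mult_aux:
  "Cdecay n w f \<Longrightarrow> Cdecay n w' g \<Longrightarrow> Cdecay n (w + w') (\<lambda>t x. f t x * g t x)"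
proof (induction n arbitrary: f g)
  case 0
  then show ?case using decaying_mult by auto
next
  case (Suc n)
  note f = CdecayD[OF Suc.prems(1)]
  note g = CdecayD[OF Suc.prems(2)]
  note IH = Suc.IH[OF f(1) Cdecay_SucD[OF Suc.prems(2)]] Suc.IH[OF f(2) Cdecay_SucD[OF Suc.prems(2)]]
    Suc.IH[OF Cdecay_SucD[OF Suc.prems(1)] g(1)] Suc.IH[OF Cdecay_SucD[OF Suc.prems(1)] g(2)]
  show ?case
    by (rule CdecayI[OF decaying_mult[OF Suc.prems[THEN Cdecay_imp_decaying]]
          Cdecay_add[OF IH(1,3)] Cdecay_add[OF IH(2,4)]])
      (auto intro!: derivative_eq_intros f g)
qed

lemma Cdecay_mult:
  "Cdecay n w f \<Longrightarrow> Cdecay n w' g \<Longrightarrow> w'' \<le> w + w' \<Longrightarrow> Cdecay n w'' (\<lambda>t x. f t x * g t x)"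
  using Cdecay_mono[OF Cdecay_mult_aux] by blast

lemma Cdecay_cmult: "Cdecay n w f \<Longrightarrow> Cdecay n w (\<lambda>t x. c * f t x)"
  using Cdecay_mult[OF Cdecay_const, of n w f w c] by simp

lemma Cdecay_minus: "Cdecay n w f \<Longrightarrow> Cdecay n w (\<lambda>t x. - f t x)"
  using Cdecay_cmult[of n w f "-1"] by simp

lemma Cdecay_diff: "Cdecay n w f \<Longrightarrow> Cdecay n w g \<Longrightarrow> Cdecay n w (\<lambda>t x. f t x - g t x)"
  using Cdecay_add[OF _ Cdecay_minus, of n w f g] by simp

lemma decaying_inverse:
  assumes "decaying 0 f" "c > 0" "\<And>t x. t \<ge> 0 \<Longrightarrow> c \<le> \<bar>f t x\<bar>"
  shows "decaying 0 (\<lambda>t x. inverse (f t x))"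
proof -
  have nz: "f t x \<noteq> 0" if "t \<ge> 0" for t x using assms(2) assms(3)[OF that, of x] by auto
  have "continuous_on ({0..} \<times> UNIV) (\<lambda>(t, x). inverse (f t x))"
    using assms(1) nz unfolding decaying_def case_prod_unfold by (auto intro!: continuous_intros)
  moreover have "\<bar>inverse (f t x)\<bar> \<le> inverse c * exp (- 0 * t)" if "t \<ge> 0" for t x
    using assms(2) assms(3)[OF that, of x] by (auto simp: le_imp_inverse_le)
  ultimately show ?thesis unfolding decaying_def by blast
qed

text \<open>Differentiating 1 / f gives back 1 / f twice, so the induction closes with the same f.
  The lower bound has to be uniform in t and x for the reciprocal to stay bounded.\<close>

lemma Cdecay_inverse:
  assumes "c > 0" "\<And>t x. t \<ge> 0 \<Longrightarrow> c \<le> \<bar>f t x\<bar>"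
  shows "Cdecay n 0 f \<Longrightarrow> Cdecay n 0 (\<lambda>t x. inverse (f t x))"
proof (induction n)
  case 0
  then show ?case using decaying_inverse assms by auto
next
  case (Suc n)
  note f = CdecayD[OF Suc.prems(1)]
  note IH = Suc.IH[OF Cdecay_SucD[OF Suc.prems]]
  have nz: "f t x \<noteq> 0" if "t \<ge> 0" for t x using assms(1) assms(2)[OF that, of x] by auto
  have m: "Cdecay n 0 (\<lambda>t x. - (inverse (f t x) * g t x * inverse (f t x)))" if "Cdecay n 0 g" for g
    by (intro Cdecay_minus Cdecay_mult[where w=0 and w'=0] IH that) auto
  show ?case
    by (rule CdecayI[OF decaying_inverse[OF Cdecay_imp_decaying[OF Suc.prems] assms] m[OF f(1)] m[OF f(2)]])
      (auto intro!: derivative_eq_intros f nz)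
qed

lemma decaying_exp:
  assumes "decaying 0 f"
  shows "decaying 0 (\<lambda>t x. exp (f t x))"
proof -
  obtain C where C: "\<And>t x. t \<ge> 0 \<Longrightarrow> \<bar>f t x\<bar> \<le> C * exp (- 0 * t)"
    using assms by (rule decayingD) (rule that)
  have "\<bar>exp (f t x)\<bar> \<le> exp C * exp (- 0 * t)" if "t \<ge> 0" for t x
    using C[OF that, of x] by auto
  moreover have "continuous_on ({0..} \<times> UNIV) (\<lambda>(t, x). exp (f t x))"
    using assms unfolding decaying_def case_prod_unfold by (auto intro!: continuous_intros)
  ultimately show ?thesis unfolding decaying_def by blast
qed

lemma Cdecay_exp: "Cdecay n 0 f \<Longrightarrow> Cdecay n 0 (\<lambda>t x. exp (f t x))"
proof (induction n)
  case 0
  then show ?case using decaying_exp by auto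
next
  case (Suc n)
  note f = CdecayD[OF Suc.prems(1)]
  note IH = Suc.IH[OF Cdecay_SucD[OF Suc.prems]]
  have m: "Cdecay n 0 (\<lambda>t x. exp (f t x) * g t x)" if "Cdecay n 0 g" for g
    by (intro Cdecay_mult[where w=0 and w'=0] IH that) auto
  show ?case
    by (rule CdecayI[OF decaying_exp[OF Cdecay_imp_decaying[OF Suc.prems]] m[OF f(1)] m[OF f(2)]])
      (auto intro!: derivative_eq_intros f)
qed

text \<open>A phase makes the family closed under differentiation: the derivative is the same
  function with phase b + pi / 2.\<close>

lemma Cdecay_cos_shift: "Cdecay n 0 (\<lambda>t x. cos (x + b))"
proof -
  have d: "decaying 0 (\<lambda>t x. cos (x + b))" for b
    unfolding decaying_def case_prod_unfold
    by (auto intro!: continuous_intros exI[of _ 1])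
  show ?thesis
  proof (induction n arbitrary: b)
    case 0
    then show ?case using d by simp
  next
    case (Suc n)
    show ?case
      by (rule CdecayI[OF d Suc.IH[of "b + pi / 2"] Cdecay_zero])
        (auto intro!: derivative_eq_intros simp: cos_add sin_add)
  qed
qed

lemma Cdecay_cos: "Cdecay n 0 (\<lambda>t x. cos x)"
  using Cdecay_cos_shift[of n 0] by simp

lemma Cdecay_sin: "Cdecay n 0 (\<lambda>t x. sin x)"
  using Cdecay_cos_shift[of n "- pi / 2"] by (simp add: cos_diff)

text \<open>Chain rule on the closed quadrant. Total differentiability of P follows from one partial
  derivative in time and a continuous one in space, which also covers the boundary t = 0. The
  \<open>blinfun\<close> form is the one in which \<open>has_derivative_partialsI\<close> takes the
  continuous partial derivative.\<close>

lemma has_real_derivative_compose_evolution: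
  fixes P :: "real \<Rightarrow> real \<Rightarrow> real"
  assumes x: "\<And>t x. t \<ge> 0 \<Longrightarrow> (P t has_real_derivative Px t x) (at x)"
    and t: "\<And>t x. t \<ge> 0 \<Longrightarrow> ((\<lambda>s. P s x) has_real_derivative Pt t x) (at t within {0..})"
    and cont: "continuous_on ({0..} \<times> UNIV) (\<lambda>(t, x). Px t x)"
    and u: "(u has_real_derivative u') (at t within {0..})" and "t \<ge> 0"
  shows "((\<lambda>s. P s (u s)) has_real_derivative Pt t (u t) + Px t (u t) * u') (at t within {0..})"
proof -
  have J: "((\<lambda>(s, y). P s y) has_derivative
     (\<lambda>(ds, dy). ds * Pt t (u t) + blinfun_apply (blinfun_scaleR_left (Px t (u t))) dy))
     (at (t, u t) within {0..} \<times> UNIV)"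
  proof (rule has_derivative_partialsI)
    show "((\<lambda>s. P s (u t)) has_derivative (\<lambda>ds. ds * Pt t (u t))) (at t within {0..})"
      using t[OF \<open>t \<ge> 0\<close>, of "u t"]
      by (simp add: has_field_derivative_def mult.commute[of _ "Pt t (u t)"])
    show "(P s has_derivative blinfun_apply (blinfun_scaleR_left (Px s y))) (at y within UNIV)"
      if "s \<in> {0..}" for s y
      using x[of s y] that by (simp add: has_field_derivative_def mult.commute[of _ "Px s y"])
    have "continuous_on ({0..} \<times> UNIV) (\<lambda>z. blinfun_scaleR_left (case z of (s, y) \<Rightarrow> Px s y) :: real \<Rightarrow>\<^sub>L real)"
      by (intro continuous_intros cont)
    then have "continuous (at (t, u t) within {0..} \<times> UNIV)
        (\<lambda>z. blinfun_scaleR_left (case z of (s, y) \<Rightarrow> Px s y) :: real \<Rightarrow>\<^sub>L real)"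
      using \<open>t \<ge> 0\<close> by (auto simp: continuous_on_eq_continuous_within)
    then show "continuous (at (t, u t) within {0..} \<times> UNIV)
        (\<lambda>(s, y). blinfun_scaleR_left (Px s y) :: real \<Rightarrow>\<^sub>L real)"
      by (simp add: case_prod_unfold)
  qed auto
  have "((\<lambda>s. (s, u s)) has_derivative (\<lambda>h. (h, u' * h))) (at t within {0..})"
    using u unfolding has_field_derivative_def by (auto intro!: derivative_intros)
  then have "((\<lambda>s. P s (u s)) has_derivative (\<lambda>h. h * Pt t (u t) + (u' * h) * Px t (u t))) (at t within {0..})"
    by (rule_tac has_derivative_eq_rhs[OF has_derivative_in_compose[where g="\<lambda>(s, y). P s y" and f="\<lambda>s. (s, u s)",
        simplified, OF _ has_derivative_subset[OF J]]]) auto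
  then show ?thesis
    unfolding has_field_derivative_def by (rule has_derivative_eq_rhs) (auto simp: algebra_simps)
qed

definition Sdecay :: "real \<Rightarrow> (real \<Rightarrow> real \<Rightarrow> real) \<Rightarrow> bool" where
  "Sdecay w f \<longleftrightarrow> (\<forall>n. Cdecay n w f)"

lemma SdecayD:
  assumes "Sdecay w f"
  shows "Sdecay w (\<lambda>t. vd (f t))" "Sdecay w (dt f)"
    "t \<ge> 0 \<Longrightarrow> (f t has_real_derivative vd (f t) x) (at x)"
    "t \<ge> 0 \<Longrightarrow> ((\<lambda>s. f s x) has_real_derivative dt f t x) (at t within {0..})"
  using CdecayD[OF assms[unfolded Sdecay_def, rule_format]] by (simp_all add: Sdecay_def)

text \<open>A bootstrap rule, meant for functions whose derivatives are expressed through the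
  function itself.\<close>

lemma SdecayI:
  assumes "\<And>n. Cdecay n w f \<Longrightarrow> Cdecay (Suc n) w f" "decaying w f"
  shows "Sdecay w f"
  unfolding Sdecay_def
proof
  show "Cdecay n w f" for n by (induction n) (use assms in auto)
qed

lemma continuous_on_quadrant_compose:
  assumes "continuous_on ({0..} \<times> UNIV) (\<lambda>(t::real, x). f t x)"
    and "continuous_on S g" "continuous_on S h" "\<And>z. z \<in> S \<Longrightarrow> g z \<ge> 0"
  shows "continuous_on S (\<lambda>z. f (g z) (h z))"
  using continuous_on_compose2[OF assms(1) continuous_on_Pair[OF assms(2,3)]] assms(4)
  by auto

text \<open>P is taken with all orders because each differentiation replaces it by one of its
  derivatives, again composed with the shift, while u loses one order. The map is written x + u
  because the displacement u is bounded and the map itself is not.\<close>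

lemma Cdecay_compose_shift:
  assumes "w \<ge> 0"
  shows "Cdecay n 0 u \<Longrightarrow> Sdecay w P \<Longrightarrow> Cdecay n w (\<lambda>t x. P t (x + u t x))"
proof (induction n arbitrary: P)
  case 0
  then have P: "decaying w P" and u: "decaying 0 u"
    using Cdecay_imp_decaying by (auto simp: Sdecay_def)
  have "continuous_on ({0..} \<times> UNIV) (\<lambda>z. (\<lambda>(t, x). P t x) (fst z, snd z + u (fst z) (snd z)))"
    by (rule continuous_on_compose2[where s="{0..} \<times> UNIV" and t="{0..} \<times> UNIV"])
      (use P u in \<open>auto simp: decaying_def case_prod_unfold intro!: continuous_intros\<close>)
  then show ?case
    using P unfolding decaying_def by (auto simp: case_prod_unfold decaying_def)
next
  case (Suc n)
  have u: "Cdecay n 0 u" using Suc.prems(1) by (rule Cdecay_SucD)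
  note P = SdecayD[OF Suc.prems(2)]
  note ud = CdecayD[OF Suc.prems(1)]
  note IH = Suc.IH[OF u P(1)] Suc.IH[OF u P(2)]
  have Pd: "decaying w (\<lambda>t x. P t (x + u t x))"
    using Cdecay_imp_decaying[OF Suc.IH[OF u Suc.prems(2)]] .
  show ?case
  proof (rule CdecayI[OF Pd])
    show "Cdecay n w (\<lambda>t x. vd (P t) (x + u t x) * (1 + vd (u t) x))"
      by (rule Cdecay_mult[OF IH(1) Cdecay_add[OF Cdecay_const ud(1)]]) simp
    show "Cdecay n w (\<lambda>t x. dt P t (x + u t x) + vd (P t) (x + u t x) * dt u t x)"
      by (rule Cdecay_add[OF IH(2) Cdecay_mult[OF IH(1) ud(2)]]) simp
    fix t x :: real assume t: "t \<ge> 0"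
    have "((\<lambda>x. x + u t x) has_real_derivative (1 + vd (u t) x)) (at x)"
      by (auto intro!: derivative_eq_intros ud t)
    from DERIV_chain2[OF P(3)[OF t] this]
    show "((\<lambda>x. P t (x + u t x)) has_real_derivative vd (P t) (x + u t x) * (1 + vd (u t) x)) (at x)" .
    have cont: "continuous_on ({0..} \<times> UNIV) (\<lambda>(t, x). vd (P t) x)"
      using P(1) Cdecay_imp_decaying unfolding Sdecay_def decaying_def by blast
    have "((\<lambda>s. x + u s x) has_real_derivative dt u t x) (at t within {0..})"
      by (auto intro!: derivative_eq_intros ud t)
    from has_real_derivative_compose_evolution[OF P(3,4) cont this t]
    show "((\<lambda>s. P s (x + u s x)) has_real_derivative dt P t (x + u t x) + vd (P t) (x + u t x) * dt u t x) (at t within {0..})" .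
  qed
qed

lemma Sdecay_compose_shift:
  "Sdecay w P \<Longrightarrow> Sdecay 0 u \<Longrightarrow> w \<ge> 0 \<Longrightarrow> Sdecay w (\<lambda>t x. P t (x + u t x))"
  using Cdecay_compose_shift unfolding Sdecay_def by blast

lemma Sdecay_const: "Sdecay 0 (\<lambda>t x. c)"
  and Sdecay_cos: "Sdecay 0 (\<lambda>t x. cos x)"
  and Sdecay_sin: "Sdecay 0 (\<lambda>t x. sin x)"
  unfolding Sdecay_def by (simp_all add: Cdecay_const Cdecay_cos Cdecay_sin)

lemma Sdecay_add: "Sdecay w f \<Longrightarrow> Sdecay w g \<Longrightarrow> Sdecay w (\<lambda>t x. f t x + g t x)"
  unfolding Sdecay_def by (simp add: Cdecay_add)

lemma Sdecay_diff: "Sdecay w f \<Longrightarrow> Sdecay w g \<Longrightarrow> Sdecay w (\<lambda>t x. f t x - g t x)"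
  unfolding Sdecay_def by (simp add: Cdecay_diff)

lemma Sdecay_minus: "Sdecay w f \<Longrightarrow> Sdecay w (\<lambda>t x. - f t x)"
  unfolding Sdecay_def by (simp add: Cdecay_minus)

lemma Sdecay_cmult: "Sdecay w f \<Longrightarrow> Sdecay w (\<lambda>t x. c * f t x)"
  unfolding Sdecay_def by (simp add: Cdecay_cmult)

lemma Sdecay_mult: "Sdecay w1 f \<Longrightarrow> Sdecay w2 g \<Longrightarrow> w \<le> w1 + w2 \<Longrightarrow> Sdecay w (\<lambda>t x. f t x * g t x)"
  unfolding Sdecay_def using Cdecay_mult by blast

lemma Sdecay_mono: "Sdecay w f \<Longrightarrow> w' \<le> w \<Longrightarrow> Sdecay w' f"
  unfolding Sdecay_def using Cdecay_mono by blast

lemma Sdecay_cong: "Sdecay w f \<Longrightarrow> (\<And>t x. t \<ge> 0 \<Longrightarrow> g t x = f t x) \<Longrightarrow> Sdecay w g"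
  unfolding Sdecay_def using Cdecay_cong by blast

lemma Sdecay_inverse:
  "Sdecay 0 f \<Longrightarrow> c > 0 \<Longrightarrow> (\<And>t x. t \<ge> 0 \<Longrightarrow> c \<le> \<bar>f t x\<bar>) \<Longrightarrow> Sdecay 0 (\<lambda>t x. inverse (f t x))"
  unfolding Sdecay_def using Cdecay_inverse by blast

lemma Sdecay_imp_continuous:
  "Sdecay w f \<Longrightarrow> continuous_on ({0..} \<times> UNIV) (\<lambda>(t, x). f t x)"
  unfolding Sdecay_def using Cdecay_imp_decaying decaying_def by blast

lemma Sdecay_imp_bounded:
  assumes "Sdecay w f"
  obtains C where "C \<ge> 0" "\<And>t x. t \<ge> 0 \<Longrightarrow> \<bar>f t x\<bar> \<le> C * exp (- w * t)"
proof -
  have "decaying w f" using assms by (auto simp: Sdecay_def intro: Cdecay_imp_decaying)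
  then show ?thesis by (rule decayingD) (rule that)
qed

lemma Sdecay_smooth_evolution:
  assumes "Sdecay w f"
  shows "smooth_evolution f"
  using assms
proof (coinduction arbitrary: f)
  case smooth_evolution
  note f = SdecayD[OF this]
  show ?case
    using Sdecay_imp_continuous[OF smooth_evolution] f
    by (intro exI[of _ f] exI[of _ "\<lambda>t. vd (f t)"] exI[of _ "dt f"])
      (simp add: has_real_derivative_iff_has_vector_derivative)
qed

section \<open>Evolutions with values in the plane\<close>

lemma vector_2_eq_scaleR: "vector [a, b] = a *\<^sub>R (vector [1, 0] :: real^2) + b *\<^sub>R vector [0, 1]"
  by (simp add: vec_eq_iff forall_2)

lemma continuous_on_quadrant_vector:
  assumes "continuous_on S (\<lambda>(t, x). f t x)" "continuous_on S (\<lambda>(t, x). g t x)"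
  shows "continuous_on S (\<lambda>(t, x). vector [f t x, g t x] :: real^2)"
  unfolding vector_2_eq_scaleR[of "f _ _"] case_prod_unfold
  using assms unfolding case_prod_unfold by (intro continuous_intros)

lemma has_vector_derivative_vector_2:
  assumes "(f has_vector_derivative f') F" "(g has_vector_derivative g') F"
  shows "((\<lambda>x. vector [f x, g x] :: real^2) has_vector_derivative vector [f', g']) F"
  unfolding vector_2_eq_scaleR[of "f _"] vector_2_eq_scaleR[of f']
  using assms by (auto intro!: derivative_eq_intros simp: has_vector_derivative_def fun_eq_iff scaleR_add_right)

lemma smooth_evolutionE:
  assumes "smooth_evolution f"
  obtains fx ft where "continuous_on ({0..} \<times> UNIV) (\<lambda>(t, x). f t x)" "smooth_evolution fx" "smooth_evolution ft"
     "\<And>t x. t \<ge> 0 \<Longrightarrow> (f t has_vector_derivative fx t x) (at x)"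
     "\<And>t x. t \<ge> 0 \<Longrightarrow> ((\<lambda>s. f s x) has_vector_derivative ft t x) (at t within {0..})"
  using assms by cases blast

lemma smooth_evolution_continuous:
  assumes "smooth_evolution f"
  shows "continuous_on ({0..} \<times> UNIV) (\<lambda>(t, x). f t x)"
  using assms by cases blast

lemma smooth_evolution_vector:
  assumes "smooth_evolution f" "smooth_evolution g"
  shows "smooth_evolution (\<lambda>t x. vector [f t x, g t x] :: real^2)"
  using assms
proof (coinduction arbitrary: f g)
  case smooth_evolution
  obtain fx ft where f: "continuous_on ({0..} \<times> UNIV) (\<lambda>(t, x). f t x)" "smooth_evolution fx" "smooth_evolution ft"
     "\<And>t x. t \<ge> 0 \<Longrightarrow> (f t has_vector_derivative fx t x) (at x)"
     "\<And>t x. t \<ge> 0 \<Longrightarrow> ((\<lambda>s. f s x) has_vector_derivative ft t x) (at t within {0..})"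
    using smooth_evolution(1) by (rule smooth_evolutionE) (rule that)
  obtain gx gt where g: "continuous_on ({0..} \<times> UNIV) (\<lambda>(t, x). g t x)" "smooth_evolution gx" "smooth_evolution gt"
     "\<And>t x. t \<ge> 0 \<Longrightarrow> (g t has_vector_derivative gx t x) (at x)"
     "\<And>t x. t \<ge> 0 \<Longrightarrow> ((\<lambda>s. g s x) has_vector_derivative gt t x) (at t within {0..})"
    using smooth_evolution(2) by (rule smooth_evolutionE) (rule that)
  show ?case
  proof (intro exI conjI allI impI)
    show "continuous_on ({0..} \<times> UNIV) (\<lambda>(t, x). vector [f t x, g t x] :: real^2)"
      using f(1) g(1) by (rule continuous_on_quadrant_vector)
    show "((\<lambda>x. vector [f t x, g t x] :: real^2) has_vector_derivative vector [fx t x, gx t x]) (at x)"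
      if "0 \<le> t" for t x
      by (rule has_vector_derivative_vector_2[OF f(4)[OF that] g(4)[OF that]])
    show "((\<lambda>s. vector [f s x, g s x] :: real^2) has_vector_derivative vector [ft t x, gt t x]) (at t within {0..})"
      if "0 \<le> t" for t x
      by (rule has_vector_derivative_vector_2[OF f(5)[OF that] g(5)[OF that]])
  qed (use f g in auto)
qed

section \<open>Integrals of evolutions over time and over the curve parameter\<close>

lemma continuous_on_time_integral:
  fixes f :: "real \<Rightarrow> real \<Rightarrow> real"
  assumes "continuous_on ({0..} \<times> UNIV) (\<lambda>(t, x). f t x)"
  shows "continuous_on ({0..} \<times> UNIV) (\<lambda>(t, x). integral {0..t} (\<lambda>s. f s x))"
proof -
  have cont: "continuous_on {0..} (\<lambda>s. f s x)" for x
    by (rule continuous_on_quadrant_compose[OF assms]) (auto intro!: continuous_intros)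
  \<comment> \<open>The substitution s = t r moves t from the limit of integration into the
    integrand, where continuity in a parameter is available.\<close>
  have eq: "integral {0..t} (\<lambda>s. f s x) = t * integral {0..1} (\<lambda>r. f (t * r) x)" if "t \<ge> 0" for t x
  proof -
    have "((\<lambda>r. t *\<^sub>R f (t * r) x) has_integral integral {t * 0..t * 1} (\<lambda>s. f s x)) {0..1}"
    proof (rule has_integral_substitution)
      show "(*) t ` {0..1} \<subseteq> {0..t}" using that by (auto simp: mult_left_le)
      show "continuous_on {0..t} (\<lambda>s. f s x)" using cont by (rule continuous_on_subset) auto
      show "((*) t has_real_derivative t) (at r within {0..1})" for r
        by (auto intro!: derivative_eq_intros)
    qed (use that in auto)
    from integral_unique[OF this] show ?thesis by simp
  qed
  have "continuous_on ({0..} \<times> UNIV) (\<lambda>z. integral (cbox 0 1) (\<lambda>r::real. f (fst z * r) (snd z)))"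
  proof (rule integral_continuous_on_param)
    show "continuous_on (({0..} \<times> UNIV) \<times> cbox 0 1) (\<lambda>(z, r). f (fst z * r) (snd z))"
      unfolding case_prod_unfold
      by (rule continuous_on_quadrant_compose[where f=f]) (use assms in \<open>auto intro!: continuous_intros\<close>)
  qed
  then have "continuous_on ({0..} \<times> UNIV) (\<lambda>z. fst z * integral {0..1} (\<lambda>r::real. f (fst z * r) (snd z)))"
    by (auto intro!: continuous_intros)
  then show ?thesis
    by (rule continuous_on_eq) (auto simp: eq)
qed

lemma has_real_derivative_time_integral:
  assumes "continuous_on {0..} g" "t \<ge> 0"
  shows "((\<lambda>t. integral {0..t} g) has_real_derivative g t) (at t within {0..})"
proof -
  have "((\<lambda>t. integral {0..t} g) has_real_derivative g t) (at t within {0..t + 1})"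
    by (rule integral_has_real_derivative) (use assms in \<open>auto intro: continuous_on_subset\<close>)
  \<comment> \<open>The fundamental theorem needs a compact interval; near t it defines the same
    filter as the half-line.\<close>
  moreover have "at t within {0..t + 1} = at t within {0..}"
    by (rule at_within_nhd[of _ "{..<t + 1}"]) auto
  ultimately show ?thesis by simp
qed

lemma has_real_derivative_time_integral_param:
  fixes f :: "real \<Rightarrow> real \<Rightarrow> real"
  assumes "\<And>s x. s \<ge> 0 \<Longrightarrow> (f s has_real_derivative fx s x) (at x)"
    "continuous_on ({0..} \<times> UNIV) (\<lambda>(t, x). f t x)" "continuous_on ({0..} \<times> UNIV) (\<lambda>(t, x). fx t x)"
  shows "((\<lambda>x. integral {0..t} (\<lambda>s. f s x)) has_real_derivative integral {0..t} (\<lambda>s. fx s x)) (at x)"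
proof -
  have "((\<lambda>x. integral (cbox 0 t) (\<lambda>s. f s x)) has_real_derivative integral (cbox 0 t) (\<lambda>s. fx s x)) (at x within UNIV)"
  proof (rule leibniz_rule_field_derivative)
    show "(\<lambda>s. f s x) integrable_on cbox 0 t" for x
      by (intro integrable_continuous continuous_on_quadrant_compose[OF assms(2)])
        (auto intro!: continuous_intros)
    show "continuous_on (UNIV \<times> cbox 0 t) (\<lambda>(x, s). fx s x)"
      unfolding case_prod_unfold
      by (rule continuous_on_quadrant_compose[OF assms(3)]) (auto intro!: continuous_intros)
  qed (use assms in auto)
  then show ?thesis by simp
qed

lemma has_real_derivative_space_integral:
  fixes f :: "real \<Rightarrow> real \<Rightarrow> real"
  assumes "\<And>t x. t \<ge> 0 \<Longrightarrow> ((\<lambda>s. f s x) has_real_derivative ft t x) (at t within {0..})"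
    "\<And>t. t \<ge> 0 \<Longrightarrow> continuous_on UNIV (f t)" "continuous_on ({0..} \<times> UNIV) (\<lambda>(t, x). ft t x)" "t \<ge> 0"
  shows "((\<lambda>t. integral {a..b} (f t)) has_real_derivative integral {a..b} (ft t)) (at t within {0..})"
proof -
  have "((\<lambda>t. integral (cbox a b) (f t)) has_real_derivative integral (cbox a b) (ft t)) (at t within {0..})"
  proof (rule leibniz_rule_field_derivative)
    show "(f t) integrable_on cbox a b" if "t \<in> {0..}" for t
      by (rule integrable_continuous) (use assms(2)[of t] that in \<open>auto intro: continuous_on_subset\<close>)
    show "continuous_on ({0..} \<times> cbox a b) (\<lambda>(t, x). ft t x)"
      using assms(3) by (rule continuous_on_subset) auto
  qed (use assms in auto)
  then show ?thesis by simp
qed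

subsection \<open>Exponentially convergent evolutions\<close>

lemma decaying_slice_continuous:
  "decaying w f \<Longrightarrow> t \<ge> 0 \<Longrightarrow> continuous_on S (f t)"
  unfolding decaying_def by (intro continuous_on_quadrant_compose[of f]) auto

lemma decaying_path_continuous:
  "decaying w f \<Longrightarrow> S \<subseteq> {0..} \<Longrightarrow> continuous_on S (\<lambda>t. f t x)"
  unfolding decaying_def by (intro continuous_on_quadrant_compose[of f]) auto

lemma decaying_time_integral:
  assumes "decaying w f" "w > 0"
  shows "decaying 0 (\<lambda>t x. integral {0..t} (\<lambda>s. f s x))"
proof -
  obtain C where C: "C \<ge> 0" "\<And>t x. t \<ge> 0 \<Longrightarrow> \<bar>f t x\<bar> \<le> C * exp (- w * t)"
    using assms(1) by (rule decayingD) (rule that)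
  \<comment> \<open>The constant C / w is the integral of C exp (- w s) over the whole
    half-line.\<close>
  have "\<bar>integral {0..t} (\<lambda>s. f s x)\<bar> \<le> C / w * exp (- 0 * t)" if "t \<ge> 0" for t x
  proof -
    have *: "((\<lambda>s. C * exp (- w * s)) has_integral (- C / w * exp (- w * t) - - C / w * exp (- w * 0))) {0..t}"
      using that \<open>w > 0\<close>
      by (intro fundamental_theorem_of_calculus)
        (auto intro!: derivative_eq_intros simp flip: has_real_derivative_iff_has_vector_derivative)
    have "norm (integral {0..t} (\<lambda>s. f s x)) \<le> integral {0..t} (\<lambda>s. C * exp (- w * s))"
      by (intro integral_norm_bound_integral has_integral_integrable[OF *] integrable_continuous_real
          decaying_path_continuous[OF assms(1)]) (use C(2)[of _ x] in auto)
    also have "\<dots> = - C / w * exp (- w * t) - - C / w * exp (- w * 0)"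
      using * by (rule integral_unique)
    also have "\<dots> \<le> C / w"
      using C(1) \<open>w > 0\<close> by simp
    finally show ?thesis by simp
  qed
  then show ?thesis
    using continuous_on_time_integral[of f] assms(1) unfolding decaying_def by blast
qed

text \<open>In x the derivative passes under the integral, and in t it is f itself, whose rate w > 0
  is in particular rate 0.\<close>

lemma Cdecay_time_integral:
  assumes "w > 0"
  shows "Cdecay n w f \<Longrightarrow> Cdecay n 0 (\<lambda>t x. integral {0..t} (\<lambda>s. f s x))"
proof (induction n arbitrary: f)
  case 0
  then show ?case using decaying_time_integral assms by auto
next
  case (Suc n)
  note f = CdecayD[OF Suc.prems(1)]
  have fd: "decaying w f" by (rule Cdecay_imp_decaying[OF Suc.prems])
  show ?case
  proof (rule CdecayI[OF decaying_time_integral[OF fd \<open>w > 0\<close>] Suc.IH[OF f(1)]])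
    show "Cdecay n 0 f"
      by (rule Cdecay_mono[OF Cdecay_SucD[OF Suc.prems]]) (use \<open>w > 0\<close> in simp)
    show "((\<lambda>x. integral {0..t} (\<lambda>s. f s x)) has_real_derivative integral {0..t} (\<lambda>s. vd (f s) x)) (at x)" for t x
      by (rule has_real_derivative_time_integral_param[OF f(3)])
        (use fd Cdecay_imp_decaying[OF f(1)] in \<open>auto simp: decaying_def\<close>)
    show "((\<lambda>t. integral {0..t} (\<lambda>s. f s x)) has_real_derivative f t x) (at t within {0..})"
      if "t \<ge> 0" for t x
      using that by (intro has_real_derivative_time_integral decaying_path_continuous[OF fd]) auto
  qed
qed

lemma Sdecay_time_integral:
  "Sdecay w f \<Longrightarrow> w > 0 \<Longrightarrow> Sdecay 0 (\<lambda>t x. integral {0..t} (\<lambda>s. f s x))"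
  unfolding Sdecay_def using Cdecay_time_integral by blast

text \<open>The integral is regarded as a function constant in x, so that functions of time alone
  belong to the same classes.\<close>

lemma decaying_space_integral:
  assumes "decaying w f" "a \<le> b"
  shows "decaying w (\<lambda>t x. integral {a..b} (f t))"
proof -
  obtain C where C: "C \<ge> 0" "\<And>t x. t \<ge> 0 \<Longrightarrow> \<bar>f t x\<bar> \<le> C * exp (- w * t)"
    using assms(1) by (rule decayingD) (rule that)
  have "\<bar>integral {a..b} (f t)\<bar> \<le> (C * (b - a)) * exp (- w * t)" if "t \<ge> 0" for t
  proof -
    have "norm (integral {a..b} (f t)) \<le> C * exp (- w * t) * (b - a)"
      by (rule integral_bound[OF assms(2) decaying_slice_continuous[OF assms(1) that]]) (use C(2)[OF that] in auto)
    then show ?thesis by (simp add: algebra_simps)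
  qed
  moreover have "continuous_on {0..} (\<lambda>t. integral (cbox a b) (f t))"
    using assms(1) unfolding decaying_def
    by (intro integral_continuous_on_param) (auto intro: continuous_on_subset)
  then have "continuous_on ({0..} \<times> (UNIV :: real set)) (\<lambda>z. integral (cbox a b) (f (fst z)))"
    by (rule continuous_on_compose2[OF _ continuous_on_fst[OF continuous_on_id]]) auto
  then have "continuous_on ({0..} \<times> (UNIV :: real set)) (\<lambda>(t, x). integral {a..b} (f t))"
    by (simp add: case_prod_unfold)
  ultimately show ?thesis unfolding decaying_def by blast
qed

lemma Cdecay_space_integral:
  assumes "a \<le> b"
  shows "Cdecay n w f \<Longrightarrow> Cdecay n w (\<lambda>t x. integral {a..b} (f t))"
proof (induction n arbitrary: f)
  case 0
  then show ?case using decaying_space_integral assms by auto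
next
  case (Suc n)
  note f = CdecayD[OF Suc.prems(1)]
  have fd: "decaying w f" by (rule Cdecay_imp_decaying[OF Suc.prems])
  show ?case
  proof (rule CdecayI[OF decaying_space_integral[OF fd assms] Cdecay_zero Suc.IH[OF f(2)]])
    show "((\<lambda>t. integral {a..b} (f t)) has_real_derivative integral {a..b} (dt f t)) (at t within {0..})"
      if "t \<ge> 0" for t x
      using that Cdecay_imp_decaying[OF f(2)]
      by (intro has_real_derivative_space_integral f decaying_slice_continuous[OF fd]) (auto simp: decaying_def)
  qed auto
qed

lemma Sdecay_space_integral:
  "Sdecay w f \<Longrightarrow> a \<le> b \<Longrightarrow> Sdecay w (\<lambda>t x. integral {a..b} (f t))"
  unfolding Sdecay_def using Cdecay_space_integral by blast

section \<open>Smooth and periodic functions of one variable\<close>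

lemma smoothD: "smooth f \<Longrightarrow> (f has_vector_derivative vd f x) (at x)"
  unfolding smooth_def vd_def
  by (metis eq_id_iff funpow_0 vector_derivative_works)

lemma smooth_vd: "smooth f \<Longrightarrow> smooth (vd f)"
  unfolding smooth_def by (metis funpow_Suc_right o_apply)

lemma smooth_continuous: "smooth f \<Longrightarrow> continuous_on S f"
  by (meson continuous_at_imp_continuous_on has_vector_derivative_continuous smoothD)

text \<open>A coinduction principle: X plays the part of an invariant closed under
  differentiation.\<close>

lemma smoothI:
  assumes "X f" "\<And>f. X f \<Longrightarrow> \<exists>f'. X f' \<and> (\<forall>x. (f has_vector_derivative f' x) (at x))"
  shows "smooth f"
proof -
  have vd: "X (vd f)" if "X f" for f using assms(2)[OF that] vd_eqI by metis
  have "X ((vd ^^ k) f)" for k by (induction k) (use assms(1) vd in auto)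
  then show ?thesis
    unfolding smooth_def using assms(2) differentiableI_vector by blast
qed

lemma smooth_vector:
  assumes "smooth f" "smooth g"
  shows "smooth (\<lambda>x. vector [f x, g x] :: real^2)"
proof (rule smoothI[where X="\<lambda>h. \<exists>f g. smooth f \<and> smooth g \<and> h = (\<lambda>x. vector [f x, g x])"])
  fix h :: "real \<Rightarrow> real^2"
  assume "\<exists>f g. smooth f \<and> smooth g \<and> h = (\<lambda>x. vector [f x, g x])"
  then obtain f g where h: "smooth f" "smooth g" "h = (\<lambda>x. vector [f x, g x])" by blast
  then show "\<exists>f'. (\<exists>f g. smooth f \<and> smooth g \<and> f' = (\<lambda>x. vector [f x, g x])) \<and>
    (\<forall>x. (h has_vector_derivative f' x) (at x))"
    by (intro exI[of _ "\<lambda>x. vector [vd f x, vd g x]"] conjI exI[of _ "vd f"] exI[of _ "vd g"])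
      (simp_all add: smooth_vd has_vector_derivative_vector_2 smoothD)
qed (use assms in blast)

lemma vd_funpow_vector:
  assumes "smooth f" "smooth g"
  shows "(vd ^^ k) (\<lambda>x. vector [f x, g x] :: real^2) = (\<lambda>x. vector [(vd ^^ k) f x, (vd ^^ k) g x])"
  using assms
proof (induction k arbitrary: f g)
  case (Suc k)
  have "vd (\<lambda>x. vector [f x, g x] :: real^2) = (\<lambda>x. vector [vd f x, vd g x])"
    by (rule vd_eqI) (simp add: Suc.prems has_vector_derivative_vector_2 smoothD)
  with Suc.IH[OF smooth_vd smooth_vd, OF Suc.prems] show ?case
    by (simp add: funpow_Suc_right del: funpow.simps)
qed simp

lemmas Sdecay_vd = SdecayD(1,3)

lemma Sdecay_smooth:
  assumes "Sdecay w f" "t \<ge> 0"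
  shows "smooth (f t)"
proof (rule smoothI[where X="\<lambda>g. \<exists>f. Sdecay w f \<and> g = f t"])
  fix g assume "\<exists>f. Sdecay w f \<and> g = f t"
  then obtain f where "Sdecay w f" "g = f t" by blast
  with Sdecay_vd[OF this(1)] \<open>t \<ge> 0\<close>
  show "\<exists>f'. (\<exists>f. Sdecay w f \<and> f' = f t) \<and> (\<forall>x. (g has_vector_derivative f' x) (at x))"
    unfolding has_real_derivative_iff_has_vector_derivative by blast
qed (use assms in blast)

lemma periodic_vd:
  assumes "smooth f" "\<And>x. f (x + p) = f x"
  shows "vd f (x + p) = vd f x"
proof -
  have "((\<lambda>x. f (x + p)) has_vector_derivative (1 *\<^sub>R vd f (x + p))) (at x)"
    by (rule vector_diff_chain_at[of "\<lambda>x. x + p" 1 x f, unfolded o_def])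
      (auto intro!: derivative_eq_intros smoothD assms)
  then have "(f has_vector_derivative vd f (x + p)) (at x)" using assms(2) by simp
  then show ?thesis using smoothD[OF assms(1)] vector_derivative_unique_at by blast
qed

lemma periodic_reduce:
  fixes f :: "real \<Rightarrow> 'a"
  assumes "\<And>x. f (x + p) = f x" "p > 0"
  obtains y where "y \<in> {0..p}" "f x = f y"
proof -
  interpret periodic_fun_simple f p by unfold_locales (rule assms)
  have "f x = f (x - of_int \<lfloor>x / p\<rfloor> * p)" by (simp add: minus_of_int)
  moreover have "x - of_int \<lfloor>x / p\<rfloor> * p \<in> {0..p}"
    using \<open>p > 0\<close> floor_divide_lower[of p x] floor_divide_upper[of p x] by (auto simp: algebra_simps)
  ultimately show ?thesis using that by blast
qed

lemma periodic_bounded: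
  fixes f :: "real \<Rightarrow> real"
  assumes "continuous_on UNIV f" "\<And>x. f (x + p) = f x" "p > 0"
  obtains C where "\<And>x. \<bar>f x\<bar> \<le> C"
proof -
  have "bounded (f ` {0..p})"
    by (intro compact_imp_bounded compact_continuous_image continuous_on_subset[OF assms(1)]) auto
  then obtain C where C: "\<forall>x\<in>{0..p}. \<bar>f x\<bar> \<le> C"
    unfolding bounded_iff by auto
  have "\<bar>f x\<bar> \<le> C" for x
    using periodic_reduce[of f p x, OF assms(2,3)] C by metis
  then show ?thesis by (rule that)
qed

lemma Cdecay_smooth_periodic:
  assumes "p > 0"
  shows "smooth f \<Longrightarrow> (\<And>x. f (x + p) = f x) \<Longrightarrow> Cdecay n 0 (\<lambda>t. f)"
proof (induction n arbitrary: f)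
  case 0
  obtain C where "\<And>x. \<bar>f x\<bar> \<le> C"
    using smooth_continuous[OF 0(1)] 0(2) assms by (rule periodic_bounded) (rule that)
  then show ?case
    unfolding Cdecay.simps decaying_def case_prod_unfold
    using continuous_on_compose2[OF smooth_continuous[OF 0(1), of UNIV] continuous_on_snd]
    by (auto intro: continuous_intros)
next
  case (Suc n)
  have d: "decaying 0 (\<lambda>t. f)" using Suc.IH[OF Suc.prems] by (rule Cdecay_imp_decaying)
  have "Cdecay n 0 (\<lambda>t. vd f)" by (rule Suc.IH[OF smooth_vd periodic_vd]) (use Suc.prems in auto)
  then show ?case
    by (rule CdecayI[OF d _ Cdecay_zero])
      (use smoothD[OF Suc.prems(1)] in \<open>auto simp: has_real_derivative_iff_has_vector_derivative\<close>)
qed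

lemma Sdecay_smooth_periodic:
  "smooth f \<Longrightarrow> (\<And>x. f (x + p) = f x) \<Longrightarrow> p > 0 \<Longrightarrow> Sdecay 0 (\<lambda>t. f)"
  unfolding Sdecay_def using Cdecay_smooth_periodic by blast

text \<open>The time derivative is integrable over the half-line together with all its derivatives,
  which forces convergence in every C^k.\<close>

definition settling :: "(real \<Rightarrow> real \<Rightarrow> real) \<Rightarrow> bool" where
  "settling f \<longleftrightarrow> Sdecay 0 f \<and> (\<exists>h w. w > 0 \<and> Sdecay w h \<and>
     (\<forall>t\<ge>0. \<forall>x. ((\<lambda>s. f s x) has_real_derivative h t x) (at t within {0..})))"

lemma settlingI:
  assumes "Sdecay 0 f" "Sdecay w h" "w > 0"
    "\<And>t x. t \<ge> 0 \<Longrightarrow> ((\<lambda>s. f s x) has_real_derivative h t x) (at t within {0..})"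
  shows "settling f"
  using assms unfolding settling_def by blast

text \<open>The point is that the derivatives in x and in t commute. This is read off from f t = f 0
  + (integral of h), differentiated under the integral.\<close>

lemma settling_vd:
  assumes "settling f"
  shows "settling (\<lambda>t. vd (f t))"
proof -
  from assms obtain h w where f: "Sdecay 0 f" and h: "w > 0" "Sdecay w h"
    and fh: "\<And>t x. t \<ge> 0 \<Longrightarrow> ((\<lambda>s. f s x) has_real_derivative h t x) (at t within {0..})"
    unfolding settling_def by blast
  have cont: "continuous_on {0..} (\<lambda>t. g t x)" if "Sdecay w g" for g x
    by (rule continuous_on_quadrant_compose[OF Sdecay_imp_continuous[OF that]]) auto
  note hx = Sdecay_vd[OF h(2)]
  have eq: "f t x = f 0 x + integral {0..t} (\<lambda>s. h s x)" if "t \<ge> 0" for t x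
  proof -
    have "((\<lambda>s. h s x) has_integral (f t x - f 0 x)) {0..t}"
      using that fh[of _ x, THEN DERIV_subset]
      by (intro fundamental_theorem_of_calculus) (auto simp flip: has_real_derivative_iff_has_vector_derivative)
    from integral_unique[OF this] show ?thesis by simp
  qed
  have vd_eq: "vd (f t) x = vd (f 0) x + integral {0..t} (\<lambda>s. vd (h s) x)" if "t \<ge> 0" for t x
  proof -
    have "((\<lambda>x. f 0 x + integral {0..t} (\<lambda>s. h s x)) has_real_derivative
        vd (f 0) x + integral {0..t} (\<lambda>s. vd (h s) x)) (at x)"
      by (intro DERIV_add Sdecay_vd[OF f] has_real_derivative_time_integral_param hx Sdecay_imp_continuous[OF h(2)]
          Sdecay_imp_continuous[OF hx(1)]) auto
    moreover have "f t = (\<lambda>x. f 0 x + integral {0..t} (\<lambda>s. h s x))" by (intro ext eq that)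
    ultimately have "(f t has_real_derivative vd (f 0) x + integral {0..t} (\<lambda>s. vd (h s) x)) (at x)" by simp
    then show ?thesis using Sdecay_vd(2)[OF f that] DERIV_unique by blast
  qed
  have "((\<lambda>s. vd (f s) x) has_real_derivative vd (h t) x) (at t within {0..})" if "t \<ge> 0" for t x
  proof (rule has_real_derivative_cong_halfline)
    show "((\<lambda>t. vd (f 0) x + integral {0..t} (\<lambda>s. vd (h s) x)) has_real_derivative vd (h t) x) (at t within {0..})"
      using DERIV_add[OF DERIV_const has_real_derivative_time_integral[OF cont[OF hx(1)] that]] by simp
  qed (use that in \<open>auto intro: vd_eq\<close>)
  then show ?thesis
    unfolding settling_def using Sdecay_vd(1)[OF f] hx(1) h(1) by blast
qed

lemma settling_vd_funpow: "settling f \<Longrightarrow> settling (\<lambda>t. (vd ^^ k) (f t))"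
  by (induction k) (auto dest: settling_vd)

lemma settling_limit:
  assumes "settling f"
  obtains l where "uniform_limit UNIV f l at_top"
proof -
  from assms obtain h w where f: "Sdecay 0 f" and h: "w > 0" "Sdecay w h"
    and fh: "\<And>t x. t \<ge> 0 \<Longrightarrow> ((\<lambda>s. f s x) has_real_derivative h t x) (at t within {0..})"
    unfolding settling_def by blast
  obtain C where C: "C \<ge> 0" "\<And>t x. t \<ge> 0 \<Longrightarrow> \<bar>h t x\<bar> \<le> C * exp (- w * t)"
    using h(2) by (rule Sdecay_imp_bounded) (rule that)
  \<comment> \<open>The bound is the tail of the integral of C exp (- w s) from t on: a Cauchy
    estimate uniform in x.\<close>
  have bd: "\<bar>f t' x - f t x\<bar> \<le> C / w * exp (- w * t)" if "0 \<le> t" "t \<le> t'" for t t' x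
  proof (cases "t = t'")
    case False
    have "norm (f t' x - f t x) \<le> - C / w * exp (- w * t') - - C / w * exp (- w * t)"
    proof (rule differentiable_bound_general[where f'="\<lambda>s. h s x" and \<phi>'="\<lambda>s. C * exp (- w * s)"])
      show "continuous_on {t..t'} (\<lambda>s. f s x)"
        by (rule continuous_on_quadrant_compose[OF Sdecay_imp_continuous[OF f]]) (use that in auto)
      show "((\<lambda>s. f s x) has_vector_derivative h s x) (at s)" if "t < s" "s < t'" for s
      proof -
        have "at s within {0..} = at s"
          by (rule at_within_interior) (use that \<open>0 \<le> t\<close> in simp)
        then show ?thesis
          using fh[of s x] that \<open>0 \<le> t\<close> by (simp add: has_real_derivative_iff_has_vector_derivative)
      qed
      show "norm (h s x) \<le> C * exp (- w * s)" if "t < s" "s < t'" for s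
        using C(2)[of s x] that \<open>0 \<le> t\<close> by simp
    qed (use that False \<open>w > 0\<close> in \<open>auto intro!: continuous_intros derivative_eq_intros
           simp flip: has_real_derivative_iff_has_vector_derivative\<close>)
    also have "\<dots> \<le> C / w * exp (- w * t)" using C(1) \<open>w > 0\<close> by simp
    finally show ?thesis by simp
  qed (use C(1) \<open>w > 0\<close> in simp)
  have "filterlim (\<lambda>t. - w * t) at_bot at_top"
    by (rule filterlim_tendsto_neg_mult_at_bot[OF tendsto_const]) (use \<open>w > 0\<close> filterlim_ident in auto)
  from tendsto_mult_left[OF filterlim_compose[OF exp_at_bot this], of "C / w"]
  have lim0: "((\<lambda>t. C / w * exp (- w * t)) \<longlongrightarrow> 0) at_top" by simp
  have "convergent (\<lambda>n. f (real n) x)" for x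
  proof (rule Cauchy_convergent, unfold Cauchy_altdef, intro allI impI)
    fix e :: real assume "e > 0"
    then have "\<forall>\<^sub>F n in sequentially. C / w * exp (- w * real n) < e"
      using order_tendstoD(2)[OF lim0] filterlim_real_sequentially by (auto simp: filterlim_iff)
    then obtain M where M: "\<And>m. m \<ge> M \<Longrightarrow> C / w * exp (- w * real m) < e"
      unfolding eventually_sequentially by blast
    have "dist (f (real m) x) (f (real n) x) < e" if "M \<le> m" "m < n" for m n
    proof -
      have "dist (f (real m) x) (f (real n) x) = \<bar>f (real n) x - f (real m) x\<bar>"
        by (simp add: dist_real_def abs_minus_commute)
      also have "\<dots> \<le> C / w * exp (- w * real m)" by (rule bd) (use that in auto)
      also have "\<dots> < e" by (rule M[OF that(1)])
      finally show ?thesis .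
    qed
    then show "\<exists>M. \<forall>m\<ge>M. \<forall>n>m. dist (f (real m) x) (f (real n) x) < e" by blast
  qed
  then obtain l where l: "\<And>x. (\<lambda>n. f (real n) x) \<longlonglongrightarrow> l x"
    unfolding convergent_def by metis
  have "uniform_limit UNIV f l at_top"
  proof (rule uniform_limitI)
    fix e :: real assume "e > 0"
    \<comment> \<open>Letting n tend to infinity in \<open>bd\<close> carries the bound over to the
      limit.\<close>
    have le: "\<bar>l x - f t x\<bar> \<le> C / w * exp (- w * t)" if "t \<ge> 0" for t x
    proof (rule tendsto_upperbound)
      show "(\<lambda>n. \<bar>f (real n) x - f t x\<bar>) \<longlonglongrightarrow> \<bar>l x - f t x\<bar>"
        by (intro tendsto_intros l)
      have "\<forall>\<^sub>F n in sequentially. t \<le> real n"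
        using filterlim_real_sequentially by (auto simp: filterlim_at_top)
      then show "\<forall>\<^sub>F n in sequentially. \<bar>f (real n) x - f t x\<bar> \<le> C / w * exp (- w * t)"
        by eventually_elim (use bd[OF that] in blast)
    qed simp
    show "\<forall>\<^sub>F t in at_top. \<forall>x\<in>UNIV. dist (f t x) (l x) < e"
      using order_tendstoD(2)[OF lim0 \<open>e > 0\<close>] eventually_ge_at_top[of 0]
    proof eventually_elim
      case (elim t)
      have "dist (f t x) (l x) < e" for x
        using le_less_trans[OF le[OF elim(2), of x] elim(1)] by (simp add: dist_real_def abs_minus_commute)
      then show ?case by blast
    qed
  qed
  then show ?thesis by (rule that)
qed

text \<open>All derivatives converge uniformly, and uniform convergence identifies the limit of the
  derivatives of order k + 1 with the derivative of the limit of those of order k. Integer times are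
  enough for this.\<close>

lemma settling_smooth_limit:
  assumes "settling f"
  obtains g where "smooth g" "\<And>k. uniform_limit UNIV (\<lambda>t. (vd ^^ k) (f t)) ((vd ^^ k) g) at_top"
proof -
  have "\<exists>l. uniform_limit UNIV (\<lambda>t. (vd ^^ k) (f t)) l at_top" for k
    using settling_limit[OF settling_vd_funpow[OF assms]] by metis
  then obtain G where G: "\<And>k. uniform_limit UNIV (\<lambda>t. (vd ^^ k) (f t)) (G k) at_top" by metis
  have D: "(G k has_vector_derivative G (Suc k) x) (at x)" for k x
  proof -
    have Gn: "uniform_limit UNIV (\<lambda>n. (vd ^^ k) (f (real n))) (G k) sequentially" for k
      using filterlim_compose[OF G filterlim_real_sequentially] .
    have "((vd ^^ k) (f (real n)) has_real_derivative (vd ^^ Suc k) (f (real n)) y) (at y)" for n y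
      using settling_vd_funpow[OF assms, of k] Sdecay_vd(2)[of 0 "\<lambda>t. (vd ^^ k) (f t)" "real n" y]
      unfolding settling_def by simp
    moreover have "(\<lambda>n. (vd ^^ k) (f (real n)) 0) \<longlonglongrightarrow> G k 0"
      using tendsto_uniform_limitI[OF Gn] by blast
    ultimately have "\<exists>g. \<forall>y\<in>UNIV. (\<lambda>n. (vd ^^ k) (f (real n)) y) \<longlonglongrightarrow> g y \<and>
        (g has_derivative (\<lambda>h. G (Suc k) y * h)) (at y within UNIV)"
    proof (intro has_derivative_sequence)
      fix e :: real assume "e > 0"
      show "\<forall>\<^sub>F n in sequentially. \<forall>x\<in>UNIV. \<forall>h.
          norm ((vd ^^ Suc k) (f (real n)) x * h - G (Suc k) x * h) \<le> e * norm h"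
        using uniform_limitD[OF Gn \<open>e > 0\<close>, of "Suc k"]
      proof eventually_elim
        case (elim n)
        have "norm ((vd ^^ Suc k) (f (real n)) x * h - G (Suc k) x * h) \<le> e * norm h" for x h
          using mult_right_mono[OF less_imp_le[OF elim[rule_format, OF UNIV_I, of x]], of "norm h"]
          by (simp add: dist_norm abs_mult del: funpow.simps flip: left_diff_distrib)
        then show ?case by blast
      qed
    qed (auto simp: has_field_derivative_def)
    then obtain g where g: "\<And>y. (\<lambda>n. (vd ^^ k) (f (real n)) y) \<longlonglongrightarrow> g y"
       "\<And>y. (g has_derivative (\<lambda>h. G (Suc k) y * h)) (at y)" by auto
    have "g = G k"
      using g(1) tendsto_uniform_limitI[OF Gn] LIMSEQ_unique by (intro ext) blast
    then show ?thesis
      using g(2)[of x] by (simp add: has_field_derivative_def flip: has_real_derivative_iff_has_vector_derivative)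
  qed
  have "(vd ^^ k) (G 0) = G k" for k
    by (induction k) (use vd_eqI[OF D] in auto)
  moreover have "smooth (G 0)"
    by (rule smoothI[where X="\<lambda>g. \<exists>k. g = G k"]) (use D in blast)+
  ultimately show ?thesis using that[of "G 0"] G by simp
qed

lemma tendsto_smoothly_vector:
  assumes "\<And>t. t \<ge> 0 \<Longrightarrow> smooth (f t)" "\<And>t. t \<ge> 0 \<Longrightarrow> smooth (f' t)" "smooth g" "smooth g'"
    and "\<And>k. uniform_limit UNIV (\<lambda>t. (vd ^^ k) (f t)) ((vd ^^ k) g) at_top"
    and "\<And>k. uniform_limit UNIV (\<lambda>t. (vd ^^ k) (f' t)) ((vd ^^ k) g') at_top"
  shows "tendsto_smoothly (\<lambda>t x. vector [f t x, f' t x]) (\<lambda>x. vector [g x, g' x])"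
  unfolding tendsto_smoothly_def
proof
  fix k
  have "uniform_limit UNIV (\<lambda>t x. vector [(vd ^^ k) (f t) x, (vd ^^ k) (f' t) x] :: real^2)
    (\<lambda>x. vector [(vd ^^ k) g x, (vd ^^ k) g' x]) at_top"
    unfolding vector_2_eq_scaleR[of "(vd ^^ k) _ _"]
    by (intro uniform_limit_intros bounded_linear.uniform_limit[OF bounded_linear_scaleR_left] assms)
  moreover have "\<forall>\<^sub>F t in at_top. \<forall>x\<in>UNIV. vector [(vd ^^ k) (f t) x, (vd ^^ k) (f' t) x] =
      ((vd ^^ k) (\<lambda>x. vector [f t x, f' t x] :: real^2)) x"
    using eventually_ge_at_top[of 0] by eventually_elim (simp add: assms vd_funpow_vector)
  note uniform_limit_cong[OF this refl]
  ultimately show "uniform_limit UNIV (\<lambda>t. (vd ^^ k) (\<lambda>x. vector [f t x, f' t x] :: real^2))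
    ((vd ^^ k) (\<lambda>x. vector [g x, g' x])) at_top"
    unfolding vd_funpow_vector[OF assms(3,4)] by blast
qed

subsection \<open>Fourier series of periodic functions\<close>

lemma has_integral_cos_period:
  "((\<lambda>x. cos (of_int m * x)) has_integral (if m = 0 then 2 * pi else 0)) {0..2 * pi}"
proof (cases "m = 0")
  case True
  then show ?thesis using has_integral_const_real[of "1::real" 0 "2 * pi"] by simp
next
  case False
  have "((\<lambda>x. cos (of_int m * x)) has_integral (sin (of_int m * (2 * pi)) / of_int m - sin (of_int m * 0) / of_int m)) {0..2 * pi}"
    using False
    by (intro fundamental_theorem_of_calculus)
      (auto intro!: derivative_eq_intros simp flip: has_real_derivative_iff_has_vector_derivative)
  moreover have "sin (of_int m * (2 * pi)) = 0"
    using sin_int_2pin[of m] by (simp add: mult.commute)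
  ultimately show ?thesis using False by simp
qed

lemma has_integral_sin_period:
  "((\<lambda>x. sin (of_int m * x)) has_integral 0) {0..2 * pi}"
proof (cases "m = 0")
  case True
  then show ?thesis by simp
next
  case False
  have "((\<lambda>x. sin (of_int m * x)) has_integral (- cos (of_int m * (2 * pi)) / of_int m - - cos (of_int m * 0) / of_int m)) {0..2 * pi}"
    using False
    by (intro fundamental_theorem_of_calculus)
      (auto intro!: derivative_eq_intros simp flip: has_real_derivative_iff_has_vector_derivative)
  moreover have "cos (of_int m * (2 * pi)) = 1"
    using cos_int_2pin[of m] by (simp add: mult.commute)
  ultimately show ?thesis using False by simp
qed

lemma has_integral_cos_cos:
  "((\<lambda>x. cos (of_int j * x) * cos (of_int k * x)) has_integral
     ((if j = k then pi else 0) + (if j = - k then pi else 0))) {0..2 * pi}"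
  using has_integral_add[OF has_integral_mult_right[OF has_integral_cos_period[of "j - k"], of "1 / 2"]
      has_integral_mult_right[OF has_integral_cos_period[of "j + k"], of "1 / 2"]]
  by (rule has_integral_eq_rhs[OF has_integral_eq[rotated]])
    (auto simp: cos_times_cos algebra_simps add_divide_distrib)

lemma has_integral_sin_sin:
  "((\<lambda>x. sin (of_int j * x) * sin (of_int k * x)) has_integral
     ((if j = k then pi else 0) - (if j = - k then pi else 0))) {0..2 * pi}"
  using has_integral_diff[OF has_integral_mult_right[OF has_integral_cos_period[of "j - k"], of "1 / 2"]
      has_integral_mult_right[OF has_integral_cos_period[of "j + k"], of "1 / 2"]]
  by (rule has_integral_eq_rhs[OF has_integral_eq[rotated]])
    (auto simp: sin_times_sin algebra_simps diff_divide_distrib)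

lemma has_integral_sin_cos:
  "((\<lambda>x. sin (of_int j * x) * cos (of_int k * x)) has_integral 0) {0..2 * pi}"
  using has_integral_add[OF has_integral_mult_right[OF has_integral_sin_period[of "j - k"], of "1 / 2"]
      has_integral_mult_right[OF has_integral_sin_period[of "j + k"], of "1 / 2"]]
  by (rule has_integral_eq_rhs[OF has_integral_eq[rotated]])
    (auto simp: sin_times_cos ring_distribs add_divide_distrib)

definition fourier_cos :: "(real \<Rightarrow> real) \<Rightarrow> int \<Rightarrow> real" where
  "fourier_cos f k = integral {0..2 * pi} (\<lambda>x. f x * cos (of_int k * x))"

definition fourier_sin :: "(real \<Rightarrow> real) \<Rightarrow> int \<Rightarrow> real" where
  "fourier_sin f k = integral {0..2 * pi} (\<lambda>x. f x * sin (of_int k * x))"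

text \<open>Multiplication by cos x or sin x shifts frequencies by one, so a function orthogonal to
  all frequencies stays so after multiplication by any polynomial in cis x. f is quantified inside
  the statement because the product case applies the hypothesis for q to f multiplied by p. Integer
  frequencies make k - 1 harmless at k = 0.\<close>

lemma fourier_zero_polynomial:
  fixes p :: "complex \<Rightarrow> real"
  assumes "real_polynomial_function p"
  shows "\<forall>f. continuous_on UNIV f \<longrightarrow> (\<forall>k. fourier_cos f k = 0 \<and> fourier_sin f k = 0) \<longrightarrow>
    (\<forall>k. fourier_cos (\<lambda>x. f x * p (cis x)) k = 0 \<and> fourier_sin (\<lambda>x. f x * p (cis x)) k = 0)"
  using assms
proof induction
  case (linear p)
  show ?case
  proof (intro allI impI)
    fix f k assume f: "continuous_on UNIV f" and z: "\<forall>k. fourier_cos f k = 0 \<and> fourier_sin f k = 0"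
    \<comment> \<open>A real-linear p is determined by its values at 1 and at the imaginary
      unit.\<close>
    have pc: "p (cis x) = cos x * p 1 + sin x * p \<i>" for x
    proof -
      have "cis x = cos x *\<^sub>R 1 + sin x *\<^sub>R \<i>" by (simp add: complex_eq_iff)
      then show ?thesis
        using linear.hyps by (simp add: bounded_linear.linear linear_add linear_scale)
    qed
    have hc: "((\<lambda>x. f x * cos (of_int k * x)) has_integral 0) {0..2 * pi}" for k
      using z[rule_format, of k] continuous_on_subset[OF f]
      by (intro has_integral_integrable_integral[THEN iffD2] conjI integrable_continuous_real continuous_intros)
         (auto simp: fourier_cos_def)
    have hs: "((\<lambda>x. f x * sin (of_int k * x)) has_integral 0) {0..2 * pi}" for k
      using z[rule_format, of k] continuous_on_subset[OF f]
      by (intro has_integral_integrable_integral[THEN iffD2] conjI integrable_continuous_real continuous_intros)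
         (auto simp: fourier_sin_def)
    have hcn: "((\<lambda>x. - (f x * cos (of_int k * x))) has_integral 0) {0..2 * pi}"
      and hsn: "((\<lambda>x. - (f x * sin (of_int k * x))) has_integral 0) {0..2 * pi}" for k
      using has_integral_neg[OF hc] has_integral_neg[OF hs] by simp_all
    have eq: "integral {0..2 * pi} g = 0"
      if "\<And>x. (p 1 / 2) * (g1 x + g2 x) + (p \<i> / 2) * (g3 x + g4 x) = g x"
        "(g1 has_integral 0) {0..2 * pi}" "(g2 has_integral 0) {0..2 * pi}"
        "(g3 has_integral 0) {0..2 * pi}" "(g4 has_integral 0) {0..2 * pi}" for g g1 g2 g3 g4
      using has_integral_add[OF has_integral_mult_right[OF has_integral_add[OF that(2,3)], of "p 1 / 2"]
         has_integral_mult_right[OF has_integral_add[OF that(4,5)], of "p \<i> / 2"]] that(1)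
      by (intro integral_unique) simp
    have c: "cos (of_int (k + 1) * x) = cos x * cos (of_int k * x) - sin x * sin (of_int k * x)"
      "cos (of_int (k - 1) * x) = cos x * cos (of_int k * x) + sin x * sin (of_int k * x)"
      "sin (of_int (k + 1) * x) = sin (of_int k * x) * cos x + cos (of_int k * x) * sin x"
      "sin (of_int (k - 1) * x) = sin (of_int k * x) * cos x - cos (of_int k * x) * sin x" for x :: real
      by (simp_all add: cos_add cos_diff sin_add sin_diff algebra_simps)
    show "fourier_cos (\<lambda>x. f x * p (cis x)) k = 0 \<and> fourier_sin (\<lambda>x. f x * p (cis x)) k = 0"
      unfolding fourier_cos_def fourier_sin_def
    proof
      show "integral {0..2 * pi} (\<lambda>x. f x * p (cis x) * cos (of_int k * x)) = 0"
        by (rule eq[OF _ hc[of "k + 1"] hc[of "k - 1"] hs[of "k + 1"] hsn[of "k - 1"]])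
          (unfold c pc, simp add: algebra_simps)
      show "integral {0..2 * pi} (\<lambda>x. f x * p (cis x) * sin (of_int k * x)) = 0"
        by (rule eq[OF _ hs[of "k + 1"] hs[of "k - 1"] hc[of "k - 1"] hcn[of "k + 1"]])
          (unfold c pc, simp add: algebra_simps)
    qed
  qed
next
  case (const c)
  show ?case by (simp add: fourier_cos_def fourier_sin_def mult.commute[of _ c] mult.assoc)
next
  case (add p q)
  have cont: "continuous_on UNIV (\<lambda>x. r (cis x))" if "real_polynomial_function r" for r
    using continuous_on_compose2[OF continuous_on_polymonial_function[of r UNIV] continuous_on_cis[OF continuous_on_id]] that
    by (simp add: real_polynomial_function_eq)
  show ?case
  proof (intro allI impI)
    fix f k assume f: "continuous_on UNIV f" and z: "\<forall>k. fourier_cos f k = 0 \<and> fourier_sin f k = 0"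
    have int: "(\<lambda>x. f x * r (cis x) * cos (of_int k * x)) integrable_on {0..2 * pi}"
       "(\<lambda>x. f x * r (cis x) * sin (of_int k * x)) integrable_on {0..2 * pi}"
      if "real_polynomial_function r" for r
      by (intro integrable_continuous_real continuous_intros continuous_on_subset[OF f]
          continuous_on_subset[OF cont[OF that]]; simp)+
    show "fourier_cos (\<lambda>x. f x * (p (cis x) + q (cis x))) k = 0 \<and> fourier_sin (\<lambda>x. f x * (p (cis x) + q (cis x))) k = 0"
      using add.IH(1)[rule_format, OF f z[rule_format], of k] add.IH(2)[rule_format, OF f z[rule_format], of k]
      unfolding fourier_cos_def fourier_sin_def
      by (simp add: distrib_left distrib_right integral_add int add.hyps)
  qed
next
  case (mult p q)
  have cont: "continuous_on UNIV (\<lambda>x. p (cis x))"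
    using continuous_on_compose2[OF continuous_on_polymonial_function[of p UNIV] continuous_on_cis[OF continuous_on_id]] mult.hyps
    by (simp add: real_polynomial_function_eq)
  show ?case
  proof (intro allI impI)
    fix f k assume f: "continuous_on UNIV f" and z: "\<forall>k. fourier_cos f k = 0 \<and> fourier_sin f k = 0"
    show "fourier_cos (\<lambda>x. f x * (p (cis x) * q (cis x))) k = 0 \<and> fourier_sin (\<lambda>x. f x * (p (cis x) * q (cis x))) k = 0"
      using mult.IH(2)[rule_format, OF continuous_on_mult[OF f cont] mult.IH(1)[rule_format, OF f z[rule_format]], of k]
      by (simp add: mult.assoc)
  qed
qed

text \<open>f is orthogonal to every polynomial in cis x, and by Stone-Weierstrass these are
  uniformly dense among the continuous functions on the circle; hence f is orthogonal to
  itself.\<close>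

lemma fourier_unique:
  fixes f :: "real \<Rightarrow> real"
  assumes f: "continuous_on UNIV f" and per: "\<And>x. f (x + 2 * pi) = f x"
    and z: "\<And>k. fourier_cos f k = 0" "\<And>k. fourier_sin f k = 0"
  shows "f x = 0"
proof -
  define g where "g z = f (Arg2pi z)" for z
  have g: "g (cis y) = f y" if "y \<in> {0..2 * pi}" for y
  proof (cases "y = 2 * pi")
    case True
    have "Arg2pi 1 = 0" by (rule Arg2pi_unique[of 1]) auto
    then show ?thesis using True per[of 0] by (simp add: g_def)
  next
    case False
    then have "Arg2pi (cis y) = y"
      using that by (intro Arg2pi_unique[of 1]) (auto simp: cis_conv_exp)
    then show ?thesis by (simp add: g_def)
  qed
  have cis_surj: "\<exists>y\<in>{0..2 * pi}. z = cis y" if "norm z = 1" for z :: complex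
    using Arg2pi_eq[of z] Arg2pi_ge_0[of z] Arg2pi_lt_2pi[of z] that
    by (intro bexI[of _ "Arg2pi z"]) (auto simp: cis_conv_exp)
  \<comment> \<open>\<open>Arg2pi\<close> jumps at 1, so continuity of g comes from the quotient map
    cis: the preimage of a closed set under g is the image under cis of a compact set.\<close>
  have cont: "continuous_on (sphere 0 1) g"
    unfolding continuous_on_closed_vimage[OF closed_sphere]
  proof (intro allI impI)
    fix T :: "real set" assume "closed T"
    have "g -` T \<inter> sphere 0 1 = cis ` ({0..2 * pi} \<inter> f -` T)"
      using cis_surj g by fastforce
    moreover have "compact ({0..2 * pi} \<inter> f -` T)"
      using closed_vimage[OF \<open>closed T\<close> f] by (intro compact_Int_closed) auto
    ultimately show "closed (g -` T \<inter> sphere 0 1)"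
      by (simp add: compact_imp_closed compact_continuous_image continuous_on_cis)
  qed
  obtain C where C: "\<And>x. \<bar>f x\<bar> \<le> C"
    using f per by (rule periodic_bounded) (simp, rule that)
  have C0: "C \<ge> 0" using C[of 0] by linarith
  have ff: "(\<lambda>x. f x * f x) integrable_on {0..2 * pi}"
    by (intro integrable_continuous_real continuous_intros continuous_on_subset[OF f]) auto
  have le: "integral {0..2 * pi} (\<lambda>x. f x * f x) \<le> C * e * (2 * pi)" if "e > 0" for e
  proof -
    obtain p where p: "polynomial_function p" "\<And>z. z \<in> sphere 0 1 \<Longrightarrow> norm (g z - p z) < e"
      using Stone_Weierstrass_polynomial_function[OF compact_sphere cont \<open>e > 0\<close>] by blast
    have cp: "continuous_on UNIV (\<lambda>x. p (cis x))"
      using continuous_on_compose2[OF continuous_on_polymonial_function[OF p(1), of UNIV] continuous_on_cis[OF continuous_on_id]]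
      by simp
    have "fourier_cos (\<lambda>x. f x * p (cis x)) 0 = 0"
      using fourier_zero_polynomial[of p] f z p(1) by (simp add: real_polynomial_function_eq)
    then have 0: "integral {0..2 * pi} (\<lambda>x. f x * p (cis x)) = 0"
      by (simp add: fourier_cos_def)
    have fp: "(\<lambda>x. f x * p (cis x)) integrable_on {0..2 * pi}"
      by (intro integrable_continuous_real continuous_intros continuous_on_subset[OF f] continuous_on_subset[OF cp]) auto
    have "integral {0..2 * pi} (\<lambda>x. f x * f x) = integral {0..2 * pi} (\<lambda>x. f x * f x - f x * p (cis x))"
      by (simp add: integral_diff[OF ff fp] 0)
    also have "norm \<dots> \<le> C * e * (2 * pi - 0)"
    proof (rule integral_bound)
      show "continuous_on {0..2 * pi} (\<lambda>x. f x * f x - f x * p (cis x))"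
        by (intro continuous_intros continuous_on_subset[OF f] continuous_on_subset[OF cp]) auto
      show "norm (f x * f x - f x * p (cis x)) \<le> C * e" if "x \<in> {0..2 * pi}" for x
        using mult_mono[OF C[of x] less_imp_le[OF p(2)[of "cis x"]]] C0 g[OF that]
        by (simp add: abs_mult flip: right_diff_distrib)
    qed simp
    finally show ?thesis by simp
  qed
  have "integral {0..2 * pi} (\<lambda>x. f x * f x) \<le> 0"
  proof (rule field_le_epsilon)
    fix e :: real assume "e > 0"
    \<comment> \<open>The denominator contains C + 1 because C may be 0.\<close>
    have "C * (e / ((C + 1) * (2 * pi))) * (2 * pi) = e * (C / (C + 1))" by simp
    also have "\<dots> \<le> e * 1" using C0 \<open>e > 0\<close> by (intro mult_left_mono) auto
    finally have "C * (e / ((C + 1) * (2 * pi))) * (2 * pi) \<le> e" by simp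
    then show "integral {0..2 * pi} (\<lambda>x. f x * f x) \<le> 0 + e"
      using le[of "e / ((C + 1) * (2 * pi))"] C0 \<open>e > 0\<close> by simp
  qed
  moreover have "integral {0..2 * pi} (\<lambda>x. f x * f x) \<ge> 0"
    by (intro integral_nonneg ff) auto
  ultimately have "integral {0..2 * pi} (\<lambda>x. f x * f x) = 0" by linarith
  then have f0: "\<forall>x\<in>{0..2 * pi}. f x * f x = 0"
    by (subst (asm) integral_eq_0_iff) (auto intro!: continuous_intros continuous_on_subset[OF f])
  obtain y where "y \<in> {0..2 * pi}" "f x = f y"
    using per by (rule periodic_reduce) (simp, rule that)
  then show ?thesis using f0 by auto
qed

section \<open>Series of exponentially damped modes\<close>

definition fterm :: "(nat \<Rightarrow> complex) \<Rightarrow> nat \<Rightarrow> real \<Rightarrow> real \<Rightarrow> real" where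
  "fterm d n t x = exp ((1 - (real n + 2)\<^sup>2) * t) *
     (Re (d n) * cos ((real n + 2) * x) - Im (d n) * sin ((real n + 2) * x))"

(* fser d solves the linear equation u_t = u_xx + u; its modes start at frequency 2, where
   the equation contracts. *)
definition fser :: "(nat \<Rightarrow> complex) \<Rightarrow> real \<Rightarrow> real \<Rightarrow> real" where
  "fser d t x = (\<Sum>n. fterm d n t x)"

text \<open>Summability against all powers of the frequency is the coefficient form of smoothness;
  it is stable under \<open>dX\<close> and \<open>dT\<close>.\<close>

definition rapid :: "(nat \<Rightarrow> complex) \<Rightarrow> bool" where
  "rapid d \<longleftrightarrow> (\<forall>m. summable (\<lambda>n. (real n + 2) ^ m * norm (d n)))"

text \<open>The action of d/dx on coefficients: mode n is the real part of d n times exp (i k x)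
  with k = n + 2, damped by exp ((1 - k^2) t). In the same way \<open>dT\<close> is the action of
  the time derivative.\<close>

definition dX :: "(nat \<Rightarrow> complex) \<Rightarrow> nat \<Rightarrow> complex" where
  "dX d n = \<i> * of_real (real n + 2) * d n"

definition dT :: "(nat \<Rightarrow> complex) \<Rightarrow> nat \<Rightarrow> complex" where
  "dT d n = of_real (1 - (real n + 2)\<^sup>2) * d n"

lemma rapid_dX:
  assumes "rapid d"
  shows "rapid (dX d)"
  unfolding rapid_def
proof
  fix m
  have "(\<lambda>n. (real n + 2) ^ m * norm (dX d n)) = (\<lambda>n. (real n + 2) ^ Suc m * norm (d n))"
    by (simp add: dX_def norm_mult fun_eq_iff del: of_real_add)
  moreover have "summable (\<lambda>n. (real n + 2) ^ Suc m * norm (d n))"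
    using assms unfolding rapid_def by (rule spec)
  ultimately show "summable (\<lambda>n. (real n + 2) ^ m * norm (dX d n))" by (simp only:)
qed

text \<open>The equation u_t = u_xx + u on the level of coefficients.\<close>

lemma dT_eq: "dT d n = d n + dX (dX d) n"
  by (simp add: dT_def dX_def algebra_simps power2_eq_square)

lemma rapid_add:
  assumes "rapid d" "rapid d'"
  shows "rapid (\<lambda>n. d n + d' n)"
  unfolding rapid_def
proof
  fix m
  show "summable (\<lambda>n. (real n + 2) ^ m * norm (d n + d' n))"
  proof (rule summable_comparison_test')
    show "summable (\<lambda>n. (real n + 2) ^ m * norm (d n) + (real n + 2) ^ m * norm (d' n))"
      using assms unfolding rapid_def by (intro summable_add) auto
    show "norm ((real n + 2) ^ m * norm (d n + d' n)) \<le> (real n + 2) ^ m * norm (d n) + (real n + 2) ^ m * norm (d' n)" for n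
      by (simp add: norm_triangle_ineq mult_left_mono flip: distrib_left)
  qed
qed

lemma rapid_dT: "rapid d \<Longrightarrow> rapid (dT d)"
  using rapid_add[OF _ rapid_dX[OF rapid_dX]] by (simp add: dT_eq[abs_def])

lemma rapid_summable: "rapid d \<Longrightarrow> summable (\<lambda>n. norm (d n))"
  unfolding rapid_def by (drule spec[of _ 0]) simp

text \<open>For k \<ge> 2 the exponent satisfies 1 - k^2 \<le> - 3: this is where the rate 3 comes
  from.\<close>

lemma fterm_bound:
  assumes "t \<ge> 0"
  shows "\<bar>fterm d n t x\<bar> \<le> exp (- 3 * t) * (2 * norm (d n))"
proof -
  have "\<bar>Re (d n) * cos ((real n + 2) * x) - Im (d n) * sin ((real n + 2) * x)\<bar>
      \<le> \<bar>Re (d n)\<bar> * \<bar>cos ((real n + 2) * x)\<bar> + \<bar>Im (d n)\<bar> * \<bar>sin ((real n + 2) * x)\<bar>"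
    using abs_triangle_ineq4 by (simp add: abs_mult[symmetric])
  also have "\<dots> \<le> norm (d n) * 1 + norm (d n) * 1"
    by (intro add_mono mult_mono) (auto simp: abs_Re_le_cmod abs_Im_le_cmod)
  finally have *: "\<bar>Re (d n) * cos ((real n + 2) * x) - Im (d n) * sin ((real n + 2) * x)\<bar> \<le> 2 * norm (d n)"
    by simp
  have "(1 - (real n + 2)\<^sup>2) * t \<le> - 3 * t"
    using assms by (intro mult_right_mono) (auto simp: power2_eq_square algebra_simps)
  then show ?thesis
    unfolding fterm_def abs_mult by (intro mult_mono *) auto
qed

lemma fterm_bound': "t \<ge> 0 \<Longrightarrow> \<bar>fterm d n t x\<bar> \<le> 2 * norm (d n)"
proof (rule order_trans[OF fterm_bound])
  assume "t \<ge> 0"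
  then show "exp (- 3 * t) * (2 * norm (d n)) \<le> 2 * norm (d n)"
    by (intro mult_left_le_one_le) auto
qed

lemma summable_fterm:
  assumes "rapid d" "t \<ge> 0"
  shows "summable (\<lambda>n. fterm d n t x)"
  by (rule summable_comparison_test'[of "\<lambda>n. 2 * norm (d n)"])
    (use fterm_bound'[OF assms(2)] in \<open>auto intro: summable_mult rapid_summable assms(1)\<close>)

lemma decaying_fser:
  assumes "rapid d"
  shows "decaying 3 (fser d)"
proof -
  have "uniform_limit ({0..} \<times> UNIV) (\<lambda>n z. \<Sum>i<n. fterm d i (fst z) (snd z))
      (\<lambda>z. \<Sum>i. fterm d i (fst z) (snd z)) sequentially"
    by (rule Weierstrass_m_test[of _ _ "\<lambda>n. 2 * norm (d n)"])
      (auto intro!: fterm_bound' summable_mult rapid_summable assms)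
  moreover have "continuous_on ({0..} \<times> UNIV) (\<lambda>z. \<Sum>i<n. fterm d i (fst z) (snd z))" for n
    unfolding fterm_def by (intro continuous_intros)
  ultimately have "continuous_on ({0..} \<times> UNIV) (\<lambda>z. \<Sum>i. fterm d i (fst z) (snd z))"
    by (intro uniform_limit_theorem[rotated]) auto
  moreover have "\<bar>fser d t x\<bar> \<le> (\<Sum>n. 2 * norm (d n)) * exp (- 3 * t)" if "t \<ge> 0" for t x
  proof -
    have s: "summable (\<lambda>n. exp (- 3 * t) * (2 * norm (d n)))"
      by (intro summable_mult rapid_summable assms)
    have "\<bar>fser d t x\<bar> \<le> (\<Sum>n. exp (- 3 * t) * (2 * norm (d n)))"
      unfolding fser_def
      using norm_suminf_le[of "\<lambda>n. fterm d n t x", OF _ s] fterm_bound[OF that] by simp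
    also have "\<dots> = (\<Sum>n. 2 * norm (d n)) * exp (- 3 * t)"
      by (subst suminf_mult) (auto intro!: summable_mult rapid_summable assms)
    finally show ?thesis .
  qed
  ultimately show ?thesis
    unfolding decaying_def case_prod_unfold fser_def by blast
qed

text \<open>Termwise differentiation: the differentiated series are dominated by 2 norm (dX d n) and
  2 norm (dT d n), uniformly on the half-line including t = 0.\<close>

lemma has_real_derivative_fser:
  assumes "rapid d" "t \<ge> 0"
  shows "(fser d t has_real_derivative fser (dX d) t x) (at x)"
    "((\<lambda>s. fser d s x) has_real_derivative fser (dT d) t x) (at t within {0..})"
proof -
  have "\<exists>g. \<forall>x\<in>UNIV. (\<lambda>n. fterm d n t x) sums g x \<and>
      (g has_real_derivative fser (dX d) t x) (at x within UNIV)"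
  proof (rule has_field_derivative_series[OF convex_UNIV _ _ UNIV_I])
    show "(fterm d n t has_real_derivative fterm (dX d) n t x) (at x)" for n x
      unfolding fterm_def dX_def
      by (auto intro!: derivative_eq_intros simp: algebra_simps)
    show "uniform_limit UNIV (\<lambda>n x. \<Sum>i<n. fterm (dX d) i t x) (fser (dX d) t) sequentially"
      unfolding fser_def
      by (rule Weierstrass_m_test[of _ _ "\<lambda>n. 2 * norm (dX d n)"])
        (auto intro!: fterm_bound' summable_mult rapid_summable rapid_dX assms)
  qed (rule summable_fterm[OF assms])
  then obtain g where g: "\<And>x. (\<lambda>n. fterm d n t x) sums g x" "(g has_real_derivative fser (dX d) t x) (at x)"
    by auto
  have "g = fser d t" using g(1) by (auto simp: fser_def sums_iff)
  with g(2) show "(fser d t has_real_derivative fser (dX d) t x) (at x)" by simp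
  have "\<exists>g. \<forall>t\<in>{0..}. (\<lambda>n. fterm d n t x) sums g t \<and>
      (g has_real_derivative fser (dT d) t x) (at t within {0..})"
  proof (rule has_field_derivative_series)
    show "((\<lambda>t. fterm d n t x) has_real_derivative fterm (dT d) n t x) (at t within {0..})" for n t
      unfolding fterm_def dT_def
      by (auto intro!: derivative_eq_intros simp: algebra_simps)
    show "uniform_limit {0..} (\<lambda>n t. \<Sum>i<n. fterm (dT d) i t x) (\<lambda>t. fser (dT d) t x) sequentially"
      unfolding fser_def
      by (rule Weierstrass_m_test[of _ _ "\<lambda>n. 2 * norm (dT d n)"])
        (auto intro!: fterm_bound' summable_mult rapid_summable rapid_dT assms)
    show "(0::real) \<in> {0..}" by simp
  qed (use summable_fterm[OF assms(1)] in auto)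
  then obtain h where h: "\<And>t. t \<ge> 0 \<Longrightarrow> (\<lambda>n. fterm d n t x) sums h t"
     "\<And>t. t \<ge> 0 \<Longrightarrow> (h has_real_derivative fser (dT d) t x) (at t within {0..})"
    by auto
  show "((\<lambda>s. fser d s x) has_real_derivative fser (dT d) t x) (at t within {0..})"
    using h(2)[OF assms(2)] assms(2)
    by (rule has_real_derivative_cong_halfline) (use h(1) in \<open>auto simp: fser_def sums_iff\<close>)
qed

lemma Sdecay_fser:
  assumes "rapid d"
  shows "Sdecay 3 (fser d)"
proof -
  have "Cdecay n 3 (fser d)" for n
    using assms
  proof (induction n arbitrary: d)
    case (Suc n)
    show ?case
      by (rule CdecayI[OF decaying_fser[OF Suc.prems] Suc.IH[OF rapid_dX] Suc.IH[OF rapid_dT]])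
        (use has_real_derivative_fser[OF Suc.prems] Suc.prems in auto)
  qed (auto simp: decaying_fser)
  then show ?thesis by (simp add: Sdecay_def)
qed

lemma fser_periodic: "fser d t (x + 2 * pi) = fser d t x"
proof -
  have "fterm d n t (x + 2 * pi) = fterm d n t x" for n
  proof -
    have *: "(real n + 2) * (x + 2 * pi) = (real n + 2) * x + of_int (int n + 2) * (2 * pi)"
      by (simp add: algebra_simps)
    show ?thesis
      unfolding fterm_def * cos_add sin_add
      using cos_int_2pin[of "int n + 2"] sin_int_2pin[of "int n + 2"] by (simp add: mult.commute[of "2 * pi"])
  qed
  then show ?thesis by (simp add: fser_def)
qed

lemma fser_dT:
  assumes "rapid d" "t \<ge> 0"
  shows "fser (dT d) t x = fser d t x + fser (dX (dX d)) t x"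
proof -
  have "fterm (dT d) n t x = fterm d n t x + fterm (dX (dX d)) n t x" for n
    by (simp add: fterm_def dT_eq algebra_simps)
  then show ?thesis
    unfolding fser_def
    using suminf_add[OF summable_fterm[OF assms, where x=x]
        summable_fterm[OF rapid_dX[OF rapid_dX[OF assms(1)]] assms(2), where x=x]]
    by simp
qed

text \<open>The bound 1 on q keeps the majorant 2 norm (d n), so integration and summation can be
  exchanged.\<close>

lemma integral_fser:
  assumes d: "rapid d" and t: "t \<ge> 0" and q: "continuous_on UNIV q" "\<And>x. \<bar>q x\<bar> \<le> 1"
    and I: "\<And>n. ((\<lambda>x. fterm d n t x * q x) has_integral I n) {0..2 * pi}"
  shows "I sums integral {0..2 * pi} (\<lambda>x. fser d t x * q x)"
proof -
  have "uniform_limit {0..2 * pi} (\<lambda>n x. \<Sum>i<n. fterm d i t x * q x)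
      (\<lambda>x. \<Sum>i. fterm d i t x * q x) sequentially"
  proof (rule Weierstrass_m_test)
    show "norm (fterm d n t x * q x) \<le> 2 * norm (d n)" for n x
      using mult_mono[OF fterm_bound'[OF t, of d n x] q(2)[of x]] by (simp add: abs_mult)
  qed (intro summable_mult rapid_summable d)
  moreover have "(\<Sum>i. fterm d i t x * q x) = fser d t x * q x" for x
    unfolding fser_def by (simp add: suminf_mult2 summable_fterm[OF d t])
  ultimately have ul: "uniform_limit (cbox 0 (2 * pi)) (\<lambda>n x. \<Sum>i<n. fterm d i t x * q x)
      (\<lambda>x. fser d t x * q x) sequentially" by simp
  have hi: "((\<lambda>x. \<Sum>i<n. fterm d i t x * q x) has_integral (\<Sum>i<n. I i)) {0..2 * pi}" for n
    by (intro has_integral_sum I) auto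
  have c: "continuous_on (cbox 0 (2 * pi)) (\<lambda>x. \<Sum>i<n. fterm d i t x * q x)" for n
    unfolding fterm_def by (intro continuous_intros continuous_on_subset[OF q(1)]) auto
  obtain I' J' where IJ: "\<And>n. ((\<lambda>x. \<Sum>i<n. fterm d i t x * q x) has_integral I' n) (cbox 0 (2 * pi))"
    "((\<lambda>x. fser d t x * q x) has_integral J') (cbox 0 (2 * pi))" "I' \<longlonglongrightarrow> J'"
    using ul c trivial_limit_sequentially by (rule uniform_limit_integral_cbox) (rule that)
  have "I' = (\<lambda>n. \<Sum>i<n. I i)"
    using IJ(1) hi by (auto intro: has_integral_unique)
  moreover have "J' = integral {0..2 * pi} (\<lambda>x. fser d t x * q x)"
    using IJ(2) by (simp add: integral_unique)
  ultimately show ?thesis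
    using IJ(3) by (simp add: sums_def)
qed

lemma fourier_fser:
  assumes "rapid d" "t \<ge> 0" "k \<ge> 0"
  shows "fourier_cos (fser d t) k =
      (if k \<ge> 2 then pi * exp ((1 - (of_int k)\<^sup>2) * t) * Re (d (nat (k - 2))) else 0)" (is ?C)
    and "fourier_sin (fser d t) k =
      (if k \<ge> 2 then - pi * exp ((1 - (of_int k)\<^sup>2) * t) * Im (d (nat (k - 2))) else 0)" (is ?S)
proof -
  define E where "E n = exp ((1 - (real n + 2)\<^sup>2) * t)" for n
  have n2: "real n + 2 = of_int (int n + 2)" for n by simp
  \<comment> \<open>As k \<ge> 0, the alternative j = - k of the orthogonality relations cannot
    occur for j = n + 2, and at most one mode survives.\<close>
  have c: "((\<lambda>x. fterm d n t x * cos (of_int k * x)) has_integral (if int n + 2 = k then E n * Re (d n) * pi else 0)) {0..2 * pi}" for n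
    using has_integral_diff[OF has_integral_mult_right[OF has_integral_cos_cos[of "int n + 2" k], of "E n * Re (d n)"]
       has_integral_mult_right[OF has_integral_sin_cos[of "int n + 2" k], of "E n * Im (d n)"]] assms(3)
    unfolding fterm_def E_def[symmetric] unfolding n2
    by (rule_tac has_integral_eq_rhs) (auto simp: algebra_simps)
  have s: "((\<lambda>x. fterm d n t x * sin (of_int k * x)) has_integral (if int n + 2 = k then - E n * Im (d n) * pi else 0)) {0..2 * pi}" for n
    using has_integral_diff[OF has_integral_mult_right[OF has_integral_sin_cos[of k "int n + 2"], of "E n * Re (d n)"]
       has_integral_mult_right[OF has_integral_sin_sin[of "int n + 2" k], of "E n * Im (d n)"]] assms(3)
    unfolding fterm_def E_def[symmetric] unfolding n2
    by (rule_tac has_integral_eq_rhs) (auto simp: algebra_simps)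
  have sums: "(\<lambda>n. if int n + 2 = k then F n else 0) sums (if k \<ge> 2 then F (nat (k - 2)) else 0)" for F :: "nat \<Rightarrow> real"
  proof (cases "k \<ge> 2")
    case True
    then have "(\<lambda>n. if int n + 2 = k then F n else 0) = (\<lambda>n. if n = nat (k - 2) then F n else 0)"
      by (auto simp: fun_eq_iff)
    with sums_single[of "nat (k - 2)" F] True show ?thesis by simp
  next
    case False
    then have "(\<lambda>n. if int n + 2 = k then F n else 0) = (\<lambda>n. 0)" by (auto simp: fun_eq_iff)
    with False show ?thesis by simp
  qed
  have Ek: "E (nat (k - 2)) = exp ((1 - (of_int k)\<^sup>2) * t)" if "k \<ge> 2"
  proof -
    have "real (nat (k - 2)) + 2 = of_int k" using that by simp
    then show ?thesis by (simp only: E_def)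
  qed
  have "integral {0..2 * pi} (\<lambda>x. fser d t x * cos (of_int k * x)) =
      (if k \<ge> 2 then E (nat (k - 2)) * Re (d (nat (k - 2))) * pi else 0)"
    by (rule sums_unique2[OF integral_fser[OF assms(1,2) _ _ c] sums]) (auto intro!: continuous_intros)
  then show ?C using Ek by (auto simp: fourier_cos_def)
  have "integral {0..2 * pi} (\<lambda>x. fser d t x * sin (of_int k * x)) =
      (if k \<ge> 2 then - E (nat (k - 2)) * Im (d (nat (k - 2))) * pi else 0)"
    by (rule sums_unique2[OF integral_fser[OF assms(1,2) _ _ s] sums]) (auto intro!: continuous_intros)
  then show ?S using Ek by (auto simp: fourier_sin_def)
qed

lemma fourier_neg:
  "fourier_cos f (- k) = fourier_cos f k" "fourier_sin f (- k) = - fourier_sin f k"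
  by (simp_all add: fourier_cos_def fourier_sin_def)

lemma fourier_diff:
  assumes "continuous_on UNIV f" "continuous_on UNIV g"
  shows "fourier_cos (\<lambda>x. f x - g x) k = fourier_cos f k - fourier_cos g k"
    "fourier_sin (\<lambda>x. f x - g x) k = fourier_sin f k - fourier_sin g k"
  unfolding fourier_cos_def fourier_sin_def left_diff_distrib
  by (intro integral_diff integrable_continuous_real continuous_intros
      continuous_on_subset[OF assms(1)] continuous_on_subset[OF assms(2)]; simp)+

lemma fourier_low_modes:
  assumes "k \<ge> 0"
  shows "fourier_cos (\<lambda>x. A + (B * cos x + C * sin x)) k =
      (if k = 0 then A * (2 * pi) else if k = 1 then B * pi else 0)" (is ?C)
    and "fourier_sin (\<lambda>x. A + (B * cos x + C * sin x)) k = (if k = 1 then C * pi else 0)" (is ?S)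
proof -
  have "((\<lambda>x. A * cos (of_int k * x) + (B * (cos (of_int 1 * x) * cos (of_int k * x)) + C * (sin (of_int 1 * x) * cos (of_int k * x))))
      has_integral A * (if k = 0 then 2 * pi else 0) +
        (B * ((if 1 = k then pi else 0) + (if 1 = - k then pi else 0)) + C * 0)) {0..2 * pi}"
    by (intro has_integral_add has_integral_mult_right has_integral_cos_period has_integral_cos_cos has_integral_sin_cos)
  from integral_unique[OF this] show ?C
    using assms by (auto simp: fourier_cos_def distrib_right mult.assoc)
  have "((\<lambda>x. A * sin (of_int k * x) + (B * (sin (of_int k * x) * cos (of_int 1 * x)) + C * (sin (of_int 1 * x) * sin (of_int k * x))))
      has_integral A * 0 + (B * 0 + C * ((if 1 = k then pi else 0) - (if 1 = - k then pi else 0)))) {0..2 * pi}"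
    by (intro has_integral_add has_integral_mult_right has_integral_sin_period has_integral_sin_sin has_integral_sin_cos)
  from integral_unique[OF this] show ?S
    using assms by (auto simp: fourier_sin_def distrib_right mult.assoc mult.commute[of "cos _" "sin _"])
qed

text \<open>The difference of both sides is continuous and periodic with all Fourier coefficients
  zero, so \<open>fourier_unique\<close> applies. The time is arbitrary because this serves for the
  initial support function as well as for beta of an unknown solution.\<close>

lemma fourier_eq_fser:
  assumes f: "continuous_on UNIV f" "\<And>x. f (x + 2 * pi) = f x"
    and d: "rapid d" and t: "t \<ge> 0"
    and c: "\<And>n. fourier_cos f (int n + 2) = pi * exp ((1 - (real n + 2)\<^sup>2) * t) * Re (d n)"
    and s: "\<And>n. fourier_sin f (int n + 2) = - pi * exp ((1 - (real n + 2)\<^sup>2) * t) * Im (d n)"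
  shows "f x = fourier_cos f 0 / (2 * pi) + (fourier_cos f 1 / pi * cos x + fourier_sin f 1 / pi * sin x) + fser d t x"
proof -
  define A B C where "A = fourier_cos f 0 / (2 * pi)" and "B = fourier_cos f 1 / pi" and "C = fourier_sin f 1 / pi"
  define L where "L x = A + (B * cos x + C * sin x)" for x
  have contL: "continuous_on UNIV L" unfolding L_def by (intro continuous_intros)
  have contS: "continuous_on UNIV (fser d t)"
    using decaying_slice_continuous[OF decaying_fser[OF d] t] .
  define h where "h x = f x - L x - fser d t x" for x
  have k: "fourier_cos h k = 0 \<and> fourier_sin h k = 0" if "k \<ge> 0" for k
  proof -
    have "fourier_cos h k = fourier_cos f k - fourier_cos L k - fourier_cos (fser d t) k"
      "fourier_sin h k = fourier_sin f k - fourier_sin L k - fourier_sin (fser d t) k"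
      unfolding h_def
      using fourier_diff[OF continuous_on_diff[OF f(1) contL] contS] fourier_diff[OF f(1) contL] by simp_all
    moreover have "fourier_sin f 0 = 0" by (simp add: fourier_sin_def)
    moreover have "fourier_cos f k = pi * exp ((1 - (of_int k)\<^sup>2) * t) * Re (d (nat (k - 2)))"
      "fourier_sin f k = - pi * exp ((1 - (of_int k)\<^sup>2) * t) * Im (d (nat (k - 2)))" if "k \<ge> 2"
      using c[of "nat (k - 2)"] s[of "nat (k - 2)"] that by simp_all
    moreover have "k = 0 \<or> k = 1 \<or> k \<ge> 2" using that by auto
    ultimately show ?thesis
      unfolding fourier_fser[OF d t that] L_def fourier_low_modes[OF that]
      by (elim disjE) (auto simp: A_def B_def C_def)
  qed
  have k': "fourier_cos h k = 0" "fourier_sin h k = 0" for k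
    using k[of k] k[of "- k"] by (cases "k \<ge> 0"; simp add: fourier_neg)+
  have "h x = 0"
  proof (rule fourier_unique[OF _ _ k'])
    show "continuous_on UNIV h" unfolding h_def by (intro continuous_intros f contL contS)
    show "h (x + 2 * pi) = h x" for x by (simp add: h_def L_def f fser_periodic)
  qed
  then show ?thesis by (simp add: h_def L_def A_def B_def C_def)
qed

section \<open>Fourier coefficients of derivatives and their decay\<close>

lemma has_integral_periodic_deriv:
  fixes g :: "real \<Rightarrow> real"
  assumes "\<And>x. (g has_real_derivative g' x) (at x)" "g (2 * pi) = g 0"
  shows "(g' has_integral 0) {0..2 * pi}"
proof -
  have "(g' has_integral g (2 * pi) - g 0) {0..2 * pi}"
    by (rule fundamental_theorem_of_calculus)
      (use assms(1) in \<open>auto simp: has_real_derivative_iff_has_vector_derivative intro: has_vector_derivative_at_within\<close>)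
  then show ?thesis using assms(2) by simp
qed

lemma fourier_vd:
  assumes "smooth f" "\<And>x. f (x + 2 * pi) = f x"
  shows "fourier_cos (vd f) k = of_int k * fourier_sin f k"
    and "fourier_sin (vd f) k = - of_int k * fourier_cos f k"
proof -
  have D: "(f has_real_derivative vd f x) (at x)" for x
    using smoothD[OF assms(1)] by (simp add: has_real_derivative_iff_has_vector_derivative)
  have per: "cos (of_int k * (2 * pi)) = 1" "sin (of_int k * (2 * pi)) = 0" "f (2 * pi) = f 0"
    using cos_int_2pin[of k] sin_int_2pin[of k] assms(2)[of 0] by (simp_all add: mult.commute)
  have int: "(\<lambda>x. g x * cos (of_int k * x)) integrable_on {0..2 * pi}"
      "(\<lambda>x. g x * sin (of_int k * x)) integrable_on {0..2 * pi}" if "smooth g" for g :: "real \<Rightarrow> real"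
    by (intro integrable_continuous_real continuous_intros smooth_continuous[OF that])+
  note i = int[OF assms(1)] int[OF smooth_vd[OF assms(1)]]
  have "((\<lambda>x. vd f x * cos (of_int k * x) - of_int k * (f x * sin (of_int k * x))) has_integral 0) {0..2 * pi}"
    by (rule has_integral_periodic_deriv[of "\<lambda>x. f x * cos (of_int k * x)"])
      (auto intro!: derivative_eq_intros D simp: per)
  from integral_unique[OF this] show "fourier_cos (vd f) k = of_int k * fourier_sin f k"
    unfolding fourier_cos_def fourier_sin_def
    using integral_diff[OF i(3) integrable_on_mult_right[OF i(2), of "of_int k"]] by simp
  have "((\<lambda>x. vd f x * sin (of_int k * x) + of_int k * (f x * cos (of_int k * x))) has_integral 0) {0..2 * pi}"
    by (rule has_integral_periodic_deriv[of "\<lambda>x. f x * sin (of_int k * x)"])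
      (auto intro!: derivative_eq_intros D simp: per)
  from integral_unique[OF this] show "fourier_sin (vd f) k = - of_int k * fourier_cos f k"
    unfolding fourier_cos_def fourier_sin_def
    using integral_add[OF i(4) integrable_on_mult_right[OF i(1), of "of_int k"]] by simp
qed

text \<open>Each derivative exchanges sine and cosine coefficients up to a factor k and a sign; the
  sum of the absolute values does not see the exchange.\<close>

lemma fourier_vd_funpow:
  assumes "smooth f" "\<And>x. f (x + 2 * pi) = f x"
  shows "\<bar>fourier_cos ((vd ^^ m) f) k\<bar> + \<bar>fourier_sin ((vd ^^ m) f) k\<bar> =
    \<bar>of_int k\<bar> ^ m * (\<bar>fourier_cos f k\<bar> + \<bar>fourier_sin f k\<bar>)"
  using assms
proof (induction m arbitrary: f)
  case (Suc m)
  have per: "vd f (x + 2 * pi) = vd f x" for x by (rule periodic_vd[OF Suc.prems])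
  have "\<bar>fourier_cos ((vd ^^ Suc m) f) k\<bar> + \<bar>fourier_sin ((vd ^^ Suc m) f) k\<bar> =
      \<bar>of_int k\<bar> ^ m * (\<bar>fourier_cos (vd f) k\<bar> + \<bar>fourier_sin (vd f) k\<bar>)"
    unfolding funpow_Suc_right o_apply by (rule Suc.IH[OF smooth_vd[OF Suc.prems(1)] per])
  also have "\<dots> = \<bar>of_int k\<bar> ^ Suc m * (\<bar>fourier_cos f k\<bar> + \<bar>fourier_sin f k\<bar>)"
    unfolding fourier_vd[OF Suc.prems] by (simp add: abs_mult distrib_left)
  finally show ?case .
qed simp

lemma fourier_bound:
  assumes "continuous_on UNIV f" "\<And>x. \<bar>f x\<bar> \<le> C"
  shows "\<bar>fourier_cos f k\<bar> \<le> C * (2 * pi)" "\<bar>fourier_sin f k\<bar> \<le> C * (2 * pi)"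
proof -
  have "norm (integral {0..2 * pi} (\<lambda>x. f x * q x)) \<le> C * (2 * pi - 0)"
    if q: "continuous_on UNIV q" "\<And>x. \<bar>q x\<bar> \<le> 1" for q
  proof (rule integral_bound)
    show "continuous_on {0..2 * pi} (\<lambda>x. f x * q x)"
      by (intro continuous_intros continuous_on_subset[OF assms(1)] continuous_on_subset[OF q(1)]) auto
    show "norm (f x * q x) \<le> C" for x
      using mult_mono[OF assms(2)[of x] q(2)[of x]] assms(2)[of x] by (simp add: abs_mult)
  qed simp
  moreover have "continuous_on UNIV (\<lambda>x. cos (real_of_int k * x))" "continuous_on UNIV (\<lambda>x. sin (real_of_int k * x))"
    by (intro continuous_intros)+
  ultimately show "\<bar>fourier_cos f k\<bar> \<le> C * (2 * pi)" "\<bar>fourier_sin f k\<bar> \<le> C * (2 * pi)"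
    by (simp_all add: fourier_cos_def fourier_sin_def)
qed

lemma smooth_funpow: "smooth f \<Longrightarrow> smooth ((vd ^^ m) f)"
  by (induction m) (auto intro: smooth_vd)

lemma periodic_vd_funpow: "smooth f \<Longrightarrow> (\<And>x. f (x + p) = f x) \<Longrightarrow> (vd ^^ m) f (x + p) = (vd ^^ m) f x"
  by (induction m arbitrary: x) (auto intro: periodic_vd smooth_funpow)

text \<open>The offset 2, the factor 1 / pi and the minus sign match \<open>fterm\<close>, so that
  at t = 0 the series reproduces the modes k \<ge> 2 of f.\<close>

definition fourier_coeffs :: "(real \<Rightarrow> real) \<Rightarrow> nat \<Rightarrow> complex" where
  "fourier_coeffs f n = Complex (fourier_cos f (int n + 2) / pi) (- fourier_sin f (int n + 2) / pi)"

text \<open>Using m + 2 derivatives instead of m leaves a factor 1 / (n + 2)^2, which is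
  summable.\<close>

lemma rapid_fourier_coeffs:
  assumes "smooth f" "\<And>x. f (x + 2 * pi) = f x"
  shows "rapid (fourier_coeffs f)"
  unfolding rapid_def
proof
  fix m
  obtain C where C: "\<And>x. \<bar>(vd ^^ (m + 2)) f x\<bar> \<le> C"
    using smooth_continuous[OF smooth_funpow[OF assms(1)]] periodic_vd_funpow[OF assms]
    by (rule periodic_bounded[where p="2 * pi"]) (simp, rule that)
  have "(real n + 2) ^ m * norm (fourier_coeffs f n) \<le> (4 * C) * (1 / (real n + 2)\<^sup>2)" for n
  proof -
    have n2: "of_int (int n + 2) = real n + 2" by simp
    have "pi * norm (fourier_coeffs f n) \<le> pi * (\<bar>Re (fourier_coeffs f n)\<bar> + \<bar>Im (fourier_coeffs f n)\<bar>)"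
      by (intro mult_left_mono cmod_le) auto
    also have "\<dots> = \<bar>fourier_cos f (int n + 2)\<bar> + \<bar>fourier_sin f (int n + 2)\<bar>"
      by (simp add: fourier_coeffs_def distrib_left abs_divide)
    finally have "(real n + 2) ^ (m + 2) * (pi * norm (fourier_coeffs f n)) \<le>
        \<bar>of_int (int n + 2)\<bar> ^ (m + 2) * (\<bar>fourier_cos f (int n + 2)\<bar> + \<bar>fourier_sin f (int n + 2)\<bar>)"
      by (auto intro!: mult_left_mono)
    also have "\<dots> = \<bar>fourier_cos ((vd ^^ (m + 2)) f) (int n + 2)\<bar> + \<bar>fourier_sin ((vd ^^ (m + 2)) f) (int n + 2)\<bar>"
      by (rule fourier_vd_funpow[OF assms, symmetric])
    also have "\<dots> \<le> C * (2 * pi) + C * (2 * pi)"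
      by (intro add_mono fourier_bound smooth_continuous smooth_funpow assms C)
    finally have "pi * ((real n + 2)\<^sup>2 * ((real n + 2) ^ m * norm (fourier_coeffs f n))) \<le> pi * (4 * C)"
      by (simp add: power_add power2_eq_square algebra_simps)
    then have "(real n + 2)\<^sup>2 * ((real n + 2) ^ m * norm (fourier_coeffs f n)) \<le> 4 * C"
      by (rule mult_left_le_imp_le) simp
    then show ?thesis by (simp add: field_simps)
  qed
  moreover have "summable (\<lambda>n. 1 / (real n + 2)\<^sup>2)"
    using summable_ignore_initial_segment[OF inverse_power_summable[of 2, where 'a=real], of 2]
    by (simp add: field_simps power2_eq_square inverse_eq_divide)
  ultimately show "summable (\<lambda>n. (real n + 2) ^ m * norm (fourier_coeffs f n))"
    using summable_comparison_test'[OF summable_mult, of "\<lambda>n. 1 / (real n + 2)\<^sup>2" 0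
        "\<lambda>n. (real n + 2) ^ m * norm (fourier_coeffs f n)" "4 * C"] by (simp add: abs_mult)
qed

subsection \<open>The equation for the normal angle\<close>

lemma constant_on_halfline:
  assumes "\<And>t. t \<ge> 0 \<Longrightarrow> ((g :: real \<Rightarrow> real) has_real_derivative 0) (at t within {0..})" "t \<ge> 0"
  shows "g t = g 0"
proof -
  have "\<exists>c. \<forall>x\<in>{0..}. g x = c"
    using assms(1) by (intro has_field_derivative_zero_constant) auto
  then show ?thesis using assms(2) by auto
qed

text \<open>Integrating factor: d divided by the exponential is constant.\<close>

lemma linear_ode:
  assumes q: "continuous_on {0..} q"
    and d: "\<And>t. t \<ge> 0 \<Longrightarrow> (d has_real_derivative q t * d t) (at t within {0..})" and t: "t \<ge> 0"
  shows "d t = d 0 * exp (integral {0..t} q)"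
proof -
  have "((\<lambda>t. d t * exp (- integral {0..t} q)) has_real_derivative 0) (at t within {0..})" if "t \<ge> 0" for t
    by (auto intro!: derivative_eq_intros d has_real_derivative_time_integral q that)
  from constant_on_halfline[of "\<lambda>t. d t * exp (- integral {0..t} q)", OF this t]
  have "d t * exp (- integral {0..t} q) = d 0" by simp
  then show ?thesis by (simp add: exp_minus field_simps)
qed

text \<open>A difference quotient of F in space that is also defined and continuous at p = q. It
  makes the difference of two solutions of a' = F (t, a) a solution of a linear equation.\<close>

definition mean_slope :: "(real \<Rightarrow> real \<Rightarrow> real) \<Rightarrow> real \<Rightarrow> real \<Rightarrow> real \<Rightarrow> real" where
  "mean_slope F' s p q = integral {0..1} (\<lambda>r. F' s (p + r * (q - p)))"

lemma mean_slope_refl: "mean_slope F' s p p = F' s p"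
  by (simp add: mean_slope_def)

lemma mean_slope:
  assumes "\<And>x. (F s has_real_derivative F' s x) (at x)"
  shows "F s q - F s p = mean_slope F' s p q * (q - p)"
proof -
  have "((\<lambda>r. F' s (p + r * (q - p)) * (q - p)) has_integral (F s (p + 1 * (q - p)) - F s (p + 0 * (q - p)))) {0..1}"
  proof (rule fundamental_theorem_of_calculus)
    fix r :: real
    have "((\<lambda>r. p + r * (q - p)) has_real_derivative (q - p)) (at r)"
      by (auto intro!: derivative_eq_intros)
    from DERIV_chain2[OF assms this]
    show "((\<lambda>r. F s (p + r * (q - p))) has_vector_derivative F' s (p + r * (q - p)) * (q - p)) (at r within {0..1})"
      by (simp add: has_real_derivative_iff_has_vector_derivative has_vector_derivative_at_within)
  qed simp
  from integral_unique[OF this] show ?thesis by (simp add: mean_slope_def)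
qed

lemma continuous_mean_slope:
  assumes "continuous_on ({0..} \<times> UNIV) (\<lambda>(t, x). F' t x)"
    and "continuous_on S a" "continuous_on S b" "continuous_on S c" "\<And>z. z \<in> S \<Longrightarrow> a z \<ge> 0"
  shows "continuous_on S (\<lambda>z. mean_slope F' (a z) (b z) (c z))"
proof -
  have "continuous_on (S \<times> cbox 0 1) (\<lambda>y. F' (a (fst y)) (b (fst y) + snd y * (c (fst y) - b (fst y))))"
    by (rule continuous_on_quadrant_compose[OF assms(1)])
      (auto intro!: continuous_intros continuous_on_compose2[OF assms(2)] continuous_on_compose2[OF assms(3)]
         continuous_on_compose2[OF assms(4)] simp: assms(5))
  then show ?thesis
    using integral_continuous_on_param[of S 0 "1::real" "\<lambda>z r. F' (a z) (b z + r * (c z - b z))"]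
    by (simp add: mean_slope_def case_prod_unfold)
qed

lemma ode_unique:
  assumes F: "Sdecay w F"
    and a: "\<And>t. t \<ge> 0 \<Longrightarrow> (a has_real_derivative F t (a t)) (at t within {0..})"
    and b: "\<And>t. t \<ge> 0 \<Longrightarrow> (b has_real_derivative F t (b t)) (at t within {0..})"
    and "a 0 = b 0" "t \<ge> 0"
  shows "a t = b t"
proof -
  note F' = Sdecay_vd[OF F]
  have c: "continuous_on {0..} f" if "\<And>t. t \<ge> 0 \<Longrightarrow> (f has_real_derivative f' t) (at t within {0..})" for f f' :: "real \<Rightarrow> real"
    using that by (intro DERIV_continuous_on) auto
  have "b t - a t = (b 0 - a 0) * exp (integral {0..t} (\<lambda>s. mean_slope (\<lambda>t. vd (F t)) s (a s) (b s)))"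
  proof (rule linear_ode)
    show "continuous_on {0..} (\<lambda>s. mean_slope (\<lambda>t. vd (F t)) s (a s) (b s))"
      by (rule continuous_mean_slope[OF Sdecay_imp_continuous[OF F'(1)] continuous_on_id c[OF a] c[OF b]]) auto
    show "((\<lambda>t. b t - a t) has_real_derivative mean_slope (\<lambda>t. vd (F t)) t (a t) (b t) * (b t - a t)) (at t within {0..})"
      if "t \<ge> 0" for t
      using DERIV_diff[OF b[OF that] a[OF that]] mean_slope[of F t "\<lambda>t. vd (F t)" "b t" "a t", OF F'(2)[OF that]] by simp
  qed fact
  then show ?thesis using assms(4) by simp
qed

lemma continuous_on_shifted:
  assumes "continuous_on ({0..} \<times> UNIV) (\<lambda>(t, x). F t x)" "continuous_on ({0..} \<times> UNIV) (\<lambda>(t, x). u t x)"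
  shows "continuous_on ({0..} \<times> UNIV) (\<lambda>(t::real, x::real). F t (x + u t x) :: real)"
  using assms(2) unfolding case_prod_unfold
  by (intro continuous_on_quadrant_compose[OF assms(1)] continuous_intros) auto

text \<open>Picard iteration for all starting points x at once. The unknown v is a bounded
  continuous function on the plane, and the weight exp (K t) in u makes the iteration a contraction
  on the whole half-line, so no continuation in time is needed.\<close>

lemma exists_displacement:
  assumes F: "Sdecay w F" and w: "w > 0"
  obtains u where "decaying 0 u" "\<And>t x. t \<ge> 0 \<Longrightarrow> u t x = a + integral {0..t} (\<lambda>s. F s (x + u s x))"
proof -
  note F' = Sdecay_vd[OF F]
  note contF = Sdecay_imp_continuous[OF F]
  obtain C where C: "C \<ge> 0" "\<And>t x. t \<ge> 0 \<Longrightarrow> \<bar>F t x\<bar> \<le> C * exp (- w * t)"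
    using F by (rule Sdecay_imp_bounded) (rule that)
  obtain B where B: "B \<ge> 0" "\<And>t x. t \<ge> 0 \<Longrightarrow> \<bar>vd (F t) x\<bar> \<le> B * exp (- 0 * t)"
    using Sdecay_mono[OF F'(1), of 0] w by (rule_tac Sdecay_imp_bounded) (auto intro: that)
  have lip: "\<bar>F t x - F t y\<bar> \<le> B * \<bar>x - y\<bar>" if "t \<ge> 0" for t x y
    using field_differentiable_bound[OF convex_UNIV, of "F t" "vd (F t)" B x y] F'(2)[OF that] B(2)[OF that] by simp
  \<comment> \<open>K > 2 B gives the contraction factor B / K \<le> 1 / 2; the summand 1 keeps K
    positive when B = 0.\<close>
  define K where "K = 2 * B + 1"
  have K: "K > 0" "B / K \<le> 1 / 2" using B(1) by (auto simp: K_def field_simps)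
  define u where "u v t x = a + exp (K * t) * apply_bcontfun v (t, x)" for v :: "(real \<times> real) \<Rightarrow>\<^sub>C real" and t x
  have contu: "continuous_on ({0..} \<times> UNIV) (\<lambda>(t, x). u v t x)" for v
    unfolding u_def case_prod_unfold by (auto intro!: continuous_intros)
  define J where "J v t x = integral {0..t} (\<lambda>s. F s (x + u v s x))" for v t x
  have G: "decaying w (\<lambda>t x. F t (x + u v t x))" for v
    unfolding decaying_def using continuous_on_shifted[OF contF contu] C(2) by blast
  have contJ: "continuous_on ({0..} \<times> UNIV) (\<lambda>(t, x). J v t x)" for v
    unfolding J_def using G by (intro continuous_on_time_integral) (auto simp: decaying_def)
  \<comment> \<open>\<open>max 0\<close> extends the iterate to negative times, because bounded
    continuous functions live on the whole plane.\<close>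
  define T where "T v = (\<lambda>z. exp (- K * max 0 (fst z)) * J v (max 0 (fst z)) (snd z))" for v
  have Tb: "T v \<in> bcontfun" for v
  proof -
    have "continuous_on UNIV (\<lambda>z. J v (max 0 (fst z)) (snd z))"
      by (rule continuous_on_quadrant_compose[OF contJ]) (auto intro!: continuous_intros)
    then have 1: "continuous_on UNIV (T v)"
      unfolding T_def by (intro continuous_intros)
    obtain M where M: "M \<ge> 0" "\<And>t x. t \<ge> 0 \<Longrightarrow> \<bar>J v t x\<bar> \<le> M * exp (- 0 * t)"
      using decaying_time_integral[OF G w, of v, folded J_def] by (rule decayingD) (rule that)
    have "norm (T v z) \<le> 1 * M" for z
      unfolding T_def norm_mult using K(1) M(2)[of "max 0 (fst z)" "snd z"]
      by (intro mult_mono) auto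
    then have "bounded (range (T v))" by (auto simp: bounded_iff)
    with 1 show ?thesis by (simp add: bcontfun_def)
  qed
  have ex: "\<exists>!v. Bcontfun (T v) = v"
  proof (rule banach_fix_type)
    show "(0::real) \<le> 1 / 2" "(1 / 2 :: real) < 1" by auto
    show "\<forall>v v'. dist (Bcontfun (T v)) (Bcontfun (T v')) \<le> 1 / 2 * dist v v'"
    proof (intro allI dist_bound)
      fix v v' :: "(real \<times> real) \<Rightarrow>\<^sub>C real" and z :: "real \<times> real"
      define t x where "t = max 0 (fst z)" and "x = snd z"
      have t: "t \<ge> 0" by (simp add: t_def)
      define D where "D = dist v v'"
      have D0: "D \<ge> 0" by (simp add: D_def)
      have int: "(\<lambda>s. F s (x + u v s x)) integrable_on {0..t}" for v
        by (intro integrable_continuous_real decaying_path_continuous[OF G]) auto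
      have ei: "((\<lambda>s. B * D * exp (K * s)) has_integral (B * D / K * exp (K * t) - B * D / K * exp (K * 0))) {0..t}"
        using t K(1) by (intro fundamental_theorem_of_calculus)
          (auto intro!: derivative_eq_intros simp flip: has_real_derivative_iff_has_vector_derivative)
      have "\<bar>J v t x - J v' t x\<bar> = norm (integral {0..t} (\<lambda>s. F s (x + u v s x) - F s (x + u v' s x)))"
        unfolding J_def by (simp add: integral_diff int)
      also have "\<dots> \<le> integral {0..t} (\<lambda>s. B * D * exp (K * s))"
      proof (intro integral_norm_bound_integral integrable_diff int has_integral_integrable[OF ei])
        fix s assume "s \<in> {0..t}"
        then have "norm (F s (x + u v s x) - F s (x + u v' s x)) \<le> B * \<bar>(x + u v s x) - (x + u v' s x)\<bar>"
          using lip[of s "x + u v s x" "x + u v' s x"] by (simp del: add_diff_cancel_left)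
        also have "(x + u v s x) - (x + u v' s x) = exp (K * s) * (v (s, x) - v' (s, x))"
          by (simp add: u_def algebra_simps)
        also have "B * \<bar>exp (K * s) * (v (s, x) - v' (s, x))\<bar> \<le> B * (exp (K * s) * D)"
          using dist_bounded[of v "(s, x)" v'] B(1)
          unfolding abs_mult D_def by (intro mult_left_mono) (auto simp: dist_real_def)
        finally show "norm (F s (x + u v s x) - F s (x + u v' s x)) \<le> B * D * exp (K * s)"
          by (simp add: algebra_simps)
      qed
      also have "\<dots> = B * D / K * exp (K * t) - B * D / K * exp (K * 0)"
        using ei by (rule integral_unique)
      also have "\<dots> \<le> B / K * D * exp (K * t)" using B(1) D0 K(1) by simp
      also have "\<dots> \<le> 1 / 2 * D * exp (K * t)"
        using K(2) D0 by (intro mult_right_mono) auto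
      finally have J: "\<bar>J v t x - J v' t x\<bar> \<le> 1 / 2 * D * exp (K * t)" .
      have "dist (T v z) (T v' z) = exp (- K * t) * \<bar>J v t x - J v' t x\<bar>"
        by (simp add: T_def t_def[symmetric] x_def[symmetric] dist_real_def abs_mult flip: right_diff_distrib)
      also have "\<dots> \<le> exp (- K * t) * (1 / 2 * D * exp (K * t))"
        using J by (intro mult_left_mono) auto
      also have "\<dots> = 1 / 2 * D" by (simp add: exp_minus)
      finally show "dist (Bcontfun (T v) z) (Bcontfun (T v') z) \<le> 1 / 2 * dist v v'"
        by (simp add: Bcontfun_inverse[OF Tb] D_def)
    qed
  qed
  then obtain v where "Bcontfun (T v) = v" by blast
  then have v: "apply_bcontfun v z = T v z" for z using Bcontfun_inverse[OF Tb, of v] by metis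
  have eq: "u v t x = a + integral {0..t} (\<lambda>s. F s (x + u v s x))" if "t \<ge> 0" for t x
    unfolding J_def[symmetric] using that v[of "(t, x)"] by (simp add: u_def[of v t x] T_def exp_minus)
  have "decaying 0 (\<lambda>t x. a + integral {0..t} (\<lambda>s. F s (x + u v s x)))"
    by (intro decaying_add decaying_const decaying_time_integral[OF G w])
  then have "decaying 0 (u v)" by (rule decaying_cong) (rule eq)
  then show ?thesis using eq by (rule that)
qed

text \<open>The x-derivative of the map x + u is exp q, where q is the time integral of F_x along
  the trajectory. Since F_x decays, q is bounded, which yields the bound c uniformly in time. The
  same formula also raises the regularity of u.\<close>

lemma displacement:
  assumes F: "Sdecay w F" and w: "w > 0"
  obtains u c where "Sdecay 0 u" "\<And>x. u 0 x = a" "c > 0" "\<And>t x. t \<ge> 0 \<Longrightarrow> c \<le> 1 + vd (u t) x"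
    "\<And>t x. t \<ge> 0 \<Longrightarrow> ((\<lambda>t. u t x) has_real_derivative F t (x + u t x)) (at t within {0..})"
proof -
  note F' = Sdecay_vd[OF F]
  note contF = Sdecay_imp_continuous[OF F] and contF' = Sdecay_imp_continuous[OF F'(1)]
  obtain u where u0: "decaying 0 u" and ueq: "\<And>t x. t \<ge> 0 \<Longrightarrow> u t x = a + integral {0..t} (\<lambda>s. F s (x + u s x))"
    using F w by (rule exists_displacement) (rule that)
  have contu: "continuous_on ({0..} \<times> UNIV) (\<lambda>(t, x). u t x)" using u0 by (simp add: decaying_def)
  have ut: "((\<lambda>t. u t x) has_real_derivative F t (x + u t x)) (at t within {0..})" if "t \<ge> 0" for t x
  proof (rule has_real_derivative_cong_halfline[OF _ that])
    have "continuous_on {0..} (\<lambda>s. F s (x + u s x))"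
      by (rule continuous_on_quadrant_compose[OF continuous_on_shifted[OF contF contu]]) (auto intro: continuous_intros)
    from has_real_derivative_time_integral[OF this that]
    show "((\<lambda>t. a + integral {0..t} (\<lambda>s. F s (x + u s x))) has_real_derivative F t (x + u t x)) (at t within {0..})"
      by (auto intro!: derivative_eq_intros)
  qed (rule ueq)
  define q where "q t x = integral {0..t} (\<lambda>s. vd (F s) (x + u s x))" for t x
  have ux: "(u t has_real_derivative exp (q t x) - 1) (at x)" if t: "t \<ge> 0" for t x
  proof -
    \<comment> \<open>The distance of two trajectories solves a linear equation with coefficient Q;
      as y tends to x, Q becomes F_x along the trajectory of x.\<close>
    define Q where "Q y s = mean_slope (\<lambda>t. vd (F t)) s (x + u s x) (y + u s y)" for y s
    have contQ: "continuous_on ({0..} \<times> UNIV) (\<lambda>(s, y). Q y s)"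
      unfolding Q_def case_prod_unfold
      by (rule continuous_mean_slope[OF contF'])
       (auto intro!: continuous_intros continuous_on_quadrant_compose[OF contu])
    have eq: "(y + u t y) - (x + u t x) = exp (integral {0..t} (Q y)) * (y - x)" for y
    proof -
      have "(y + u t y) - (x + u t x) = ((y + u 0 y) - (x + u 0 x)) * exp (integral {0..t} (Q y))"
      proof (rule linear_ode[OF _ _ t])
        show "continuous_on {0..} (Q y)"
          by (rule continuous_on_quadrant_compose[OF contQ]) (auto intro: continuous_intros)
        show "((\<lambda>t. (y + u t y) - (x + u t x)) has_real_derivative Q y s * ((y + u s y) - (x + u s x))) (at s within {0..})"
          if "s \<ge> 0" for s
          using mean_slope[of F s "\<lambda>t. vd (F t)" "y + u s y" "x + u s x", OF F'(2)[OF that]]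
          by (auto intro!: derivative_eq_intros ut that simp: Q_def)
      qed
      then show ?thesis using ueq[of 0] by (simp add: mult.commute)
    qed
    have "continuous_on UNIV (\<lambda>y. integral {0..t} (Q y))"
      by (rule continuous_on_quadrant_compose[OF continuous_on_time_integral[OF contQ]]) (use t in \<open>auto intro: continuous_intros\<close>)
    then have "isCont (\<lambda>y. exp (integral {0..t} (Q y))) x"
      by (auto intro!: continuous_intros simp: continuous_on_eq_continuous_at)
    moreover have "integral {0..t} (Q x) = q t x" 
      by (simp add: q_def Q_def[abs_def] mean_slope_refl)
    \<comment> \<open>Caratheodory's criterion: the increment is y - x times a factor continuous in
      y.\<close>
    ultimately have "((\<lambda>y. y + u t y) has_real_derivative exp (q t x)) (at x)"
      using eq by (auto simp: CARAT_DERIV intro!: exI[of _ "\<lambda>y. exp (integral {0..t} (Q y))"])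
    from DERIV_diff[OF this DERIV_ident] show ?thesis by simp
  qed
  \<comment> \<open>Bootstrap: order n of u gives order n of q, hence of u_x = exp q - 1, and order
    n of u_t, so together order n + 1 of u.\<close>
  have Cn: "Cdecay n 0 u" for n
  proof (induction n)
    case (Suc n)
    have "Cdecay n 0 q"
      unfolding q_def by (rule Cdecay_time_integral[OF w Cdecay_compose_shift[OF _ Suc F'(1)]]) (use w in simp)
    then have 1: "Cdecay n 0 (\<lambda>t x. exp (q t x) - 1)"
      by (intro Cdecay_diff Cdecay_exp Cdecay_const)
    have 2: "Cdecay n 0 (\<lambda>t x. F t (x + u t x))"
      by (rule Cdecay_mono[OF Cdecay_compose_shift[OF _ Suc F]]) (use w in auto)
    show ?case using u0 1 2 ux ut by (rule CdecayI)
  qed (use u0 in simp)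
  then have Su: "Sdecay 0 u" by (simp add: Sdecay_def)
  have "Sdecay 0 q"
    unfolding q_def by (rule Sdecay_time_integral[OF Sdecay_compose_shift[OF F'(1) Su] w]) (use w in simp)
  then obtain M where M: "\<And>t x. t \<ge> 0 \<Longrightarrow> \<bar>q t x\<bar> \<le> M * exp (- 0 * t)"
    by (rule Sdecay_imp_bounded) (rule that)
  have "exp (- M) \<le> 1 + vd (u t) x" if "t \<ge> 0" for t x
  proof -
    have "vd (u t) = (\<lambda>x. exp (q t x) - 1)" using ux[OF that] by (rule vd_eqI_real)
    moreover have "- M \<le> q t x" using M[OF that, of x] by simp
    ultimately show ?thesis by simp
  qed
  moreover have "u 0 x = a" for x using ueq[of 0] by simp
  ultimately show ?thesis using Su ut by (intro that[of u "exp (- M)"]) auto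
qed

subsection \<open>Legendre curves with support function\<close>

definition unit_vec :: "real \<Rightarrow> real^2" where
  "unit_vec x = vector [cos x, sin x]"

lemma inner_2: "(v :: real^2) \<bullet> w = v $ 1 * w $ 1 + v $ 2 * w $ 2"
  by (simp add: inner_vec_def sum_2)

lemma rot_nth [simp]: "rot v $ 1 = - (v $ 2)" "rot v $ 2 = v $ 1"
  by (simp_all add: rot_def)

lemma unit_vec_nth [simp]: "unit_vec x $ 1 = cos x" "unit_vec x $ 2 = sin x"
  by (simp_all add: unit_vec_def)

lemma rot_rot: "rot (rot v) = - v"
  by (simp add: vec_eq_iff forall_2)

lemma inner_rot_self [simp]: "v \<bullet> rot v = 0" "rot v \<bullet> v = 0"
  by (simp_all add: inner_2)

lemma inner_rot_rot [simp]: "rot v \<bullet> rot w = v \<bullet> w"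
  by (simp add: inner_2)

lemma inner_rot_left: "rot v \<bullet> w = - (v \<bullet> rot w)"
  by (simp add: inner_2)

lemma norm_rot [simp]: "norm (rot v) = norm v"
  by (simp add: norm_eq_sqrt_inner)

lemma norm_unit_vec [simp]: "norm (unit_vec x) = 1"
  by (simp add: norm_eq_sqrt_inner inner_2 flip: power2_eq_square)

lemma inner_unit_vec_self [simp]: "unit_vec x \<bullet> unit_vec x = 1"
  by (simp add: inner_2 flip: power2_eq_square)

lemma unit_vec_periodic: "unit_vec (x + 2 * pi) = unit_vec x"
  by (simp add: unit_vec_def)

lemma bounded_linear_rot: "bounded_linear rot"
  unfolding linear_conv_bounded_linear[symmetric]
  by (rule linearI) (simp_all add: vec_eq_iff forall_2)

lemma has_vector_derivative_rot:
  "(f has_vector_derivative f') F \<Longrightarrow> ((\<lambda>x. rot (f x)) has_vector_derivative rot f') F"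
  by (rule bounded_linear.has_vector_derivative[OF bounded_linear_rot])

lemma has_vector_derivative_unit_vec:
  assumes "(f has_real_derivative f') (at x within S)"
  shows "((\<lambda>x. unit_vec (f x)) has_vector_derivative f' *\<^sub>R rot (unit_vec (f x))) (at x within S)"
proof -
  have "((\<lambda>x. unit_vec (f x)) has_vector_derivative vector [- sin (f x) * f', cos (f x) * f']) (at x within S)"
    unfolding unit_vec_def using assms
    by (intro has_vector_derivative_vector_2)
      (auto intro!: derivative_eq_intros simp flip: has_real_derivative_iff_has_vector_derivative)
  moreover have "f' *\<^sub>R rot (unit_vec (f x)) = vector [- sin (f x) * f', cos (f x) * f']"
    by (simp add: vec_eq_iff forall_2)
  ultimately show ?thesis by simp
qed

lemma has_vector_derivative_nth:
  "(f has_vector_derivative f') F \<Longrightarrow> ((\<lambda>x. f x $ i) has_vector_derivative f' $ i) F"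
  by (rule bounded_linear.has_vector_derivative[OF bounded_linear_vec_nth])

lemma has_real_derivative_inner:
  fixes f g :: "real \<Rightarrow> real^2"
  assumes "(f has_vector_derivative f') (at x within S)" "(g has_vector_derivative g') (at x within S)"
  shows "((\<lambda>x. f x \<bullet> g x) has_real_derivative f x \<bullet> g' + f' \<bullet> g x) (at x within S)"
  using bounded_bilinear.has_vector_derivative[OF bounded_bilinear_inner assms]
  by (simp add: has_real_derivative_iff_has_vector_derivative)

lemma frame_expansion:
  assumes "norm (n :: real^2) = 1"
  shows "w = (w \<bullet> n) *\<^sub>R n + (w \<bullet> rot n) *\<^sub>R rot n"
proof -
  have n: "n $ 1 * n $ 1 + n $ 2 * n $ 2 = 1"
    using assms by (simp add: norm_eq_1 inner_2)
  have "w $ 1 * (n $ 1 * n $ 1 + n $ 2 * n $ 2) = (w $ 1 * n $ 1 + w $ 2 * n $ 2) * n $ 1 - (- (w $ 1 * n $ 2) + w $ 2 * n $ 1) * n $ 2"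
    "w $ 2 * (n $ 1 * n $ 1 + n $ 2 * n $ 2) = (w $ 1 * n $ 1 + w $ 2 * n $ 2) * n $ 2 + (- (w $ 1 * n $ 2) + w $ 2 * n $ 1) * n $ 1"
    by algebra+
  then show ?thesis by (simp add: vec_eq_iff forall_2 inner_2 n)
qed

lemma unit_vectors_eqI:
  assumes "norm (v :: real^2) = 1" "norm w = 1" "v \<bullet> w = 1"
  shows "v = w"
proof -
  have "(v - w) \<bullet> (v - w) = 0"
    using assms by (simp add: inner_diff_left inner_diff_right norm_eq_1 inner_commute)
  then show ?thesis by simp
qed

lemma obtain_angle:
  assumes "norm (v :: real^2) = 1"
  obtains a where "v = unit_vec a"
proof -
  have "(v $ 1)\<^sup>2 + (v $ 2)\<^sup>2 = 1" using assms by (simp add: norm_eq_1 inner_2 power2_eq_square)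
  then obtain a where "v $ 1 = cos a" "v $ 2 = sin a" using sincos_total_2pi by metis
  then show ?thesis by (intro that[of a]) (simp add: vec_eq_iff forall_2)
qed

text \<open>The inner product of N with the unit vector of angle \<theta> is constant because both
  turn with angular velocity \<omega>. This lifts a normal to an angle without covering spaces, and
  it is used both along the curve (S = UNIV) and in time (S = {0..}).\<close>

lemma rotating_frame:
  assumes S: "convex S" "x0 \<in> S"
    and N: "\<And>x. x \<in> S \<Longrightarrow> (N has_vector_derivative \<omega> x *\<^sub>R rot (N x)) (at x within S)"
    and \<theta>: "\<And>x. x \<in> S \<Longrightarrow> (\<theta> has_real_derivative \<omega> x) (at x within S)"
    and un: "\<And>x. x \<in> S \<Longrightarrow> norm (N x) = 1" and "N x0 = unit_vec (\<theta> x0)" and x: "x \<in> S"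
  shows "N x = unit_vec (\<theta> x)"
proof -
  have "((\<lambda>x. N x \<bullet> unit_vec (\<theta> x)) has_real_derivative 0) (at x within S)" if "x \<in> S" for x
    using has_real_derivative_inner[OF N[OF that] has_vector_derivative_unit_vec[OF \<theta>[OF that]]]
    by (simp add: inner_rot_left)
  then have "\<exists>c. \<forall>x\<in>S. N x \<bullet> unit_vec (\<theta> x) = c"
    by (rule has_field_derivative_zero_constant[OF S(1)])
  then have "N x \<bullet> unit_vec (\<theta> x) = N x0 \<bullet> unit_vec (\<theta> x0)" using x S(2) by auto
  then have "N x \<bullet> unit_vec (\<theta> x) = 1" by (simp add: assms(6))
  with un[OF x] show ?thesis by (intro unit_vectors_eqI) auto
qed

lemma legendre_curveD:
  assumes "legendre_curve \<gamma> \<nu>"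
  shows "(\<gamma> has_vector_derivative beta \<gamma> \<nu> x *\<^sub>R rot (\<nu> x)) (at x)"
    "(\<nu> has_vector_derivative ell \<nu> x *\<^sub>R rot (\<nu> x)) (at x)"
proof -
  have u: "norm (\<nu> x) = 1" for x using assms by (auto simp: legendre_curve_def)
  have s: "smooth \<gamma>" "smooth \<nu>" and orth: "vd \<gamma> x \<bullet> \<nu> x = 0"
    using assms by (auto simp: legendre_curve_def)
  have "vd \<gamma> x = beta \<gamma> \<nu> x *\<^sub>R rot (\<nu> x)"
    by (subst frame_expansion[OF u[of x]]) (simp add: orth beta_def)
  with smoothD[OF s(1)] show "(\<gamma> has_vector_derivative beta \<gamma> \<nu> x *\<^sub>R rot (\<nu> x)) (at x)" by metis
  have "((\<lambda>x. \<nu> x \<bullet> \<nu> x) has_real_derivative 2 * (vd \<nu> x \<bullet> \<nu> x)) (at x)"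
    using has_real_derivative_inner[OF smoothD[OF s(2)] smoothD[OF s(2)], of x] by (simp add: inner_commute)
  moreover have "(\<lambda>x. \<nu> x \<bullet> \<nu> x) = (\<lambda>x. 1)" using u by (simp add: norm_eq_1)
  ultimately have "2 * (vd \<nu> x \<bullet> \<nu> x) = 0"
    using DERIV_unique[OF _ DERIV_const] by metis
  then have "vd \<nu> x = ell \<nu> x *\<^sub>R rot (\<nu> x)"
    by (subst frame_expansion[OF u[of x]]) (simp add: ell_def)
  with smoothD[OF s(2)] show "(\<nu> has_vector_derivative ell \<nu> x *\<^sub>R rot (\<nu> x)) (at x)" by metis
qed

lemma smooth_nth:
  assumes "smooth (f :: real \<Rightarrow> real^2)"
  shows "smooth (\<lambda>x. f x $ i)"
proof (rule smoothI[where X="\<lambda>g. \<exists>f :: real \<Rightarrow> real^2. smooth f \<and> g = (\<lambda>x. f x $ i)"])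
  fix g assume "\<exists>f :: real \<Rightarrow> real^2. smooth f \<and> g = (\<lambda>x. f x $ i)"
  then obtain f :: "real \<Rightarrow> real^2" where f: "smooth f" "g = (\<lambda>x. f x $ i)" by blast
  then show "\<exists>f'. (\<exists>f :: real \<Rightarrow> real^2. smooth f \<and> f' = (\<lambda>x. f x $ i)) \<and> (\<forall>x. (g has_vector_derivative f' x) (at x))"
    using smooth_vd[OF f(1)] has_vector_derivative_nth[OF smoothD[OF f(1)]] by blast
qed (use assms in blast)

lemma Sdecay_shift: "Sdecay 0 (\<lambda>t. f) \<Longrightarrow> Sdecay 0 (\<lambda>t x. f (x + b))"
  using Sdecay_compose_shift[of 0 "\<lambda>t. f" "\<lambda>t x. b"] Sdecay_const by simp

text \<open>With ell = 1 the normal turns at unit speed, so the normal angle is \<theta> + a. The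
  function p takes the normal angle as its argument, which keeps the shift a out of p.\<close>

lemma normal_form:
  assumes L: "legendre_curve \<gamma> \<nu>" and ell: "\<And>\<theta>. ell \<nu> \<theta> = 1" and a: "\<nu> x0 = unit_vec (x0 + a)"
  obtains p where "Sdecay 0 (\<lambda>t. p)" "\<And>x. p (x + 2 * pi) = p x" "\<And>\<theta>. \<nu> \<theta> = unit_vec (\<theta> + a)"
    "\<And>\<theta>. support \<gamma> \<nu> \<theta> = p (\<theta> + a)"
    "\<And>\<theta>. beta \<gamma> \<nu> \<theta> = p (\<theta> + a) + vd (vd p) (\<theta> + a)"
    "\<And>\<theta>. \<gamma> \<theta> = p (\<theta> + a) *\<^sub>R unit_vec (\<theta> + a) + vd p (\<theta> + a) *\<^sub>R rot (unit_vec (\<theta> + a))"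
proof -
  note D = legendre_curveD[OF L]
  have s: "smooth \<gamma>" and per: "\<And>\<theta>. \<gamma> (\<theta> + 2 * pi) = \<gamma> \<theta>" and un: "\<And>\<theta>. norm (\<nu> \<theta>) = 1"
    using L by (auto simp: legendre_curve_def)
  have N: "\<nu> \<theta> = unit_vec (\<theta> + a)" for \<theta>
    by (rule rotating_frame[of UNIV x0 \<nu> "\<lambda>_. 1" "\<lambda>x. x + a"])
      (use D(2) ell a un in \<open>auto intro!: derivative_eq_intros\<close>)
  define p where "p y = \<gamma> (y - a) \<bullet> unit_vec y" for y
  have gi: "Sdecay 0 (\<lambda>t x. \<gamma> (x + - a) $ i)" for i
    by (intro Sdecay_shift[of "\<lambda>x. \<gamma> x $ i"] Sdecay_smooth_periodic[where p="2 * pi"] smooth_nth s) (auto simp: per)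
  have "Sdecay 0 (\<lambda>t y. \<gamma> (y + - a) $ 1 * cos y + \<gamma> (y + - a) $ 2 * sin y)"
    by (intro Sdecay_add Sdecay_mult[where ?w1.0=0 and ?w2.0=0] gi Sdecay_cos Sdecay_sin) auto
  then have pS: "Sdecay 0 (\<lambda>t. p)" by (simp add: p_def[abs_def] inner_2)
  have gd: "((\<lambda>y. \<gamma> (y - a)) has_vector_derivative beta \<gamma> \<nu> (y - a) *\<^sub>R rot (unit_vec y)) (at y)" for y
  proof -
    have "((\<lambda>y. y - a) has_vector_derivative 1) (at y)"
      by (auto intro!: derivative_eq_intros simp flip: has_real_derivative_iff_has_vector_derivative)
    from vector_diff_chain_at[OF this D(1)] N[of "y - a"] show ?thesis by (simp add: o_def)
  qed
  have ud: "(unit_vec has_vector_derivative rot (unit_vec y)) (at y)" for y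
    using has_vector_derivative_unit_vec[of "\<lambda>x. x" 1 y UNIV] by simp
  have p': "vd p = (\<lambda>y. \<gamma> (y - a) \<bullet> rot (unit_vec y))"
    unfolding p_def[abs_def]
    by (rule vd_eqI_real) (use has_real_derivative_inner[OF gd ud] in simp)
  have rd: "((\<lambda>y. rot (unit_vec y)) has_vector_derivative - unit_vec y) (at y)" for y
    using has_vector_derivative_rot[OF ud] by (simp add: rot_rot)
  have "vd (vd p) = (\<lambda>y. - (\<gamma> (y - a) \<bullet> unit_vec y) + beta \<gamma> \<nu> (y - a))"
    unfolding p'
    by (rule vd_eqI_real) (use has_real_derivative_inner[OF gd rd] in simp)
  then have p'': "beta \<gamma> \<nu> \<theta> = p (\<theta> + a) + vd (vd p) (\<theta> + a)" for \<theta> by (simp add: p_def)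
  have "\<gamma> \<theta> = p (\<theta> + a) *\<^sub>R unit_vec (\<theta> + a) + vd p (\<theta> + a) *\<^sub>R rot (unit_vec (\<theta> + a))" for \<theta>
    using frame_expansion[OF norm_unit_vec, of "\<gamma> \<theta>" "\<theta> + a"] by (simp add: p_def p')
  moreover have "p (x + 2 * pi) = p x" for x
    using per[of "x - a"] unit_vec_periodic[of x] by (simp add: p_def algebra_simps)
  ultimately show ?thesis
    using pS N p'' by (intro that[of p]) (auto simp: support_def p_def)
qed

text \<open>\<alpha> may run backwards, so this is not a change of variables by a monotone map.
  Instead an antiderivative H of g is composed with \<alpha>, and the increment of H over a period
  does not depend on where the period starts.\<close>

lemma integral_periodic_substitution:
  fixes g :: "real \<Rightarrow> real"
  assumes g: "continuous_on UNIV g" "\<And>x. g (x + 2 * pi) = g x"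
    and \<alpha>: "\<And>x. (\<alpha> has_real_derivative \<alpha>' x) (at x)" "\<alpha> (2 * pi) = \<alpha> 0 + 2 * pi"
  shows "((\<lambda>x. \<alpha>' x * g (\<alpha> x)) has_integral integral {0..2 * pi} g) {0..2 * pi}"
proof -
  have "bounded (\<alpha> ` {0..2 * pi})"
    by (intro compact_imp_bounded compact_continuous_image DERIV_continuous_on) (use \<alpha>(1) in \<open>auto intro: has_field_derivative_at_within\<close>)
  then obtain M where M: "\<forall>x\<in>{0..2 * pi}. \<bar>\<alpha> x\<bar> \<le> M"
    unfolding bounded_iff by auto
  \<comment> \<open>H is integrated from - K. The interval from - K to K is made large enough to
    contain the values of \<alpha>, the period from 0 to 2 pi, and \<alpha> 0 + 2 pi.\<close>
  define K where "K = M + 4 * pi"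
  have "\<bar>\<alpha> 0\<bar> \<le> M" using M by simp
  then have K: "M < K" "2 * pi < K" "\<bar>\<alpha> 0 + 2 * pi\<bar> < K" using pi_gt_zero unfolding K_def by linarith+
  define H where "H y = integral {- K..y} g" for y
  have H: "(H has_real_derivative g y) (at y)" if "- K < y" "y < K" for y
  proof -
    have "(H has_real_derivative g y) (at y within {- K..K})"
      unfolding H_def by (rule integral_has_real_derivative) (use that in \<open>auto intro: continuous_on_subset[OF g(1)]\<close>)
    moreover have "at y within {- K..K} = at y"
      by (rule at_within_interior) (use that in simp)
    ultimately show ?thesis by simp
  qed
  have "((\<lambda>x. \<alpha>' x * g (\<alpha> x)) has_integral H (\<alpha> (2 * pi)) - H (\<alpha> 0)) {0..2 * pi}"
  proof (rule fundamental_theorem_of_calculus)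
    fix x assume "x \<in> {0..2 * pi}"
    then have "- K < \<alpha> x" "\<alpha> x < K" using M K by (auto simp: abs_le_iff dest!: bspec[of _ _ x])
    from DERIV_chain2[OF H[OF this] \<alpha>(1)[of x]]
    show "((\<lambda>x. H (\<alpha> x)) has_vector_derivative \<alpha>' x * g (\<alpha> x)) (at x within {0..2 * pi})"
      by (simp add: has_real_derivative_iff_has_vector_derivative has_vector_derivative_at_within mult.commute)
  qed simp
  moreover have "H (\<alpha> (2 * pi)) - H (\<alpha> 0) = H (2 * pi) - H 0"
  proof -
    define D where "D y = H (y + 2 * pi) - H y" for y
    have "\<exists>c. \<forall>y\<in>{- K<..<K - 2 * pi}. D y = c"
    proof (rule has_field_derivative_zero_constant)
      fix y assume y: "y \<in> {- K<..<K - 2 * pi}"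
      have 1: "- K < y + 2 * pi" "y + 2 * pi < K" "- K < y" "y < K"
        using y pi_gt_zero unfolding greaterThanLessThan_iff by linarith+
      have "((\<lambda>y. H (y + 2 * pi)) has_real_derivative g (y + 2 * pi)) (at y)"
        using H[OF 1(1,2)] by (simp add: DERIV_shift)
      from DERIV_diff[OF this H[OF 1(3,4)]]
      show "(D has_real_derivative 0) (at y within {- K<..<K - 2 * pi})"
        unfolding D_def[abs_def] g(2) by (auto intro: has_field_derivative_at_within)
    qed auto
    moreover have "\<alpha> 0 \<in> {- K<..<K - 2 * pi}" "0 \<in> {- K<..<K - 2 * pi}"
      using K \<open>\<bar>\<alpha> 0\<bar> \<le> M\<close> pi_gt_zero unfolding greaterThanLessThan_iff by linarith+
    ultimately have "D (\<alpha> 0) = D 0" by metis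
    then show ?thesis by (simp add: D_def \<alpha>(2))
  qed
  moreover have "H (2 * pi) - H 0 = integral {0..2 * pi} g"
  proof -
    have "integral {- K..0} g + integral {0..2 * pi} g = integral {- K..2 * pi} g"
    proof (rule Henstock_Kurzweil_Integration.integral_combine)
      show "- K \<le> 0" "0 \<le> 2 * pi" using K(2) pi_gt_zero by linarith+
    qed (auto intro!: integrable_continuous_real continuous_on_subset[OF g(1)])
    then show ?thesis by (simp add: H_def)
  qed
  ultimately show ?thesis by simp
qed

subsection \<open>The explicit solution\<close>

lemma antimono_halfline:
  fixes g :: "real \<Rightarrow> real"
  assumes g: "\<And>t. t \<ge> 0 \<Longrightarrow> (g has_real_derivative g' t) (at t within {0..})"
    and le: "\<And>t. t \<ge> 0 \<Longrightarrow> g' t \<le> 0" and t: "0 \<le> s" "s \<le> t"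
  shows "g t \<le> g s"
proof -
  have "(g' has_integral g t - g s) {s..t}"
    using t g[THEN DERIV_subset]
    by (intro fundamental_theorem_of_calculus) (auto simp flip: has_real_derivative_iff_has_vector_derivative)
  moreover have "((\<lambda>x. 0 :: real) has_integral 0) {s..t}" by simp
  ultimately have "g t - g s \<le> 0"
    by (rule has_integral_le) (use le t in auto)
  then show ?thesis by simp
qed

text \<open>The series has no modes of frequency 0 or 1.\<close>

lemma fser_mean_zero:
  assumes d: "rapid d" and t: "t \<ge> 0"
  shows "(fser d t has_integral 0) {0..2 * pi}"
    "((\<lambda>x. fser d t x * cos x) has_integral 0) {0..2 * pi}"
    "((\<lambda>x. fser d t x * sin x) has_integral 0) {0..2 * pi}"
proof -
  have c: "continuous_on S (fser d t)" for S
    by (rule decaying_slice_continuous[OF decaying_fser[OF d] t])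
  have "(fser d t) integrable_on {0..2 * pi}"
    "(\<lambda>x. fser d t x * cos x) integrable_on {0..2 * pi}"
    "(\<lambda>x. fser d t x * sin x) integrable_on {0..2 * pi}"
    by (intro integrable_continuous_real continuous_intros c)+
  then show "(fser d t has_integral 0) {0..2 * pi}"
    "((\<lambda>x. fser d t x * cos x) has_integral 0) {0..2 * pi}"
    "((\<lambda>x. fser d t x * sin x) has_integral 0) {0..2 * pi}"
    using fourier_fser[OF d t, of 0] fourier_fser[OF d t, of 1]
    by (simp_all add: has_integral_integrable_integral fourier_cos_def fourier_sin_def)
qed

lemma dT_dX: "dT (dX d) = dX (dT d)"
  by (simp add: dT_def dX_def fun_eq_iff)

text \<open>Green's identity: \<open>dT\<close> stands for 1 + d^2/dx^2, so the difference of the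
  integrands is the derivative of a periodic Wronskian.\<close>

lemma integral_fser_dT_symmetric:
  assumes "rapid d" "rapid e" "t \<ge> 0"
  shows "integral {0..2 * pi} (\<lambda>x. fser d t x * fser (dT e) t x) =
    integral {0..2 * pi} (\<lambda>x. fser (dT d) t x * fser e t x)"
proof -
  have c: "continuous_on S (fser d' t)" if "rapid d'" for S d'
    by (rule decaying_slice_continuous[OF decaying_fser[OF that] assms(3)])
  have D: "(fser d' t has_real_derivative fser (dX d') t x) (at x)" if "rapid d'" for d' x
    by (rule has_real_derivative_fser[OF that assms(3)])
  note r = assms(1,2) rapid_dX[OF assms(1)] rapid_dX[OF assms(2)]
  have hi: "((\<lambda>x. fser d t x * fser (dT e) t x - fser (dT d) t x * fser e t x) has_integral 0) {0..2 * pi}"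
  proof (rule has_integral_periodic_deriv)
    show "((\<lambda>x. fser d t x * fser (dX e) t x - fser (dX d) t x * fser e t x) has_real_derivative
        fser d t x * fser (dT e) t x - fser (dT d) t x * fser e t x) (at x)" for x
      using DERIV_diff[OF DERIV_mult[OF D[OF r(1)] D[OF r(4)]] DERIV_mult[OF D[OF r(3)] D[OF r(2)]], of x]
        fser_dT[OF assms(1,3), of x] fser_dT[OF assms(2,3), of x]
      by (simp add: algebra_simps)
    show "fser d t (2 * pi) * fser (dX e) t (2 * pi) - fser (dX d) t (2 * pi) * fser e t (2 * pi) =
        fser d t 0 * fser (dX e) t 0 - fser (dX d) t 0 * fser e t 0"
      using fser_periodic[of _ t 0] by simp
  qed
  have i: "(\<lambda>x. fser d t x * fser (dT e) t x) integrable_on {0..2 * pi}"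
    "(\<lambda>x. fser (dT d) t x * fser e t x) integrable_on {0..2 * pi}"
    by (intro integrable_continuous_real continuous_intros c r rapid_dT)+
  show ?thesis
    using integral_unique[OF hi] unfolding integral_diff[OF i] by simp
qed

section \<open>The explicit solution as a function of the normal angle\<close>

locale support_flow =
  fixes p :: "real \<Rightarrow> real"
  assumes p_Sdecay: "Sdecay 0 (\<lambda>t. p)" and p_periodic: "\<And>x. p (x + 2 * pi) = p x"
    and area_pos: "integral {0..2 * pi} (\<lambda>x. p x * (p x + vd (vd p) x)) > 0"
begin

definition d :: "nat \<Rightarrow> complex" where "d = fourier_coeffs p"
definition m :: real where "m = fourier_cos p 0 / (2 * pi)"
definition c1 :: real where "c1 = fourier_cos p 1 / pi"
definition c2 :: real where "c2 = fourier_sin p 1 / pi"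
definition A2 :: real where "A2 = integral {0..2 * pi} (\<lambda>x. p x * (p x + vd (vd p) x))"
text \<open>By orthogonality this is pi times the sum over k \<ge> 2 of (k^2 - 1) exp (2 (1 - k^2)
  t) times the squared modulus of the coefficient of frequency k. It is the isoperimetric deficit
  L^2 / (2 pi) - 2 A.\<close>

definition I :: "real \<Rightarrow> real" where
  "I t = - integral {0..2 * pi} (\<lambda>x. fser d t x * fser (dT d) t x)"
text \<open>The integral of beta^2 is 2 pi p0^2 + W, so W measures how far beta is from its
  mean.\<close>

definition W :: "real \<Rightarrow> real" where
  "W t = integral {0..2 * pi} (\<lambda>x. fser (dT d) t x * fser (dT d) t x)"

(* Conservation of area, 2 pi p0^2 - I = 2 A, determines the mean p0 of the support
   function up to its sign, which cannot change. *)
definition p0 :: "real \<Rightarrow> real" where "p0 t = sgn m * sqrt ((A2 + I t) / (2 * pi))"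
definition lamt :: "real \<Rightarrow> real" where "lamt t = (2 * pi * (p0 t)\<^sup>2 + W t) / (2 * pi * p0 t)"
definition P :: "real \<Rightarrow> real \<Rightarrow> real" where "P t x = p0 t + (c1 * cos x + c2 * sin x) + fser d t x"
definition Px :: "real \<Rightarrow> real \<Rightarrow> real" where "Px t x = c2 * cos x - c1 * sin x + fser (dX d) t x"
text \<open>The operator p + p'' annihilates frequency 1, so the terms with c1 and c2 drop
  out.\<close>

definition bet :: "real \<Rightarrow> real \<Rightarrow> real" where "bet t x = p0 t + fser (dT d) t x"
text \<open>The tangential velocity beta_x / (1 + beta^2) of the flow when ell = 1;
  \<open>drift\<close> is the velocity of the normal angle in the equation for nu.\<close>

definition slide :: "real \<Rightarrow> real \<Rightarrow> real" where
  "slide t x = fser (dX (dT d)) t x * inverse (1 + bet t x * bet t x)"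
definition drift :: "real \<Rightarrow> real \<Rightarrow> real" where "drift t x = - (bet t x * slide t x)"
text \<open>Cartesian coordinates of P nu + P_x mu, because the decay classes are made for scalar
  functions.\<close>

definition X1 :: "real \<Rightarrow> real \<Rightarrow> real" where "X1 t x = P t x * cos x - Px t x * sin x"
definition X2 :: "real \<Rightarrow> real \<Rightarrow> real" where "X2 t x = P t x * sin x + Px t x * cos x"
definition Gc :: "real \<Rightarrow> curve" where "Gc t x = vector [X1 t x, X2 t x]"

lemma p_smooth: "smooth p"
  using Sdecay_smooth[OF p_Sdecay, of 0] by simp

lemma rapid_d: "rapid d"
  unfolding d_def by (rule rapid_fourier_coeffs[OF p_smooth p_periodic])

lemmas rapid_all = rapid_d rapid_dX[OF rapid_d] rapid_dT[OF rapid_d] rapid_dX[OF rapid_dT[OF rapid_d]]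
  rapid_dX[OF rapid_dX[OF rapid_d]] rapid_dT[OF rapid_dT[OF rapid_d]]

lemmas Sdecay_all = rapid_all[THEN Sdecay_fser]

lemma fser_cont: "t \<ge> 0 \<Longrightarrow> rapid d' \<Longrightarrow> continuous_on S (fser d' t)"
  by (rule decaying_slice_continuous[OF decaying_fser])

lemma p_series: "p x = m + (c1 * cos x + c2 * sin x) + fser d 0 x"
  unfolding m_def c1_def c2_def
  by (rule fourier_eq_fser[OF smooth_continuous[OF p_smooth] p_periodic rapid_d])
    (auto simp: d_def fourier_coeffs_def)

lemma p_curvature: "p x + vd (vd p) x = m + fser (dT d) 0 x"
proof -
  note D = has_real_derivative_fser(1)[OF rapid_all(1) order_refl] has_real_derivative_fser(1)[OF rapid_all(2) order_refl]
  have "vd p = (\<lambda>x. - (c1 * sin x) + c2 * cos x + fser (dX d) 0 x)"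
    by (subst p_series[abs_def], rule vd_eqI_real) (auto intro!: derivative_eq_intros D)
  moreover have "vd (\<lambda>x. - (c1 * sin x) + c2 * cos x + fser (dX d) 0 x) =
      (\<lambda>x. - (c1 * cos x) - c2 * sin x + fser (dX (dX d)) 0 x)"
    by (rule vd_eqI_real) (auto intro!: derivative_eq_intros D)
  ultimately show ?thesis
    by (simp add: p_series[of x] fser_dT[OF rapid_d])
qed

text \<open>The frequencies 0, 1 and k \<ge> 2 are orthogonal, and beta has no frequency 1. The mean
  \<mu> is left free: it is m for the initial curve and p0 t later.\<close>

lemma area_formula:
  assumes t: "t \<ge> 0"
  shows "integral {0..2 * pi} (\<lambda>x. (\<mu> + (c1 * cos x + c2 * sin x) + fser d t x) * (\<mu> + fser (dT d) t x)) =
    2 * pi * \<mu>\<^sup>2 - I t"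
proof -
  note z = fser_mean_zero[OF rapid_all(1) t] fser_mean_zero[OF rapid_all(3) t]
  have c: "(cos has_integral 0) {0..2 * pi}" using has_integral_cos_period[of 1] by simp
  have s: "(sin has_integral 0) {0..2 * pi}" using has_integral_sin_period[of 1] by simp
  have k: "((\<lambda>x. \<mu> * \<mu>) has_integral (2 * pi * \<mu>\<^sup>2)) {0..2 * pi}"
    using has_integral_const_real[of "\<mu> * \<mu>" 0 "2 * pi"] by (simp add: power2_eq_square)
  have "(\<lambda>x. fser d t x * fser (dT d) t x) integrable_on {0..2 * pi}"
    by (intro integrable_continuous_real continuous_intros fser_cont t rapid_all)
  then have i: "((\<lambda>x. fser d t x * fser (dT d) t x) has_integral - I t) {0..2 * pi}"
    by (simp add: I_def has_integral_integral)
  have "((\<lambda>x. \<mu> * \<mu> + (\<mu> * (c1 * cos x + c2 * sin x + fser d t x + fser (dT d) t x) +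
      (c1 * (fser (dT d) t x * cos x) + c2 * (fser (dT d) t x * sin x))) + fser d t x * fser (dT d) t x)
    has_integral 2 * pi * \<mu>\<^sup>2 + (\<mu> * (c1 * 0 + c2 * 0 + 0 + 0) + (c1 * 0 + c2 * 0)) + - I t) {0..2 * pi}"
    by (intro has_integral_add has_integral_mult_right z c s k i)
  then have "((\<lambda>x. (\<mu> + (c1 * cos x + c2 * sin x) + fser d t x) * (\<mu> + fser (dT d) t x))
      has_integral 2 * pi * \<mu>\<^sup>2 - I t) {0..2 * pi}"
    by (rule has_integral_eq_rhs[OF has_integral_eq[rotated]]) (auto simp: algebra_simps)
  then show ?thesis by (rule integral_unique)
qed

lemma A2_eq: "A2 = 2 * pi * m\<^sup>2 - I 0"
  unfolding A2_def p_curvature using area_formula[of 0 m] by (simp add: p_series)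

lemma Sdecay_I: "Sdecay 3 (\<lambda>t x. I t)"
  unfolding I_def
  by (intro Sdecay_minus Sdecay_space_integral Sdecay_mult[OF Sdecay_all(1) Sdecay_all(3)]) auto

lemma Sdecay_W: "Sdecay 3 (\<lambda>t x. W t)"
  unfolding W_def
  by (intro Sdecay_space_integral Sdecay_mult[OF Sdecay_all(3) Sdecay_all(3)]) auto

lemma W_nonneg: "t \<ge> 0 \<Longrightarrow> W t \<ge> 0"
  unfolding W_def by (intro integral_nonneg integrable_continuous_real continuous_intros fser_cont rapid_all) auto

text \<open>By the symmetry of \<open>dT\<close> the two terms of the product rule have the same
  integral W.\<close>

lemma I_deriv:
  assumes t: "t \<ge> 0"
  shows "(I has_real_derivative - 2 * W t) (at t within {0..})"
proof -
  have "((\<lambda>t. integral {0..2 * pi} (\<lambda>x. fser d t x * fser (dT d) t x)) has_real_derivative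
      integral {0..2 * pi} (\<lambda>x. fser (dT d) t x * fser (dT d) t x + fser d t x * fser (dT (dT d)) t x)) (at t within {0..})"
  proof (rule has_real_derivative_space_integral[OF _ _ _ t])
    show "((\<lambda>s. fser d s x * fser (dT d) s x) has_real_derivative
        fser (dT d) t x * fser (dT d) t x + fser d t x * fser (dT (dT d)) t x) (at t within {0..})" if "t \<ge> 0" for t x
      by (auto intro!: derivative_eq_intros has_real_derivative_fser rapid_all that)
    show "continuous_on UNIV (\<lambda>x. fser d t x * fser (dT d) t x)" if "t \<ge> 0" for t
      by (intro continuous_intros fser_cont that rapid_all)
    show "continuous_on ({0..} \<times> UNIV) (\<lambda>(t, x). fser (dT d) t x * fser (dT d) t x + fser d t x * fser (dT (dT d)) t x)"
      by (intro Sdecay_imp_continuous[where w=3] Sdecay_add Sdecay_mult[OF Sdecay_all(3) Sdecay_all(3)]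
          Sdecay_mult[OF Sdecay_all(1) Sdecay_all(6)]) auto
  qed
  also have "integral {0..2 * pi} (\<lambda>x. fser (dT d) t x * fser (dT d) t x + fser d t x * fser (dT (dT d)) t x) = W t + W t"
    unfolding W_def
    by (subst integral_add) (auto simp: integral_fser_dT_symmetric[OF rapid_all(1,3) t]
        intro!: integrable_continuous_real continuous_intros fser_cont t rapid_all)
  finally show ?thesis
    unfolding I_def[abs_def] by (auto intro!: derivative_eq_intros)
qed

text \<open>I decreases because W \<ge> 0, and it tends to 0 by its decay; this replaces the
  evaluation of a Parseval sum.\<close>

lemma I_nonneg:
  assumes t: "t \<ge> 0"
  shows "I t \<ge> 0"
proof -
  obtain C where C: "\<And>t x :: real. t \<ge> 0 \<Longrightarrow> \<bar>I t\<bar> \<le> C * exp (- 3 * t)"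
    using Sdecay_I by (rule Sdecay_imp_bounded) (rule that)
  have "filterlim (\<lambda>t. - 3 * t :: real) at_bot at_top"
    by (rule filterlim_tendsto_neg_mult_at_bot[OF tendsto_const]) (auto simp: filterlim_ident)
  from tendsto_mult_left[OF filterlim_compose[OF exp_at_bot this], of "- C"]
  have lim: "((\<lambda>s. - C * exp (- 3 * s)) \<longlongrightarrow> 0) at_top" by simp
  show ?thesis
  proof (rule tendsto_upperbound[OF lim])
    show "\<forall>\<^sub>F s in at_top. - C * exp (- 3 * s) \<le> I t"
      using eventually_ge_at_top[of t]
    proof eventually_elim
      case (elim s)
      have "I s \<le> I t"
        by (rule antimono_halfline[OF I_deriv]) (use elim t W_nonneg in auto)
      moreover have "- C * exp (- 3 * s) \<le> I s" using C[of s] elim t by (simp add: abs_le_iff)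
      ultimately show ?case by simp
    qed
  qed simp
qed

lemma A2_pos: "A2 > 0"
  using area_pos by (simp add: A2_def)

lemma p0_radicand: "t \<ge> 0 \<Longrightarrow> A2 / (2 * pi) \<le> (A2 + I t) / (2 * pi)"
  using I_nonneg[of t] by (simp add: divide_right_mono)

text \<open>Here the positivity of the area enters: 2 pi m^2 is the doubled area plus I 0.\<close>

lemma m_nonzero: "m \<noteq> 0"
  using A2_eq A2_pos I_nonneg[of 0] by auto

lemma sgn_m_square: "sgn m * sgn m = 1"
  using m_nonzero by (simp add: sgn_if)

lemma p0_square: "t \<ge> 0 \<Longrightarrow> (p0 t)\<^sup>2 = (A2 + I t) / (2 * pi)"
  using A2_pos I_nonneg[of t] by (simp add: p0_def power_mult_distrib power2_eq_square[of "sgn m"] m_nonzero)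

lemma p0_nonzero: "t \<ge> 0 \<Longrightarrow> p0 t \<noteq> 0"
  using p0_square[of t] A2_pos I_nonneg[of t] by auto

lemma p0_abs:
  assumes "t \<ge> 0"
  shows "\<bar>p0 t\<bar> = sqrt ((A2 + I t) / (2 * pi))" "sqrt (A2 / (2 * pi)) \<le> \<bar>p0 t\<bar>"
  using real_sqrt_le_mono[OF p0_radicand[OF assms]] m_nonzero A2_pos I_nonneg[OF assms]
  by (auto simp: p0_def abs_mult sgn_if)

lemma p0_0: "p0 0 = m"
proof -
  have "(A2 + I 0) / (2 * pi) = m\<^sup>2" by (simp add: A2_eq)
  then show ?thesis by (simp add: p0_def sgn_mult_abs)
qed

lemma p0_rate: "t \<ge> 0 \<Longrightarrow> p0 t - lamt t = - W t * inverse (2 * pi * p0 t)"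
  using p0_nonzero[of t] by (simp add: lamt_def field_simps power2_eq_square)

text \<open>Differentiating 2 pi p0^2 = A2 + I gives 4 pi p0 p0' = - 2 W. By the formula for lambda
  this says p0' = p0 - lambda, so the mean defined by conservation of area obeys the flow.\<close>

lemma p0_deriv:
  assumes t: "t \<ge> 0"
  shows "(p0 has_real_derivative - W t * inverse (2 * pi * p0 t)) (at t within {0..})"
    "(p0 has_real_derivative p0 t - lamt t) (at t within {0..})"
proof -
  define q where "q t = (A2 + I t) / (2 * pi)" for t
  have q: "q t > 0" using A2_pos I_nonneg[OF t] by (simp add: q_def)
  have qd: "(q has_real_derivative - 2 * W t / (2 * pi)) (at t within {0..})"
    unfolding q_def[abs_def] by (auto intro!: derivative_eq_intros I_deriv t)
  have D: "((\<lambda>t. sgn m * sqrt (q t)) has_real_derivative sgn m * (inverse (sqrt (q t)) / 2 * (- 2 * W t / (2 * pi)))) (at t within {0..})"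
    by (intro DERIV_cmult DERIV_chain2[OF DERIV_real_sqrt[OF q] qd])
  have inv: "inverse (p0 t) = sgn m * inverse (sqrt (q t))"
    using sgn_m_square m_nonzero by (auto simp: p0_def q_def sgn_if)
  have v: "sgn m * (inverse (sqrt (q t)) / 2 * (- 2 * W t / (2 * pi))) = - W t * inverse (2 * pi * p0 t)"
  proof -
    have "s * (i / 2 * (- 2 * W t / (2 * pi))) = - W t * (inverse 2 * inverse pi * (s * i))" for s i :: real
      by (simp add: inverse_eq_divide)
    then show ?thesis unfolding inverse_mult_distrib inv .
  qed
  have pe: "p0 = (\<lambda>t. sgn m * sqrt (q t))" by (simp add: p0_def[abs_def] q_def)
  show 1: "(p0 has_real_derivative - W t * inverse (2 * pi * p0 t)) (at t within {0..})"
    using D unfolding v pe[symmetric] .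
  then show "(p0 has_real_derivative p0 t - lamt t) (at t within {0..})" by (simp only: p0_rate[OF t])
qed

lemma Sdecay_p0: "Sdecay 0 (\<lambda>t x. p0 t)"
proof -
  obtain C where C: "\<And>t x :: real. t \<ge> 0 \<Longrightarrow> \<bar>I t\<bar> \<le> C * exp (- 0 * t)"
    using Sdecay_mono[OF Sdecay_I, of 0] by (rule_tac Sdecay_imp_bounded) (simp, rule that)
  have "\<bar>p0 t\<bar> \<le> sqrt ((A2 + C) / (2 * pi)) * exp (- 0 * t)" if "t \<ge> 0" for t
    using C[OF that] p0_abs(1)[OF that] by (simp add: divide_right_mono abs_le_iff)
  moreover have "continuous_on {0..} p0"
    using p0_deriv(1) by (intro DERIV_continuous_on) auto
  then have "continuous_on ({0..} \<times> (UNIV :: real set)) (\<lambda>z. p0 (fst z))"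
    by (rule continuous_on_compose2[OF _ continuous_on_fst[OF continuous_on_id]]) auto
  ultimately have dec: "decaying 0 (\<lambda>t x. p0 t)"
    unfolding decaying_def case_prod_unfold by blast
  show ?thesis
  proof (rule SdecayI[OF _ dec])
    \<comment> \<open>The derivative of p0 is a product of W and 1 / p0, so each order of p0 yields
      the next one.\<close>
    fix n assume n: "Cdecay n 0 (\<lambda>t x. p0 t)"
    have "Cdecay n 0 (\<lambda>t x. inverse (2 * pi * p0 t))"
      by (rule Cdecay_inverse[of "2 * pi * sqrt (A2 / (2 * pi))"])
        (use A2_pos p0_abs(2) in \<open>auto simp: abs_mult intro: Cdecay_cmult n\<close>)
    moreover have "Cdecay n 0 (\<lambda>t x. W t)"
      using Sdecay_mono[OF Sdecay_W, of 0] by (simp add: Sdecay_def)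
    ultimately have "Cdecay n 0 (\<lambda>t x. - W t * inverse (2 * pi * p0 t))"
      by (intro Cdecay_mult[where w=0 and w'=0] Cdecay_minus) auto
    then show "Cdecay (Suc n) 0 (\<lambda>t x. p0 t)"
      by (rule CdecayI[OF dec Cdecay_zero]) (use p0_deriv(1) in auto)
  qed
qed

lemma Sdecay_p0_rate: "Sdecay 3 (\<lambda>t x. p0 t - lamt t)"
proof -
  have "Sdecay 0 (\<lambda>t x. inverse (2 * pi * p0 t))"
    by (rule Sdecay_inverse[OF Sdecay_cmult[OF Sdecay_p0], of "2 * pi * sqrt (A2 / (2 * pi))"])
      (use A2_pos p0_abs(2) in \<open>auto simp: abs_mult\<close>)
  then have "Sdecay 3 (\<lambda>t x. - W t * inverse (2 * pi * p0 t))"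
    by (intro Sdecay_mult[OF Sdecay_minus[OF Sdecay_W]]) auto
  then show ?thesis by (rule Sdecay_cong) (rule p0_rate)
qed

end

lemma smooth_affine_add:
  assumes "smooth g"
  shows "smooth (\<lambda>x. a * x + b + g x :: real)"
proof (rule smoothI[where X="\<lambda>f. \<exists>a b g. smooth g \<and> f = (\<lambda>x. a * x + b + g x)"])
  fix f :: "real \<Rightarrow> real" assume "\<exists>a b g. smooth g \<and> f = (\<lambda>x. a * x + b + g x)"
  then obtain a b g where g: "smooth g" "f = (\<lambda>x. a * x + b + g x)" by blast
  have "(g has_real_derivative vd g x) (at x)" for x
    using smoothD[OF g(1)] by (simp add: has_real_derivative_iff_has_vector_derivative)
  then have "(f has_real_derivative 0 * x + a + vd g x) (at x)" for x
    unfolding g(2) by (auto intro!: derivative_eq_intros)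
  then show "\<exists>f'. (\<exists>a b g. smooth g \<and> f' = (\<lambda>x. a * x + b + g x)) \<and> (\<forall>x. (f has_vector_derivative f' x) (at x))"
    using smooth_vd[OF g(1)] unfolding has_real_derivative_iff_has_vector_derivative
    by (intro exI[of _ "\<lambda>x. 0 * x + a + vd g x"]) blast
qed (use assms in blast)

text \<open>The bound is uniform in space, so an arbitrary path y may be followed.\<close>

lemma Sdecay_tendsto_zero:
  assumes "Sdecay w f" "w > 0"
  shows "((\<lambda>t. f t (y t)) \<longlongrightarrow> 0) at_top"
proof -
  obtain C where C: "\<And>t x. t \<ge> 0 \<Longrightarrow> \<bar>f t x\<bar> \<le> C * exp (- w * t)"
    using assms(1) by (rule Sdecay_imp_bounded) (rule that)
  have "filterlim (\<lambda>t. - w * t :: real) at_bot at_top"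
    by (rule filterlim_tendsto_neg_mult_at_bot[OF tendsto_const]) (use assms(2) in \<open>auto simp: filterlim_ident\<close>)
  from tendsto_mult_left[OF filterlim_compose[OF exp_at_bot this], of C]
  have lim: "((\<lambda>s. C * exp (- w * s)) \<longlongrightarrow> 0) at_top" by simp
  show ?thesis
  proof (rule Lim_null_comparison[OF _ lim])
    show "\<forall>\<^sub>F t in at_top. norm (f t (y t)) \<le> C * exp (- w * t)"
      using eventually_ge_at_top[of 0] by eventually_elim (unfold real_norm_def, rule C)
  qed
qed

section \<open>The family of curves parametrized by the normal angle\<close>

context support_flow
begin

lemma Sdecay_P: "Sdecay 0 P"
  unfolding P_def[abs_def]
  by (intro Sdecay_add Sdecay_p0 Sdecay_cmult Sdecay_cos Sdecay_sin Sdecay_mono[OF Sdecay_all(1)]) auto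

lemma Sdecay_Px: "Sdecay 0 Px"
  unfolding Px_def[abs_def]
  by (intro Sdecay_add Sdecay_diff Sdecay_cmult Sdecay_cos Sdecay_sin Sdecay_mono[OF Sdecay_all(2)]) auto

lemma Sdecay_bet: "Sdecay 0 bet"
  unfolding bet_def[abs_def]
  by (intro Sdecay_add Sdecay_p0 Sdecay_mono[OF Sdecay_all(3)]) auto

lemma Sdecay_X1: "Sdecay 0 X1"
  unfolding X1_def[abs_def]
  by (intro Sdecay_diff Sdecay_mult[OF Sdecay_P Sdecay_cos] Sdecay_mult[OF Sdecay_Px Sdecay_sin]) simp_all

lemma Sdecay_X2: "Sdecay 0 X2"
  unfolding X2_def[abs_def]
  by (intro Sdecay_add Sdecay_mult[OF Sdecay_P Sdecay_sin] Sdecay_mult[OF Sdecay_Px Sdecay_cos]) simp_all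

lemma Sdecay_slide: "Sdecay 3 slide"
proof -
  have "Sdecay 0 (\<lambda>t x. 1 + bet t x * bet t x)"
    by (intro Sdecay_add Sdecay_const Sdecay_mult[OF Sdecay_bet Sdecay_bet]) simp
  then have "Sdecay 0 (\<lambda>t x. inverse (1 + bet t x * bet t x))"
    by (rule Sdecay_inverse[where c=1]) auto
  then show ?thesis
    unfolding slide_def[abs_def] by (intro Sdecay_mult[OF Sdecay_all(4)]) auto
qed

lemma Sdecay_drift: "Sdecay 3 drift"
  unfolding drift_def[abs_def] by (intro Sdecay_minus Sdecay_mult[OF Sdecay_bet Sdecay_slide]) simp

lemma Sdecay_speed: "Sdecay 3 (\<lambda>t x. bet t x - lamt t)"
  by (rule Sdecay_cong[OF Sdecay_add[OF Sdecay_p0_rate Sdecay_all(3)]]) (simp add: bet_def)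

lemma space_derivs:
  assumes t: "t \<ge> 0"
  shows "(P t has_real_derivative Px t x) (at x)"
    "(Px t has_real_derivative bet t x - P t x) (at x)"
    "(bet t has_real_derivative fser (dX (dT d)) t x) (at x)"
    "(X1 t has_real_derivative - (bet t x * sin x)) (at x)"
    "(X2 t has_real_derivative bet t x * cos x) (at x)"
proof -
  note D = rapid_all(1-3)[THEN has_real_derivative_fser(1), OF t]
  show 1: "(P t has_real_derivative Px t x) (at x)"
    unfolding P_def[abs_def] Px_def by (auto intro!: derivative_eq_intros D)
  have "(Px t has_real_derivative - c2 * sin x - c1 * cos x + fser (dX (dX d)) t x) (at x)"
    unfolding Px_def[abs_def] by (auto intro!: derivative_eq_intros D)
  moreover have "- c2 * sin x - c1 * cos x + fser (dX (dX d)) t x = bet t x - P t x"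
    by (simp add: bet_def P_def fser_dT[OF rapid_d t])
  ultimately show 2: "(Px t has_real_derivative bet t x - P t x) (at x)" by simp
  show "(bet t has_real_derivative fser (dX (dT d)) t x) (at x)"
    unfolding bet_def[abs_def] by (auto intro!: derivative_eq_intros D)
  show "(X1 t has_real_derivative - (bet t x * sin x)) (at x)"
    unfolding X1_def[abs_def] by (auto intro!: derivative_eq_intros 1 2 simp: algebra_simps)
  show "(X2 t has_real_derivative bet t x * cos x) (at x)"
    unfolding X2_def[abs_def] by (auto intro!: derivative_eq_intros 1 2 simp: algebra_simps)
qed

text \<open>At a fixed normal angle the frame does not move, so P nu + P_x mu has normal velocity
  P_t = beta - lambda and tangential velocity P_xt = beta_x.\<close>

lemma time_derivs:
  assumes t: "t \<ge> 0"
  shows "((\<lambda>t. X1 t x) has_real_derivative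
      (bet t x - lamt t) * cos x - fser (dX (dT d)) t x * sin x) (at t within {0..})"
    "((\<lambda>t. X2 t x) has_real_derivative
      (bet t x - lamt t) * sin x + fser (dX (dT d)) t x * cos x) (at t within {0..})"
proof -
  have "((\<lambda>t. P t x) has_real_derivative (p0 t - lamt t) + fser (dT d) t x) (at t within {0..})"
    unfolding P_def[abs_def] by (auto intro!: derivative_eq_intros p0_deriv(2) has_real_derivative_fser rapid_d t)
  then have 1: "((\<lambda>t. P t x) has_real_derivative bet t x - lamt t) (at t within {0..})"
    by (simp add: bet_def algebra_simps)
  have 2: "((\<lambda>t. Px t x) has_real_derivative fser (dX (dT d)) t x) (at t within {0..})"
    unfolding Px_def[abs_def]
    using has_real_derivative_fser(2)[OF rapid_all(2) t, of x] by (auto intro!: derivative_eq_intros simp: dT_dX)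
  show "((\<lambda>t. X1 t x) has_real_derivative
      (bet t x - lamt t) * cos x - fser (dX (dT d)) t x * sin x) (at t within {0..})"
    unfolding X1_def[abs_def] by (auto intro!: derivative_eq_intros 1 2 simp: algebra_simps)
  show "((\<lambda>t. X2 t x) has_real_derivative
      (bet t x - lamt t) * sin x + fser (dX (dT d)) t x * cos x) (at t within {0..})"
    unfolding X2_def[abs_def] by (auto intro!: derivative_eq_intros 1 2 simp: algebra_simps)
qed

lemma Gc_frame: "Gc t x = P t x *\<^sub>R unit_vec x + Px t x *\<^sub>R rot (unit_vec x)"
  by (simp add: Gc_def X1_def X2_def vec_eq_iff forall_2)

lemma Gc_deriv:
  assumes "t \<ge> 0"
  shows "(Gc t has_vector_derivative bet t x *\<^sub>R rot (unit_vec x)) (at x)"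
proof -
  have "(Gc t has_vector_derivative vector [- (bet t x * sin x), bet t x * cos x]) (at x)"
    unfolding Gc_def[abs_def]
    using space_derivs(4,5)[OF assms, of x] by (intro has_vector_derivative_vector_2)
      (simp_all add: has_real_derivative_iff_has_vector_derivative)
  moreover have "bet t x *\<^sub>R rot (unit_vec x) = vector [- (bet t x * sin x), bet t x * cos x]"
    by (simp add: vec_eq_iff forall_2)
  ultimately show ?thesis by simp
qed

lemma unit_vec_deriv: "(unit_vec has_vector_derivative rot (unit_vec x)) (at x)"
  using has_vector_derivative_unit_vec[of "\<lambda>x. x" 1 x UNIV] by simp

lemma ell_unit_vec: "ell unit_vec x = 1"
  unfolding ell_def vd_eqI[OF unit_vec_deriv] by simp

lemma beta_Gc: "t \<ge> 0 \<Longrightarrow> beta (Gc t) unit_vec = bet t"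
  unfolding beta_def[abs_def] by (simp add: vd_eqI[OF Gc_deriv])

lemma legendre_Gc:
  assumes t: "t \<ge> 0"
  shows "legendre_curve (Gc t) unit_vec"
proof -
  have "smooth (Gc t)" unfolding Gc_def[abs_def]
    by (intro smooth_vector Sdecay_smooth[OF Sdecay_X1 t] Sdecay_smooth[OF Sdecay_X2 t])
  moreover have "smooth unit_vec"
    unfolding unit_vec_def[abs_def]
    using Sdecay_smooth[OF Sdecay_cos, of 0] Sdecay_smooth[OF Sdecay_sin, of 0] by (intro smooth_vector) auto
  moreover have "Gc t (x + 2 * pi) = Gc t x" for x
    by (simp add: Gc_def X1_def X2_def P_def Px_def fser_periodic)
  ultimately show ?thesis
    unfolding legendre_curve_def vd_eqI[OF Gc_deriv[OF t]] by (simp add: unit_vec_periodic)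
qed

lemma lam_Gc:
  assumes t: "t \<ge> 0"
  shows "lam (Gc t) unit_vec = lamt t"
proof -
  note z = fser_mean_zero(1)[OF rapid_all(3) t]
  have k: "((\<lambda>x. c) has_integral (2 * pi * c)) {0..2 * pi}" for c :: real
    using has_integral_const_real[of c 0 "2 * pi"] by simp
  have "(bet t has_integral 2 * pi * p0 t + 0) {0..2 * pi}"
    unfolding bet_def[abs_def] by (intro has_integral_add k z)
  then have L: "alg_length (Gc t) unit_vec = 2 * pi * p0 t"
    by (simp add: alg_length_def beta_Gc[OF t] integral_unique)
  have w: "((\<lambda>x. fser (dT d) t x * fser (dT d) t x) has_integral W t) {0..2 * pi}"
    unfolding W_def
    by (intro integrable_integral integrable_continuous_real continuous_intros fser_cont t rapid_all)
  have "((\<lambda>x. (p0 t)\<^sup>2 + 2 * p0 t * fser (dT d) t x + fser (dT d) t x * fser (dT d) t x)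
      has_integral 2 * pi * (p0 t)\<^sup>2 + 2 * p0 t * 0 + W t) {0..2 * pi}"
    by (intro has_integral_add has_integral_mult_right k z w)
  moreover have "(\<lambda>x. (p0 t)\<^sup>2 + 2 * p0 t * fser (dT d) t x + fser (dT d) t x * fser (dT d) t x) = (\<lambda>x. (bet t x)\<^sup>2)"
    by (simp add: bet_def power2_eq_square algebra_simps)
  ultimately have "integral {0..2 * pi} (\<lambda>x. (bet t x)\<^sup>2) = 2 * pi * (p0 t)\<^sup>2 + W t"
    by (simp add: integral_unique)
  then show ?thesis
    by (simp add: lam_def L beta_Gc[OF t] lamt_def)
qed

lemma slide_eq: "fser (dX (dT d)) t x = slide t x * (1 + bet t x * bet t x)"
proof -
  have "1 + bet t x * bet t x \<noteq> 0" using zero_le_square[of "bet t x"] by linarith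
  then show ?thesis by (simp add: slide_def)
qed

lemma flow_rhs:
  assumes t: "t \<ge> 0"
  shows "flow_gamma (Gc t) unit_vec x = slide t x *\<^sub>R rot (unit_vec x) + (bet t x - lamt t) *\<^sub>R unit_vec x"
    "flow_nu (Gc t) unit_vec x = drift t x *\<^sub>R rot (unit_vec x)"
proof -
  have s: "speed (Gc t) unit_vec = (\<lambda>x. bet t x - lamt t)"
    by (simp add: speed_def[abs_def] beta_Gc[OF t] lam_Gc[OF t])
  have v: "vd (\<lambda>x. bet t x - lamt t) = fser (dX (dT d)) t"
    by (rule vd_eqI_real) (auto intro!: derivative_eq_intros space_derivs t)
  show "flow_gamma (Gc t) unit_vec x = slide t x *\<^sub>R rot (unit_vec x) + (bet t x - lamt t) *\<^sub>R unit_vec x"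
    "flow_nu (Gc t) unit_vec x = drift t x *\<^sub>R rot (unit_vec x)"
    unfolding flow_gamma_def flow_nu_def s v
    by (simp_all add: ell_unit_vec beta_Gc[OF t] slide_def drift_def divide_inverse power2_eq_square)
qed

text \<open>x + u t x is the normal angle at time t of the point with parameter x. The lower bound c
  does not depend on time, so that the limit of these maps is still a diffeomorphism.\<close>

definition displacement_of :: "real \<Rightarrow> (real \<Rightarrow> real \<Rightarrow> real) \<Rightarrow> bool" where
  "displacement_of a u \<longleftrightarrow> Sdecay 0 u \<and> (\<forall>x. u 0 x = a) \<and> (\<exists>c>0. \<forall>t\<ge>0. \<forall>x. c \<le> 1 + vd (u t) x) \<and>
     (\<forall>t\<ge>0. \<forall>x. ((\<lambda>t. u t x) has_real_derivative drift t (x + u t x)) (at t within {0..}))"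

lemma displacement_exists: "\<exists>u. displacement_of a u"
proof -
  obtain u c where "Sdecay 0 u" "\<And>x. u 0 x = a" "c > 0" "\<And>t x. t \<ge> 0 \<Longrightarrow> c \<le> 1 + vd (u t) x"
    "\<And>t x. t \<ge> 0 \<Longrightarrow> ((\<lambda>t. u t x) has_real_derivative drift t (x + u t x)) (at t within {0..})"
    using Sdecay_drift by (rule displacement[where a=a]) (simp, rule that)
  then show ?thesis unfolding displacement_of_def by blast
qed

section \<open>The evolving curve in its moving parametrization\<close>

definition moved_curve :: "(real \<Rightarrow> real \<Rightarrow> real) \<Rightarrow> real \<Rightarrow> curve" where
  "moved_curve u t x = Gc t (x + u t x)"

definition moved_normal :: "(real \<Rightarrow> real \<Rightarrow> real) \<Rightarrow> real \<Rightarrow> curve" where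
  "moved_normal u t x = unit_vec (x + u t x)"

lemma displacement_ofD:
  assumes "displacement_of a u"
  shows "Sdecay 0 u" "u 0 x = a" "t \<ge> 0 \<Longrightarrow> 0 < 1 + vd (u t) x"
    "t \<ge> 0 \<Longrightarrow> ((\<lambda>t. u t x) has_real_derivative drift t (x + u t x)) (at t within {0..})"
    "t \<ge> 0 \<Longrightarrow> ((\<lambda>x. x + u t x) has_real_derivative 1 + vd (u t) x) (at x)"
proof -
  show u: "Sdecay 0 u" "u 0 x = a"
    "t \<ge> 0 \<Longrightarrow> ((\<lambda>t. u t x) has_real_derivative drift t (x + u t x)) (at t within {0..})"
    using assms unfolding displacement_of_def by blast+
  show "t \<ge> 0 \<Longrightarrow> 0 < 1 + vd (u t) x"
    using assms unfolding displacement_of_def by (meson less_le_trans)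
  show "t \<ge> 0 \<Longrightarrow> ((\<lambda>x. x + u t x) has_real_derivative 1 + vd (u t) x) (at x)"
    by (auto intro!: derivative_eq_intros Sdecay_vd(2)[OF u(1)])
qed

lemma drift_periodic: "drift t (x + 2 * pi) = drift t x"
  by (simp add: drift_def slide_def bet_def fser_periodic)

text \<open>The drift is periodic, so the trajectory started at x + 2 pi, moved back by 2 pi, solves
  the same equation with the same initial value.\<close>

lemma displacement_periodic:
  assumes u: "displacement_of a u" and t: "t \<ge> 0"
  shows "u t (x + 2 * pi) = u t x"
proof -
  have "x + u t x = (x + 2 * pi + u t (x + 2 * pi)) - 2 * pi"
  proof (rule ode_unique[OF Sdecay_drift _ _ _ t, where a="\<lambda>t. x + u t x"])
    fix t :: real assume "t \<ge> 0"
    note D = displacement_ofD(4)[OF u \<open>t \<ge> 0\<close>]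
    show "((\<lambda>t. x + u t x) has_real_derivative drift t (x + u t x)) (at t within {0..})"
      by (auto intro!: derivative_eq_intros D)
    have "drift t (x + 2 * pi + u t (x + 2 * pi) - 2 * pi) = drift t (x + 2 * pi + u t (x + 2 * pi))"
      using drift_periodic[of t "x + 2 * pi + u t (x + 2 * pi) - 2 * pi"] by (simp add: add_ac)
    then show "((\<lambda>t. x + 2 * pi + u t (x + 2 * pi) - 2 * pi) has_real_derivative
        drift t (x + 2 * pi + u t (x + 2 * pi) - 2 * pi)) (at t within {0..})"
      using D[of "x + 2 * pi"] by (auto intro!: derivative_eq_intros)
  qed (simp add: displacement_ofD(2)[OF u])
  then show ?thesis by simp
qed

lemma moved_curve_eq: "moved_curve u t = (\<lambda>x. vector [X1 t (x + u t x), X2 t (x + u t x)])"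
  by (simp add: moved_curve_def Gc_def fun_eq_iff)

lemma moved_normal_eq: "moved_normal u t = (\<lambda>x. vector [cos (x + u t x), sin (x + u t x)])"
  by (simp add: moved_normal_def unit_vec_def fun_eq_iff)

lemma Sdecay_moved:
  assumes "displacement_of a u"
  shows "Sdecay 0 (\<lambda>t x. X1 t (x + u t x))" "Sdecay 0 (\<lambda>t x. X2 t (x + u t x))"
    "Sdecay 0 (\<lambda>t x. cos (x + u t x))" "Sdecay 0 (\<lambda>t x. sin (x + u t x))"
  using displacement_ofD(1)[OF assms]
  by (auto intro: Sdecay_compose_shift[where P=X1] Sdecay_compose_shift[where P=X2]
      Sdecay_compose_shift[where P="\<lambda>t. cos"] Sdecay_compose_shift[where P="\<lambda>t. sin"]
      Sdecay_X1 Sdecay_X2 Sdecay_cos Sdecay_sin)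

text \<open>Following the moving normal angle adds beta times drift = - beta^2 slide to the
  tangential velocity beta_x = (1 + beta^2) slide, which leaves exactly slide.\<close>

lemma moved_component_derivs:
  fixes x :: real
  assumes u: "displacement_of a u" and t: "t \<ge> 0"
  defines "y \<equiv> x + u t x"
  shows "((\<lambda>t. X1 t (x + u t x)) has_real_derivative
      (bet t y - lamt t) * cos y - slide t y * sin y) (at t within {0..})"
    "((\<lambda>t. X2 t (x + u t x)) has_real_derivative
      (bet t y - lamt t) * sin y + slide t y * cos y) (at t within {0..})"
proof -
  have ud: "((\<lambda>t. x + u t x) has_real_derivative drift t (x + u t x)) (at t within {0..})"
    by (auto intro!: derivative_eq_intros displacement_ofD(4)[OF u t])
  have cX: "continuous_on ({0..} \<times> UNIV) (\<lambda>(t, x). - (bet t x * sin x))"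
    "continuous_on ({0..} \<times> UNIV) (\<lambda>(t, x). bet t x * cos x)"
    by (intro Sdecay_imp_continuous[where w=0] Sdecay_minus Sdecay_mult[OF Sdecay_bet Sdecay_sin]
        Sdecay_mult[OF Sdecay_bet Sdecay_cos]; simp)+
  note D = has_real_derivative_compose_evolution[OF space_derivs(4) time_derivs(1) cX(1) ud t]
    has_real_derivative_compose_evolution[OF space_derivs(5) time_derivs(2) cX(2) ud t]
  show "((\<lambda>t. X1 t (x + u t x)) has_real_derivative
      (bet t y - lamt t) * cos y - slide t y * sin y) (at t within {0..})"
    "((\<lambda>t. X2 t (x + u t x)) has_real_derivative
      (bet t y - lamt t) * sin y + slide t y * cos y) (at t within {0..})"
    using D by (simp_all add: y_def drift_def slide_eq algebra_simps)
qed

lemma moved_derivs: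
  assumes u: "displacement_of a u" and t: "t \<ge> 0"
  shows "((\<lambda>t. moved_curve u t x) has_vector_derivative flow_gamma (Gc t) unit_vec (x + u t x)) (at t within {0..})"
    "((\<lambda>t. moved_normal u t x) has_vector_derivative flow_nu (Gc t) unit_vec (x + u t x)) (at t within {0..})"
proof -
  define y where "y = x + u t x"
  have "flow_gamma (Gc t) unit_vec y =
      vector [(bet t y - lamt t) * cos y - slide t y * sin y, (bet t y - lamt t) * sin y + slide t y * cos y]"
    unfolding flow_rhs[OF t] by (simp add: vec_eq_iff forall_2)
  then show "((\<lambda>t. moved_curve u t x) has_vector_derivative flow_gamma (Gc t) unit_vec (x + u t x)) (at t within {0..})"
    unfolding moved_curve_eq y_def
    using has_vector_derivative_vector_2[OF moved_component_derivs[OF u t, unfolded has_real_derivative_iff_has_vector_derivative]]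
    by simp
  show "((\<lambda>t. moved_normal u t x) has_vector_derivative flow_nu (Gc t) unit_vec (x + u t x)) (at t within {0..})"
    unfolding moved_normal_def flow_rhs[OF t]
    by (intro has_vector_derivative_unit_vec) (auto intro!: derivative_eq_intros displacement_ofD(4)[OF u t])
qed

text \<open>Both components of the velocity, beta - lambda and slide, decay at rate 3, and
  composition with the bounded displacement keeps the rate.\<close>

lemma settling_moved:
  assumes u: "displacement_of a u"
  shows "settling u" "settling (\<lambda>t x. X1 t (x + u t x))" "settling (\<lambda>t x. X2 t (x + u t x))"
proof -
  have c: "Sdecay 3 (\<lambda>t x. f t (x + u t x))" if "Sdecay 3 f" for f
    using Sdecay_compose_shift[OF that displacement_ofD(1)[OF u]] by simp
  show "settling u"
    by (rule settlingI[OF displacement_ofD(1)[OF u] c[OF Sdecay_drift] _ displacement_ofD(4)[OF u]]) auto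
  have "Sdecay 3 (\<lambda>t y. (bet t y - lamt t) * cos y - slide t y * sin y)"
    "Sdecay 3 (\<lambda>t y. (bet t y - lamt t) * sin y + slide t y * cos y)"
    by (intro Sdecay_diff Sdecay_add Sdecay_mult[OF Sdecay_speed Sdecay_cos] Sdecay_mult[OF Sdecay_speed Sdecay_sin]
        Sdecay_mult[OF Sdecay_slide Sdecay_cos] Sdecay_mult[OF Sdecay_slide Sdecay_sin]; simp)+
  from this[THEN c] show "settling (\<lambda>t x. X1 t (x + u t x))" "settling (\<lambda>t x. X2 t (x + u t x))"
    using settlingI[OF Sdecay_moved(1)[OF u] _ _ moved_component_derivs(1)[OF u]]
      settlingI[OF Sdecay_moved(2)[OF u] _ _ moved_component_derivs(2)[OF u]] by simp_all
qed

lemma moved_flow_solution: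
  assumes u: "displacement_of a u"
  shows "flow_solution (moved_curve u 0) (moved_normal u 0) (moved_curve u) (moved_normal u)"
proof -
  have "normalization (moved_curve u t) (moved_normal u t) (Gc t) unit_vec (\<lambda>x. x + u t x)" if t: "t \<ge> 0" for t
  proof -
    have "smooth (\<lambda>x. x + u t x)"
      using smooth_affine_add[OF Sdecay_smooth[OF displacement_ofD(1)[OF u] t], of 1 0] by simp
    then show ?thesis
      unfolding normalization_def
      by (simp add: legendre_Gc[OF t] ell_unit_vec displacement_periodic[OF u t] moved_curve_def moved_normal_def)
  qed
  moreover have "smooth_evolution (moved_curve u)"
    unfolding moved_curve_eq[abs_def]
    by (intro smooth_evolution_vector Sdecay_smooth_evolution[OF Sdecay_moved(1)[OF u]]
       Sdecay_smooth_evolution[OF Sdecay_moved(2)[OF u]])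
  moreover have "smooth_evolution (moved_normal u)"
    unfolding moved_normal_eq[abs_def]
    by (intro smooth_evolution_vector Sdecay_smooth_evolution[OF Sdecay_moved(3)[OF u]]
       Sdecay_smooth_evolution[OF Sdecay_moved(4)[OF u]])
  ultimately show ?thesis
    unfolding flow_solution_def using moved_derivs[OF u] by blast
qed

lemma moved_invariants:
  assumes u: "displacement_of a u" and t: "t \<ge> 0"
  shows "legendre_curve (moved_curve u t) (moved_normal u t)" "ell_convex (moved_normal u t)"
    "alg_area (moved_curve u t) (moved_normal u t) = A2 / 2"
proof -
  let ?\<alpha> = "\<lambda>x. x + u t x" and ?\<alpha>' = "\<lambda>x. 1 + vd (u t) x"
  note \<alpha> = displacement_ofD(5)[OF u t]
  have \<nu>': "vd (moved_normal u t) = (\<lambda>x. ?\<alpha>' x *\<^sub>R rot (unit_vec (?\<alpha> x)))"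
    unfolding moved_normal_def[abs_def] by (rule vd_eqI) (rule has_vector_derivative_unit_vec[OF \<alpha>])
  have \<gamma>': "vd (moved_curve u t) = (\<lambda>x. ?\<alpha>' x *\<^sub>R bet t (?\<alpha> x) *\<^sub>R rot (unit_vec (?\<alpha> x)))"
    unfolding moved_curve_def[abs_def]
    by (rule vd_eqI)
      (use vector_diff_chain_at[OF \<alpha>[unfolded has_real_derivative_iff_has_vector_derivative] Gc_deriv[OF t]] in \<open>simp add: o_def\<close>)
  have per: "?\<alpha> (x + 2 * pi) = ?\<alpha> x + 2 * pi" for x using displacement_periodic[OF u t] by simp
  have "smooth (moved_curve u t)" "smooth (moved_normal u t)"
    unfolding moved_curve_eq moved_normal_eq
    by (intro smooth_vector Sdecay_smooth[OF Sdecay_moved(1)[OF u] t] Sdecay_smooth[OF Sdecay_moved(2)[OF u] t]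
      Sdecay_smooth[OF Sdecay_moved(3)[OF u] t] Sdecay_smooth[OF Sdecay_moved(4)[OF u] t])+
  moreover have "Gc t (x + 2 * pi) = Gc t x" for x
    using legendre_Gc[OF t] by (simp add: legendre_curve_def)
  ultimately show "legendre_curve (moved_curve u t) (moved_normal u t)"
    unfolding legendre_curve_def \<gamma>'
    by (simp add: moved_curve_def moved_normal_def per unit_vec_periodic)
  show "ell_convex (moved_normal u t)"
    unfolding ell_convex_def ell_def \<nu>' using displacement_ofD(3)[OF u t] by (simp add: moved_normal_def)
  have \<beta>: "beta (moved_curve u t) (moved_normal u t) = (\<lambda>x. ?\<alpha>' x * bet t (?\<alpha> x))"
    unfolding beta_def[abs_def] \<gamma>' by (simp add: moved_normal_def)
  have s: "support (moved_curve u t) (moved_normal u t) = (\<lambda>x. P t (?\<alpha> x))"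
    unfolding support_def[abs_def] moved_curve_def moved_normal_def Gc_frame by (simp add: inner_add_left)
  \<comment> \<open>The area integral is transported to the normal angle, where
    \<open>area_formula\<close> and the choice of p0 give the constant value.\<close>
  have "((\<lambda>x. ?\<alpha>' x * (P t (?\<alpha> x) * bet t (?\<alpha> x))) has_integral integral {0..2 * pi} (\<lambda>x. P t x * bet t x)) {0..2 * pi}"
  proof (rule integral_periodic_substitution[OF _ _ \<alpha>])
    show "continuous_on UNIV (\<lambda>x. P t x * bet t x)"
      by (intro smooth_continuous Sdecay_smooth[OF Sdecay_mult[OF Sdecay_P Sdecay_bet order.refl, simplified] t])
  qed (use per[of 0] in \<open>simp_all add: P_def bet_def fser_periodic\<close>)
  moreover have "integral {0..2 * pi} (\<lambda>x. P t x * bet t x) = A2"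
    using area_formula[OF t, of "p0 t"] p0_square[OF t] by (simp add: P_def bet_def)
  ultimately show "alg_area (moved_curve u t) (moved_normal u t) = A2 / 2"
    unfolding alg_area_def \<beta> s by (simp add: integral_unique algebra_simps)
qed

lemma p0_limit: "(p0 \<longlongrightarrow> sgn m * sqrt (A2 / (2 * pi))) at_top"
proof -
  have "(I \<longlongrightarrow> 0) at_top" using Sdecay_tendsto_zero[OF Sdecay_I] by simp
  from tendsto_add[OF tendsto_const[of A2] this] show ?thesis
    unfolding p0_def[abs_def] by (intro tendsto_intros) auto
qed

text \<open>The first harmonics of p only translate the curve by (c1, c2), which becomes the centre
  of the limit circle.\<close>

lemma X_eq:
  "X1 t x = c1 + (p0 t * cos x + (fser d t x * cos x - fser (dX d) t x * sin x))"
  "X2 t x = c2 + (p0 t * sin x + (fser d t x * sin x + fser (dX d) t x * cos x))"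
proof -
  have e: "c * (cos x * cos x) + c * (sin x * sin x) = c" for c
    by (simp flip: distrib_left power2_eq_square)
  have "X1 t x = c1 * (cos x * cos x) + c1 * (sin x * sin x) +
      (p0 t * cos x + (fser d t x * cos x - fser (dX d) t x * sin x))"
    "X2 t x = c2 * (cos x * cos x) + c2 * (sin x * sin x) +
      (p0 t * sin x + (fser d t x * sin x + fser (dX d) t x * cos x))"
    unfolding X1_def X2_def P_def Px_def by algebra+
  then show "X1 t x = c1 + (p0 t * cos x + (fser d t x * cos x - fser (dX d) t x * sin x))"
    "X2 t x = c2 + (p0 t * sin x + (fser d t x * sin x + fser (dX d) t x * cos x))"
    unfolding e .
qed

lemma moved_limit:
  assumes u: "displacement_of a u"
  obtains g where "circle_param (sqrt (A2 / (2 * pi))) g" "tendsto_smoothly (moved_curve u) g"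
proof -
  define R where "R = sqrt (A2 / (2 * pi))"
  obtain v where v: "smooth v" "\<And>k. uniform_limit UNIV (\<lambda>t. (vd ^^ k) (u t)) ((vd ^^ k) v) at_top"
    using settling_moved(1)[OF u] by (rule settling_smooth_limit) (rule that)
  obtain g1 where g1: "smooth g1"
    "\<And>k. uniform_limit UNIV (\<lambda>t. (vd ^^ k) (\<lambda>x. X1 t (x + u t x))) ((vd ^^ k) g1) at_top"
    using settling_moved(2)[OF u] by (rule settling_smooth_limit) (rule that)
  obtain g2 where g2: "smooth g2"
    "\<And>k. uniform_limit UNIV (\<lambda>t. (vd ^^ k) (\<lambda>x. X2 t (x + u t x))) ((vd ^^ k) g2) at_top"
    using settling_moved(3)[OF u] by (rule settling_smooth_limit) (rule that)
  have lim_u: "((\<lambda>t. u t x) \<longlongrightarrow> v x) at_top" for x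
    using tendsto_uniform_limitI[OF v(2)[of 0], of x] by simp
  have per: "v (x + 2 * pi) = v x" for x
  proof (rule tendsto_unique[OF _ lim_u])
    have "\<forall>\<^sub>F t in at_top. u t x = u t (x + 2 * pi)"
      using eventually_ge_at_top[of 0] by eventually_elim (simp add: displacement_periodic[OF u])
    then show "((\<lambda>t. u t (x + 2 * pi)) \<longlongrightarrow> v x) at_top"
      by (rule Lim_transform_eventually[OF lim_u[of x]])
  qed simp
  obtain c where c: "c > 0" "\<And>t x. t \<ge> 0 \<Longrightarrow> c \<le> 1 + vd (u t) x"
    using u unfolding displacement_of_def by blast
  \<comment> \<open>Strict positivity survives the limit through the bound c, which is uniform in
    time.\<close>
  have v': "0 < 1 + vd v x" for x
  proof -
    have "((\<lambda>t. 1 + vd (u t) x) \<longlongrightarrow> 1 + vd v x) at_top"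
      using tendsto_uniform_limitI[OF v(2)[of 1], of x] by (intro tendsto_intros) simp
    then have "c \<le> 1 + vd v x"
    proof (rule tendsto_lowerbound)
      show "\<forall>\<^sub>F t in at_top. c \<le> 1 + vd (u t) x"
        using eventually_ge_at_top[of 0] by eventually_elim (rule c(2))
    qed simp
    with c(1) show ?thesis by simp
  qed
  \<comment> \<open>If m < 0 the mean of p stays negative, and the point of signed radius - R at
    angle y is the point of radius R at angle y + pi.\<close>
  define b where "b = (if m > 0 then 0 else pi)"
  have b: "sgn m * R * cos y = R * cos (y + b)" "sgn m * R * sin y = R * sin (y + b)" for y
    using m_nonzero by (auto simp: b_def)
  have Y: "((\<lambda>t. x + u t x) \<longlongrightarrow> x + v x) at_top" for x by (intro tendsto_intros lim_u)
  have z: "((\<lambda>t. fser d t (x + u t x)) \<longlongrightarrow> 0) at_top" "((\<lambda>t. fser (dX d) t (x + u t x)) \<longlongrightarrow> 0) at_top" for x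
    by (rule Sdecay_tendsto_zero[OF Sdecay_all(1)], simp, rule Sdecay_tendsto_zero[OF Sdecay_all(2)], simp)
  have "((\<lambda>t. X1 t (x + u t x)) \<longlongrightarrow> c1 + (sgn m * R * cos (x + v x) + (0 * cos (x + v x) - 0 * sin (x + v x)))) at_top" for x
    unfolding X_eq R_def by (intro tendsto_intros z p0_limit Y)
  note L1 = this
  have 1: "g1 x = c1 + R * cos (x + v x + b)" for x
  proof -
    have "((\<lambda>t. X1 t (x + u t x)) \<longlongrightarrow> g1 x) at_top"
      using tendsto_uniform_limitI[OF g1(2)[of 0], of x] by simp
    from tendsto_unique[OF trivial_limit_at_top_linorder this L1[of x]] show ?thesis by (simp add: b)
  qed
  have "((\<lambda>t. X2 t (x + u t x)) \<longlongrightarrow> c2 + (sgn m * R * sin (x + v x) + (0 * sin (x + v x) + 0 * cos (x + v x)))) at_top" for x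
    unfolding X_eq R_def by (intro tendsto_intros z p0_limit Y)
  note L2 = this
  have 2: "g2 x = c2 + R * sin (x + v x + b)" for x
  proof -
    have "((\<lambda>t. X2 t (x + u t x)) \<longlongrightarrow> g2 x) at_top"
      using tendsto_uniform_limitI[OF g2(2)[of 0], of x] by simp
    from tendsto_unique[OF trivial_limit_at_top_linorder this L2[of x]] show ?thesis by (simp add: b)
  qed
  have "circle_param R (\<lambda>x. vector [g1 x, g2 x])"
    unfolding circle_param_def
  proof (intro exI conjI allI)
    show "smooth (\<lambda>x. 1 * x + b + v x)" by (rule smooth_affine_add[OF v(1)])
    show "1 * (x + 2 * pi) + b + v (x + 2 * pi) = 1 * x + b + v x + 2 * pi" for x by (simp add: per)
    have "vd (\<lambda>x. 1 * x + b + v x) = (\<lambda>x. 1 + vd v x)"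
      using smoothD[OF v(1)]
      by (intro vd_eqI_real) (auto intro!: derivative_eq_intros simp: has_real_derivative_iff_has_vector_derivative[symmetric])
    then show "0 < vd (\<lambda>x. 1 * x + b + v x) x" for x using v' by simp
    show "(vector [g1 x, g2 x] :: real^2) = vector [c1, c2] + R *\<^sub>R vector [cos (1 * x + b + v x), sin (1 * x + b + v x)]" for x
      by (simp add: vec_eq_iff forall_2 1 2 algebra_simps)
  qed
  moreover have "tendsto_smoothly (moved_curve u) (\<lambda>x. vector [g1 x, g2 x])"
    unfolding moved_curve_eq[abs_def]
    by (rule tendsto_smoothly_vector[OF Sdecay_smooth[OF Sdecay_moved(1)[OF u]] Sdecay_smooth[OF Sdecay_moved(2)[OF u]]
          g1(1) g2(1) g1(2) g2(2)])
  ultimately show ?thesis using that by (simp add: R_def)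
qed

end

subsection \<open>Uniqueness\<close>

lemma periodic_shift_integral:
  fixes g :: "real \<Rightarrow> real"
  assumes "continuous_on UNIV g" "\<And>x. g (x + 2 * pi) = g x"
  shows "integral {0..2 * pi} (\<lambda>x. g (x + a)) = integral {0..2 * pi} g"
proof -
  have "((\<lambda>x. x + a) has_real_derivative 1) (at x)" for x
    by (auto intro!: derivative_eq_intros)
  from integral_periodic_substitution[OF assms this]
  have "((\<lambda>x. 1 * g (x + a)) has_integral integral {0..2 * pi} g) {0..2 * pi}" by simp
  from integral_unique[OF this] show ?thesis by simp
qed

lemma Sdecay_static_derivs:
  assumes "Sdecay 0 (\<lambda>t. f)"
  shows "smooth f" "Sdecay 0 (\<lambda>t. vd f)" "(f has_real_derivative vd f x) (at x)" "continuous_on S f"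
  using Sdecay_smooth[OF assms, of 0] Sdecay_vd(1)[OF assms] Sdecay_vd(2)[OF assms, of 0]
  by (auto intro: smooth_continuous)

text \<open>\<open>slip\<close>, \<open>mean_speed\<close> and \<open>velocity\<close> express the
  right-hand side of the flow through beta as a function b of the normal angle alone, free of any
  parametrization.\<close>

definition slip :: "(real \<Rightarrow> real) \<Rightarrow> real \<Rightarrow> real" where
  "slip b y = vd b y / (1 + (b y)\<^sup>2)"

definition mean_speed :: "(real \<Rightarrow> real) \<Rightarrow> real" where
  "mean_speed b = 1 / integral {0..2 * pi} b * integral {0..2 * pi} (\<lambda>x. (b x)\<^sup>2)"

definition velocity :: "(real \<Rightarrow> real) \<Rightarrow> real \<Rightarrow> real^2" where
  "velocity b y = slip b y *\<^sub>R rot (unit_vec y) + (b y - mean_speed b) *\<^sub>R unit_vec y"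

(* b is the function beta of the curve as a function of the normal angle alpha; its first
   Fourier coefficients vanish because b = p + p''. *)
definition curvature_of :: "curve \<Rightarrow> (real \<Rightarrow> real) \<Rightarrow> (real \<Rightarrow> real) \<Rightarrow> (real \<Rightarrow> real) \<Rightarrow> bool" where
  "curvature_of \<gamma> \<alpha> \<alpha>' b \<longleftrightarrow> Sdecay 0 (\<lambda>t. b) \<and> (\<forall>x. b (x + 2 * pi) = b x) \<and>
     fourier_cos b 1 = 0 \<and> fourier_sin b 1 = 0 \<and> (\<forall>x. \<alpha> (x + 2 * pi) = \<alpha> x + 2 * pi) \<and>
     (\<forall>x. (\<gamma> has_vector_derivative (\<alpha>' x * b (\<alpha> x)) *\<^sub>R rot (unit_vec (\<alpha> x))) (at x))"

text \<open>N turns at unit speed, so \<phi> and \<alpha> both have the angular speed of \<nu> as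
  derivative and differ by a constant. Hence everything computed from (G, N) at \<phi> can be
  rewritten at the normal angle \<alpha>, whatever the sign of \<alpha>'.\<close>

lemma normalized_slice:
  assumes norm: "normalization \<gamma> \<nu> G N \<phi>"
    and \<nu>: "\<And>\<theta>. \<nu> \<theta> = unit_vec (\<alpha> \<theta>)" and \<alpha>: "\<And>\<theta>. (\<alpha> has_real_derivative \<alpha>' \<theta>) (at \<theta>)"
  obtains b where "curvature_of \<gamma> \<alpha> \<alpha>' b" "\<And>\<theta>. flow_gamma G N (\<phi> \<theta>) = velocity b (\<alpha> \<theta>)"
    "\<And>\<theta>. flow_nu G N (\<phi> \<theta>) = (- (b (\<alpha> \<theta>) * slip b (\<alpha> \<theta>))) *\<^sub>R rot (\<nu> \<theta>)"
proof -
  have L: "legendre_curve G N" and ell: "\<And>\<theta>. ell N \<theta> = 1" and \<phi>: "smooth \<phi>"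
    and per: "\<And>\<theta>. \<phi> (\<theta> + 2 * pi) = \<phi> \<theta> + 2 * pi"
    and \<gamma>G: "\<And>\<theta>. \<gamma> \<theta> = G (\<phi> \<theta>)" and \<nu>N: "\<And>\<theta>. \<nu> \<theta> = N (\<phi> \<theta>)"
    using norm by (auto simp: normalization_def)
  note D = legendre_curveD[OF L]
  have \<nu>1: "(\<lambda>\<theta>. N (\<phi> \<theta>)) = \<nu>" and \<nu>2: "(\<lambda>\<theta>. unit_vec (\<alpha> \<theta>)) = \<nu>" and \<gamma>1: "(\<lambda>\<theta>. G (\<phi> \<theta>)) = \<gamma>"
    by (simp_all only: \<gamma>G[symmetric] \<nu>N[symmetric] \<nu>[symmetric])
  have \<phi>': "(\<phi> has_real_derivative \<alpha>' \<theta>) (at \<theta>)" for \<theta>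
  proof -
    have "(\<nu> has_vector_derivative vd \<phi> \<theta> *\<^sub>R ell N (\<phi> \<theta>) *\<^sub>R rot (N (\<phi> \<theta>))) (at \<theta>)"
      using vector_diff_chain_at[OF smoothD[OF \<phi>] D(2)] by (simp add: o_def \<nu>1)
    moreover have "(\<nu> has_vector_derivative \<alpha>' \<theta> *\<^sub>R rot (unit_vec (\<alpha> \<theta>))) (at \<theta>)"
      using has_vector_derivative_unit_vec[OF \<alpha>] unfolding \<nu>2 .
    ultimately have "vd \<phi> \<theta> *\<^sub>R rot (\<nu> \<theta>) = \<alpha>' \<theta> *\<^sub>R rot (\<nu> \<theta>)"
      using vector_derivative_unique_at ell \<nu> \<nu>N by (metis scaleR_one)
    moreover have "rot (\<nu> \<theta>) \<noteq> 0" using norm_rot[of "\<nu> \<theta>"] \<nu> by (metis norm_unit_vec norm_zero zero_neq_one)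
    ultimately have "vd \<phi> \<theta> = \<alpha>' \<theta>" by simp
    then show ?thesis using smoothD[OF \<phi>, of \<theta>] by (simp add: has_real_derivative_iff_has_vector_derivative)
  qed
  define a where "a = \<alpha> 0 - \<phi> 0"
  have "\<alpha> \<theta> - \<phi> \<theta> = a" for \<theta>
    unfolding a_def
    by (rule DERIV_isconst_all) (use DERIV_diff[OF \<alpha> \<phi>'] in simp)
  then have \<alpha>\<phi>: "\<alpha> \<theta> = \<phi> \<theta> + a" for \<theta> by (simp add: algebra_simps)
  have "N (\<phi> 0) = unit_vec (\<phi> 0 + a)" using \<nu> \<nu>N \<alpha>\<phi> by metis
  then obtain p where p: "Sdecay 0 (\<lambda>t. p)" "\<And>x. p (x + 2 * pi) = p x" "\<And>\<theta>. N \<theta> = unit_vec (\<theta> + a)"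
    "\<And>\<theta>. beta G N \<theta> = p (\<theta> + a) + vd (vd p) (\<theta> + a)"
    using L ell by (rule_tac normal_form[where \<gamma>=G and \<nu>=N and ?x0.0="\<phi> 0" and a=a]) blast+
  note p1 = Sdecay_static_derivs[OF p(1)]
  note p2 = Sdecay_static_derivs[OF p1(2)]
  define b where "b y = p y + vd (vd p) y" for y
  have b: "Sdecay 0 (\<lambda>t. b)" unfolding b_def[abs_def] by (intro Sdecay_add p(1) p2(2))
  note bd = Sdecay_static_derivs[OF b]
  have pv: "vd p (x + 2 * pi) = vd p x" for x by (rule periodic_vd[OF p1(1) p(2)])
  have pvv: "vd (vd p) (x + 2 * pi) = vd (vd p) x" for x by (rule periodic_vd[OF p2(1) pv])
  have bper: "b (x + 2 * pi) = b x" for x by (simp add: b_def p pvv)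
  have bmin: "b = (\<lambda>x. vd (vd p) x - - p x)" by (simp add: b_def[abs_def] add.commute)
  \<comment> \<open>Frequency 1 is an eigenmode of the second derivative with eigenvalue - 1, so p +
    p'' does not contain it.\<close>
  have f1: "fourier_cos b 1 = 0" "fourier_sin b 1 = 0"
    unfolding bmin
    using fourier_diff[OF smooth_continuous[OF smooth_vd[OF p2(1)]] continuous_on_minus[OF p1(4)], of 1]
      fourier_vd[OF p1(1) p(2), of 1] fourier_vd[OF p2(1) pv, of 1]
    by (simp_all add: fourier_cos_def fourier_sin_def)
  have \<beta>: "beta G N = (\<lambda>x. b (x + a))" by (simp add: fun_eq_iff p(4) b_def)
  have "alg_length G N = integral {0..2 * pi} b"
    unfolding alg_length_def \<beta> by (rule periodic_shift_integral[OF bd(4) bper])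
  moreover have "integral {0..2 * pi} (\<lambda>x. (beta G N x)\<^sup>2) = integral {0..2 * pi} (\<lambda>x. (b x)\<^sup>2)"
    unfolding \<beta> by (rule periodic_shift_integral[where g="\<lambda>x. (b x)\<^sup>2"]) (auto intro!: continuous_intros bd(4) simp: bper)
  ultimately have l: "lam G N = mean_speed b" by (simp add: lam_def mean_speed_def)
  have s: "speed G N = (\<lambda>x. b (x + a) - mean_speed b)" by (simp add: speed_def[abs_def] l \<beta>)
  have vs: "vd (speed G N) = (\<lambda>x. vd b (x + a))"
    unfolding s
  proof (rule vd_eqI_real)
    fix x
    have "((\<lambda>x. b (x + a)) has_real_derivative vd b (x + a)) (at x)"
      using bd(3)[of "x + a"] by (simp only: DERIV_shift)
    from DERIV_diff[OF this DERIV_const]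
    show "((\<lambda>x. b (x + a) - mean_speed b) has_real_derivative vd b (x + a)) (at x)" by simp
  qed
  have \<gamma>': "(\<gamma> has_vector_derivative (\<alpha>' \<theta> * b (\<alpha> \<theta>)) *\<^sub>R rot (\<nu> \<theta>)) (at \<theta>)" for \<theta>
    using vector_diff_chain_at[OF \<phi>'[unfolded has_real_derivative_iff_has_vector_derivative] D(1), of \<theta>]
    by (simp add: o_def \<gamma>1 \<beta> \<alpha>\<phi> \<nu>N)
  show ?thesis
  proof (rule that[of b])
    show "curvature_of \<gamma> \<alpha> \<alpha>' b"
      unfolding curvature_of_def using b bper f1 \<gamma>' by (simp add: \<alpha>\<phi> per \<nu>)
    show "flow_gamma G N (\<phi> \<theta>) = velocity b (\<alpha> \<theta>)" for \<theta>
      unfolding flow_gamma_def vs by (simp add: ell s \<beta> \<alpha>\<phi> \<nu>N[symmetric] \<nu> velocity_def slip_def)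
    show "flow_nu G N (\<phi> \<theta>) = (- (b (\<alpha> \<theta>) * slip b (\<alpha> \<theta>))) *\<^sub>R rot (\<nu> \<theta>)" for \<theta>
      unfolding flow_nu_def vs by (simp add: ell \<beta> \<alpha>\<phi> \<nu>N slip_def)
  qed
qed

lemma vector_derivative_unique_halfline:
  assumes "(f has_vector_derivative a) (at t within {0..})" "(f has_vector_derivative b) (at t within {0..})" "t \<ge> 0"
  shows "a = (b :: 'a :: real_normed_vector)"
proof -
  show ?thesis using vector_derivative_unique_within[OF halfline_nontrivial[OF assms(3)] assms(1,2)] .
qed

text \<open>What is known along an arbitrary solution. The function b t is given at each time
  separately, with no regularity in t, and \<open>\<alpha>\<^sub>x\<close> carries no sign
  condition.\<close>

locale flow_lift =
  fixes a :: real and \<gamma> \<gamma>\<^sub>t :: "real \<Rightarrow> curve" and \<alpha> \<alpha>\<^sub>x \<omega> \<omega>\<^sub>x b :: "real \<Rightarrow> real \<Rightarrow> real"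
  assumes cont: "continuous_on ({0..} \<times> UNIV) (\<lambda>(t, x). \<alpha> t x)" "continuous_on ({0..} \<times> UNIV) (\<lambda>(t, x). \<alpha>\<^sub>x t x)"
      "continuous_on ({0..} \<times> UNIV) (\<lambda>(t, x). \<omega> t x)" "continuous_on ({0..} \<times> UNIV) (\<lambda>(t, x). \<omega>\<^sub>x t x)"
      "continuous_on ({0..} \<times> UNIV) (\<lambda>(t, x). \<gamma> t x)" "continuous_on ({0..} \<times> UNIV) (\<lambda>(t, x). \<gamma>\<^sub>t t x)"
    and init: "\<alpha> 0 x = x + a" "\<alpha>\<^sub>x 0 x = 1"
    and derivs: "t \<ge> 0 \<Longrightarrow> (\<alpha> t has_real_derivative \<alpha>\<^sub>x t x) (at x)"
      "t \<ge> 0 \<Longrightarrow> (\<omega> t has_real_derivative \<omega>\<^sub>x t x) (at x)"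
      "t \<ge> 0 \<Longrightarrow> ((\<lambda>t. \<alpha> t x) has_real_derivative \<omega> t x) (at t within {0..})"
      "t \<ge> 0 \<Longrightarrow> ((\<lambda>t. \<alpha>\<^sub>x t x) has_real_derivative \<omega>\<^sub>x t x) (at t within {0..})"
      "t \<ge> 0 \<Longrightarrow> ((\<lambda>t. \<gamma> t x) has_vector_derivative \<gamma>\<^sub>t t x) (at t within {0..})"
    and per: "t \<ge> 0 \<Longrightarrow> \<gamma> t (x + 2 * pi) = \<gamma> t x"
    and curvature: "t \<ge> 0 \<Longrightarrow> curvature_of (\<gamma> t) (\<alpha> t) (\<alpha>\<^sub>x t) (b t)"
    and \<gamma>\<^sub>t: "t \<ge> 0 \<Longrightarrow> \<gamma>\<^sub>t t x = velocity (b t) (\<alpha> t x)"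
    and \<omega>: "t \<ge> 0 \<Longrightarrow> \<omega> t x = - (b t (\<alpha> t x) * slip (b t) (\<alpha> t x))"

text \<open>The angle is obtained by integrating the angular velocity of \<nu> in time, starting
  from \<theta> + a. In this way it inherits the joint regularity of the evolution, which the maps
  \<phi>, chosen at each time independently, do not provide.\<close>

lemma flow_lift_exists:
  assumes fs: "flow_solution \<gamma>\<^sub>0 \<nu>\<^sub>0 \<gamma> \<nu>" and \<nu>\<^sub>0: "\<And>\<theta>. \<nu>\<^sub>0 \<theta> = unit_vec (\<theta> + a)"
  obtains \<gamma>\<^sub>t \<alpha> \<alpha>\<^sub>x \<omega> \<omega>\<^sub>x b where "flow_lift a \<gamma> \<gamma>\<^sub>t \<alpha> \<alpha>\<^sub>x \<omega> \<omega>\<^sub>x b"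
    "\<And>t \<theta>. t \<ge> 0 \<Longrightarrow> \<nu> t \<theta> = unit_vec (\<alpha> t \<theta>)"
proof -
  have se: "smooth_evolution \<gamma>" "smooth_evolution \<nu>" and 0: "\<nu> 0 = \<nu>\<^sub>0"
    using fs by (auto simp: flow_solution_def)
  have "\<exists>G N \<phi>. \<forall>t\<ge>0. normalization (\<gamma> t) (\<nu> t) (G t) (N t) (\<phi> t) \<and>
        (\<forall>\<theta>. ((\<lambda>s. \<gamma> s \<theta>) has_vector_derivative flow_gamma (G t) (N t) (\<phi> t \<theta>)) (at t within {0..}) \<and>
             ((\<lambda>s. \<nu> s \<theta>) has_vector_derivative flow_nu (G t) (N t) (\<phi> t \<theta>)) (at t within {0..}))"
    using fs unfolding flow_solution_def by metis
  then obtain G N \<phi> where norm: "\<And>t. t \<ge> 0 \<Longrightarrow> normalization (\<gamma> t) (\<nu> t) (G t) (N t) (\<phi> t)"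
    and fg: "\<And>t \<theta>. t \<ge> 0 \<Longrightarrow> ((\<lambda>s. \<gamma> s \<theta>) has_vector_derivative flow_gamma (G t) (N t) (\<phi> t \<theta>)) (at t within {0..})"
    and fn: "\<And>t \<theta>. t \<ge> 0 \<Longrightarrow> ((\<lambda>s. \<nu> s \<theta>) has_vector_derivative flow_nu (G t) (N t) (\<phi> t \<theta>)) (at t within {0..})"
    by blast
  obtain \<gamma>x \<gamma>\<^sub>t where \<gamma>: "continuous_on ({0..} \<times> UNIV) (\<lambda>(t, x). \<gamma> t x)" "smooth_evolution \<gamma>x" "smooth_evolution \<gamma>\<^sub>t"
     "\<And>t x. t \<ge> 0 \<Longrightarrow> (\<gamma> t has_vector_derivative \<gamma>x t x) (at x)"
     "\<And>t x. t \<ge> 0 \<Longrightarrow> ((\<lambda>s. \<gamma> s x) has_vector_derivative \<gamma>\<^sub>t t x) (at t within {0..})"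
    using se(1) by (rule smooth_evolutionE) (rule that)
  obtain \<nu>x \<nu>t where \<nu>: "continuous_on ({0..} \<times> UNIV) (\<lambda>(t, x). \<nu> t x)" "smooth_evolution \<nu>x" "smooth_evolution \<nu>t"
     "\<And>t x. t \<ge> 0 \<Longrightarrow> (\<nu> t has_vector_derivative \<nu>x t x) (at x)"
     "\<And>t x. t \<ge> 0 \<Longrightarrow> ((\<lambda>s. \<nu> s x) has_vector_derivative \<nu>t t x) (at t within {0..})"
    using se(2) by (rule smooth_evolutionE) (rule that)
  obtain \<nu>tx \<nu>tt where \<nu>t: "continuous_on ({0..} \<times> UNIV) (\<lambda>(t, x). \<nu>t t x)" "smooth_evolution \<nu>tx" "smooth_evolution \<nu>tt"
     "\<And>t x. t \<ge> 0 \<Longrightarrow> (\<nu>t t has_vector_derivative \<nu>tx t x) (at x)"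
     "\<And>t x. t \<ge> 0 \<Longrightarrow> ((\<lambda>s. \<nu>t s x) has_vector_derivative \<nu>tt t x) (at t within {0..})"
    using \<nu>(3) by (rule smooth_evolutionE) (rule that)
  have unit: "norm (\<nu> t \<theta>) = 1" if "t \<ge> 0" for t \<theta>
    using norm[OF that] by (auto simp: normalization_def legendre_curve_def)
  define \<omega> where "\<omega> t \<theta> = \<nu>t t \<theta> \<bullet> rot (\<nu> t \<theta>)" for t \<theta>
  define \<omega>\<^sub>x where "\<omega>\<^sub>x t \<theta> = \<nu>t t \<theta> \<bullet> rot (\<nu>x t \<theta>) + \<nu>tx t \<theta> \<bullet> rot (\<nu> t \<theta>)" for t \<theta>
  note cr = bounded_linear.continuous_on[OF bounded_linear_rot]
  have c\<omega>: "continuous_on ({0..} \<times> UNIV) (\<lambda>(t, x). \<omega> t x)"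
    using \<nu>(1) \<nu>t(1) unfolding \<omega>_def case_prod_unfold by (intro continuous_intros cr)
  have c\<omega>x: "continuous_on ({0..} \<times> UNIV) (\<lambda>(t, x). \<omega>\<^sub>x t x)"
    using \<nu>(1) \<nu>t(1) smooth_evolution_continuous[OF \<nu>(2)] smooth_evolution_continuous[OF \<nu>t(2)]
    unfolding \<omega>\<^sub>x_def case_prod_unfold by (intro continuous_intros cr)
  have \<omega>x: "(\<omega> t has_real_derivative \<omega>\<^sub>x t x) (at x)" if "t \<ge> 0" for t x
    unfolding \<omega>_def[abs_def] \<omega>\<^sub>x_def
    by (rule has_real_derivative_inner[OF \<nu>t(4)[OF that] has_vector_derivative_rot[OF \<nu>(4)[OF that]]])
  have \<nu>t\<omega>: "\<nu>t t \<theta> = \<omega> t \<theta> *\<^sub>R rot (\<nu> t \<theta>)" if t: "t \<ge> 0" for t \<theta>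
  proof -
    have "\<nu>t t \<theta> = flow_nu (G t) (N t) (\<phi> t \<theta>)"
      by (rule vector_derivative_unique_halfline[OF \<nu>(5)[OF t] fn[OF t] t])
    moreover have "N t (\<phi> t \<theta>) = \<nu> t \<theta>" using norm[OF t] by (simp add: normalization_def)
    ultimately obtain k where k: "\<nu>t t \<theta> = k *\<^sub>R rot (\<nu> t \<theta>)" by (metis flow_nu_def)
    then have "\<omega> t \<theta> = k" using unit[OF t, of \<theta>] by (simp add: \<omega>_def norm_eq_1)
    with k show ?thesis by simp
  qed
  define \<alpha> where "\<alpha> t \<theta> = \<theta> + a + integral {0..t} (\<lambda>s. \<omega> s \<theta>)" for t \<theta>
  define \<alpha>\<^sub>x where "\<alpha>\<^sub>x t \<theta> = 1 + integral {0..t} (\<lambda>s. \<omega>\<^sub>x s \<theta>)" for t \<theta>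
  have path: "continuous_on {0..} (\<lambda>s. f s \<theta>)" if "continuous_on ({0..} \<times> UNIV) (\<lambda>(t, x). f t x)" for f :: "real \<Rightarrow> real \<Rightarrow> real" and \<theta>
    by (rule continuous_on_quadrant_compose[OF that]) (auto intro: continuous_intros)
  have \<alpha>t: "((\<lambda>t. \<alpha> t x) has_real_derivative \<omega> t x) (at t within {0..})" if "t \<ge> 0" for t x
    unfolding \<alpha>_def by (auto intro!: derivative_eq_intros has_real_derivative_time_integral path c\<omega> that)
  have \<alpha>xt: "((\<lambda>t. \<alpha>\<^sub>x t x) has_real_derivative \<omega>\<^sub>x t x) (at t within {0..})" if "t \<ge> 0" for t x
    unfolding \<alpha>\<^sub>x_def by (auto intro!: derivative_eq_intros has_real_derivative_time_integral path c\<omega>x that)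
  have \<alpha>x: "(\<alpha> t has_real_derivative \<alpha>\<^sub>x t x) (at x)" if "t \<ge> 0" for t x
    unfolding \<alpha>_def[abs_def] \<alpha>\<^sub>x_def
    using has_real_derivative_time_integral_param[OF \<omega>x c\<omega> c\<omega>x] by (auto intro!: derivative_eq_intros)
  have \<nu>\<alpha>: "\<nu> t \<theta> = unit_vec (\<alpha> t \<theta>)" if "t \<ge> 0" for t \<theta>
  proof (rule rotating_frame[of "{0..}" 0 "\<lambda>t. \<nu> t \<theta>" "\<lambda>t. \<omega> t \<theta>" "\<lambda>t. \<alpha> t \<theta>"])
    show "((\<lambda>t. \<nu> t \<theta>) has_vector_derivative \<omega> t \<theta> *\<^sub>R rot (\<nu> t \<theta>)) (at t within {0..})" if "t \<in> {0..}" for t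
      using \<nu>(5)[of t \<theta>] \<nu>t\<omega>[of t \<theta>] that by simp
  qed (use \<alpha>t unit that in \<open>auto simp: \<alpha>_def 0 \<nu>\<^sub>0\<close>)
  have "\<exists>b. \<forall>t\<ge>0. curvature_of (\<gamma> t) (\<alpha> t) (\<alpha>\<^sub>x t) (b t) \<and>
    (\<forall>\<theta>. flow_gamma (G t) (N t) (\<phi> t \<theta>) = velocity (b t) (\<alpha> t \<theta>)) \<and>
    (\<forall>\<theta>. flow_nu (G t) (N t) (\<phi> t \<theta>) = (- (b t (\<alpha> t \<theta>) * slip (b t) (\<alpha> t \<theta>))) *\<^sub>R rot (\<nu> t \<theta>))"
    (is "\<exists>b. \<forall>t\<ge>0. ?R t (b t)")
  proof -
    have "\<exists>b. ?R t b" if t: "t \<ge> 0" for t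
      by (rule normalized_slice[OF norm[OF t] \<nu>\<alpha>[OF t] \<alpha>x[OF t]]) (intro exI conjI allI; assumption)
    then show ?thesis by metis
  qed
  then obtain b where b: "\<And>t. t \<ge> 0 \<Longrightarrow> curvature_of (\<gamma> t) (\<alpha> t) (\<alpha>\<^sub>x t) (b t)"
    and fb: "\<And>t \<theta>. t \<ge> 0 \<Longrightarrow> flow_gamma (G t) (N t) (\<phi> t \<theta>) = velocity (b t) (\<alpha> t \<theta>)"
      "\<And>t \<theta>. t \<ge> 0 \<Longrightarrow> flow_nu (G t) (N t) (\<phi> t \<theta>) = (- (b t (\<alpha> t \<theta>) * slip (b t) (\<alpha> t \<theta>))) *\<^sub>R rot (\<nu> t \<theta>)"
    by blast
  have "flow_lift a \<gamma> \<gamma>\<^sub>t \<alpha> \<alpha>\<^sub>x \<omega> \<omega>\<^sub>x b"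
  proof
    show "continuous_on ({0..} \<times> UNIV) (\<lambda>(t, x). \<alpha> t x)" "continuous_on ({0..} \<times> UNIV) (\<lambda>(t, x). \<alpha>\<^sub>x t x)"
      using continuous_on_time_integral[OF c\<omega>] continuous_on_time_integral[OF c\<omega>x]
      unfolding \<alpha>_def \<alpha>\<^sub>x_def case_prod_unfold by (auto intro!: continuous_intros)
    show "continuous_on ({0..} \<times> UNIV) (\<lambda>(t, x). \<gamma>\<^sub>t t x)" by (rule smooth_evolution_continuous[OF \<gamma>(3)])
    show "\<alpha> 0 x = x + a" "\<alpha>\<^sub>x 0 x = 1" for x by (simp_all add: \<alpha>_def \<alpha>\<^sub>x_def)
    fix t x :: real assume t: "0 \<le> t"
    show "\<gamma> t (x + 2 * pi) = \<gamma> t x"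
      using norm[OF t] unfolding normalization_def legendre_curve_def by metis
    show "\<gamma>\<^sub>t t x = velocity (b t) (\<alpha> t x)"
      unfolding fb(1)[OF t, symmetric] by (rule vector_derivative_unique_halfline[OF \<gamma>(5)[OF t] fg[OF t] t])
    have "\<nu>t t x = flow_nu (G t) (N t) (\<phi> t x)"
      by (rule vector_derivative_unique_halfline[OF \<nu>(5)[OF t] fn[OF t] t])
    then show "\<omega> t x = - (b t (\<alpha> t x) * slip (b t) (\<alpha> t x))"
      using unit[OF t, of x] unfolding fb(2)[OF t] by (simp add: \<omega>_def norm_eq_1)
  qed (use c\<omega> c\<omega>x \<gamma> \<alpha>x \<omega>x \<alpha>t \<alpha>xt b in auto)
  then show ?thesis using \<nu>\<alpha> by (rule that)
qed

section \<open>Moments of beta along an arbitrary solution\<close>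

context flow_lift
begin

lemma b:
  assumes "t \<ge> 0"
  shows "Sdecay 0 (\<lambda>_. b t)" "b t (x + 2 * pi) = b t x" "fourier_cos (b t) 1 = 0" "fourier_sin (b t) 1 = 0"
  using curvature[OF assms] by (simp_all add: curvature_of_def)

lemma curve_deriv:
  "t \<ge> 0 \<Longrightarrow> (\<gamma> t has_vector_derivative (\<alpha>\<^sub>x t x * b t (\<alpha> t x)) *\<^sub>R rot (unit_vec (\<alpha> t x))) (at x)"
  using curvature by (simp add: curvature_of_def)

text \<open>Normal and tangential components of the position; on a curve with support function p
  they are p (alpha) and p' (alpha).\<close>

abbreviation "gn t x \<equiv> \<gamma> t x \<bullet> unit_vec (\<alpha> t x)"

abbreviation "gm t x \<equiv> \<gamma> t x \<bullet> rot (unit_vec (\<alpha> t x))"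

text \<open>The density of beta f (alpha) d alpha up to a total derivative, with beta eliminated:
  gm_x = alpha_x beta - alpha_x gn, and integration by parts moves the derivative from gm to f. All
  that remains has known time derivatives.\<close>

definition moment :: "(real \<Rightarrow> real) \<Rightarrow> (real \<Rightarrow> real) \<Rightarrow> real \<Rightarrow> real \<Rightarrow> real" where
  "moment f f' t x = \<alpha>\<^sub>x t x * (f (\<alpha> t x) * gn t x -
     f' (\<alpha> t x) * gm t x)"

lemma frame_derivs:
  assumes t: "t \<ge> 0"
  shows "((\<lambda>x. gn t x) has_real_derivative \<alpha>\<^sub>x t x * gm t x) (at x)"
    "((\<lambda>x. gm t x) has_real_derivative
       \<alpha>\<^sub>x t x * b t (\<alpha> t x) - \<alpha>\<^sub>x t x * gn t x) (at x)"
    "((\<lambda>t. gn t x) has_real_derivative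
       \<gamma>\<^sub>t t x \<bullet> unit_vec (\<alpha> t x) + \<omega> t x * gm t x) (at t within {0..})"
    "((\<lambda>t. gm t x) has_real_derivative
       \<gamma>\<^sub>t t x \<bullet> rot (unit_vec (\<alpha> t x)) - \<omega> t x * gn t x) (at t within {0..})"
proof -
  note ex = has_vector_derivative_unit_vec[OF derivs(1)[OF t, of x]]
  note et = has_vector_derivative_unit_vec[OF derivs(3)[OF t, of x]]
  show "((\<lambda>x. gn t x) has_real_derivative \<alpha>\<^sub>x t x * gm t x) (at x)"
    using has_real_derivative_inner[OF curve_deriv[OF t, of x] ex] by simp
  show "((\<lambda>x. gm t x) has_real_derivative
       \<alpha>\<^sub>x t x * b t (\<alpha> t x) - \<alpha>\<^sub>x t x * gn t x) (at x)"
    using has_real_derivative_inner[OF curve_deriv[OF t, of x] has_vector_derivative_rot[OF ex]]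
    by (simp add: linear_scale[OF bounded_linear.linear[OF bounded_linear_rot]] rot_rot)
  show "((\<lambda>t. gn t x) has_real_derivative
       \<gamma>\<^sub>t t x \<bullet> unit_vec (\<alpha> t x) + \<omega> t x * gm t x) (at t within {0..})"
    using has_real_derivative_inner[OF derivs(5)[OF t, of x] et] by (simp add: add.commute)
  show "((\<lambda>t. gm t x) has_real_derivative
       \<gamma>\<^sub>t t x \<bullet> rot (unit_vec (\<alpha> t x)) - \<omega> t x * gn t x) (at t within {0..})"
    using has_real_derivative_inner[OF derivs(5)[OF t, of x] has_vector_derivative_rot[OF et]]
    by (simp add: linear_scale[OF bounded_linear.linear[OF bounded_linear_rot]] rot_rot)
qed

lemma periodic_at_ends:
  assumes "t \<ge> 0"
  shows "\<alpha> t (2 * pi) = \<alpha> t 0 + 2 * pi" "\<gamma> t (2 * pi) = \<gamma> t 0" "\<omega> t (2 * pi) = \<omega> t 0"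
    "b t (\<alpha> t (2 * pi)) = b t (\<alpha> t 0)" "unit_vec (\<alpha> t (2 * pi)) = unit_vec (\<alpha> t 0)"
proof -
  have 1: "\<alpha> t (2 * pi) = \<alpha> t 0 + 2 * pi" "\<gamma> t (2 * pi) = \<gamma> t 0"
    using curvature[OF assms] per[OF assms, of 0] by (auto simp: curvature_of_def dest: spec[of _ 0])
  have "vd (b t) (y + 2 * pi) = vd (b t) y" for y
    by (rule periodic_vd[OF Sdecay_static_derivs(1)[OF b(1)[OF assms]] b(2)[OF assms]])
  with 1 b(2)[OF assms] \<omega>[OF assms]
  show "\<alpha> t (2 * pi) = \<alpha> t 0 + 2 * pi" "\<gamma> t (2 * pi) = \<gamma> t 0" "\<omega> t (2 * pi) = \<omega> t 0"
    "b t (\<alpha> t (2 * pi)) = b t (\<alpha> t 0)" "unit_vec (\<alpha> t (2 * pi)) = unit_vec (\<alpha> t 0)"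
    by (simp_all add: unit_vec_periodic slip_def)
qed

text \<open>Subtract the total derivative of f (alpha) gm from alpha_x beta f (alpha), and
  substitute along alpha, which needs no monotonicity.\<close>

lemma integral_moment:
  assumes t: "t \<ge> 0" and f: "\<And>y. (f has_real_derivative f' y) (at y)" "\<And>y. f (y + 2 * pi) = f y"
  shows "integral {0..2 * pi} (moment f f' t) = integral {0..2 * pi} (\<lambda>y. b t y * f y)"
proof -
  note bd = Sdecay_static_derivs[OF b(1)[OF t]]
  note e = periodic_at_ends[OF t]
  have cf: "continuous_on UNIV f" using f(1) by (intro DERIV_continuous_on) (auto intro: has_field_derivative_at_within)
  have 1: "((\<lambda>x. \<alpha>\<^sub>x t x * (b t (\<alpha> t x) * f (\<alpha> t x))) has_integral integral {0..2 * pi} (\<lambda>y. b t y * f y)) {0..2 * pi}"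
    by (rule integral_periodic_substitution[where g="\<lambda>y. b t y * f y", OF _ _ derivs(1)[OF t] e(1)])
      (auto intro!: continuous_intros bd(4) cf simp: f(2) b(2)[OF t])
  have 2: "((\<lambda>x. f' (\<alpha> t x) * \<alpha>\<^sub>x t x * gm t x +
      (\<alpha>\<^sub>x t x * b t (\<alpha> t x) - \<alpha>\<^sub>x t x * gn t x) * f (\<alpha> t x)) has_integral 0) {0..2 * pi}"
    by (rule has_integral_periodic_deriv[of "\<lambda>x. f (\<alpha> t x) * gm t x"])
      (use DERIV_mult[OF DERIV_chain2[OF f(1) derivs(1)[OF t]] frame_derivs(2)[OF t]] f(2)[of "\<alpha> t 0"] e in auto)
  have "(moment f f' t has_integral integral {0..2 * pi} (\<lambda>y. b t y * f y) - 0) {0..2 * pi}"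
    by (rule has_integral_eq[OF _ has_integral_diff[OF 1 2]]) (simp add: moment_def algebra_simps)
  then show ?thesis by (simp add: integral_unique)
qed

text \<open>Weak form of beta_t = (1 + d^2/dx^2) (beta - lambda), tested with an eigenfunction f'' =
  \<kappa> f: cosine and sine of frequency k have \<kappa> = - k^2, constants have \<kappa> =
  0.\<close>

lemma moment_rate:
  assumes t: "t \<ge> 0"
    and f: "\<And>y. (f has_real_derivative f' y) (at y)" "\<And>y. (f' has_real_derivative \<kappa> * f y) (at y)"
      "\<And>y. f (y + 2 * pi) = f y" "\<And>y. f' (y + 2 * pi) = f' y"
  shows "((\<lambda>t. integral {0..2 * pi} (\<lambda>y. b t y * f y)) has_real_derivative
    (1 + \<kappa>) * integral {0..2 * pi} (\<lambda>y. (b t y - mean_speed (b t)) * f y)) (at t within {0..})"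
proof -
  \<comment> \<open>The time derivative of the moment density by the product rule, with f'' replaced
    by \<kappa> f.\<close>
  define h where "h t x = \<omega>\<^sub>x t x * (f (\<alpha> t x) * gn t x - f' (\<alpha> t x) * gm t x) +
    \<alpha>\<^sub>x t x * ((f' (\<alpha> t x) * \<omega> t x * gn t x + (\<gamma>\<^sub>t t x \<bullet> unit_vec (\<alpha> t x) + \<omega> t x * gm t x) * f (\<alpha> t x)) -
      (\<kappa> * f (\<alpha> t x) * \<omega> t x * gm t x + (\<gamma>\<^sub>t t x \<bullet> rot (unit_vec (\<alpha> t x)) - \<omega> t x * gn t x) * f' (\<alpha> t x)))" for t x
  note bd = Sdecay_static_derivs[OF b(1)[OF t]]
  note e = periodic_at_ends[OF t]
  have cf: "continuous_on UNIV f" "continuous_on UNIV f'"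
    using f(1,2) by (auto intro!: DERIV_continuous_on intro: has_field_derivative_at_within)
  note c = cont[unfolded case_prod_unfold]
  have cu: "continuous_on UNIV unit_vec"
    using has_vector_derivative_unit_vec[of "\<lambda>x. x" 1] by (intro continuous_at_imp_continuous_on ballI)
      (auto intro: has_vector_derivative_continuous)
  have ca: "continuous_on ({0..} \<times> UNIV) (\<lambda>z. g (\<alpha> (fst z) (snd z)))" if "continuous_on UNIV g" for g :: "real \<Rightarrow> 'c :: topological_space"
    by (rule continuous_on_compose2[OF that c(1)]) auto
  have ct: "continuous_on ({0..} \<times> UNIV) (\<lambda>(t, x). h t x)"
    unfolding h_def case_prod_unfold
    by (intro continuous_intros c ca[OF cf(1)] ca[OF cf(2)] ca[OF cu] bounded_linear.continuous_on[OF bounded_linear_rot])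
  have mt: "((\<lambda>t. moment f f' t x) has_real_derivative h t x) (at t within {0..})" if t: "t \<ge> 0" for t x
    unfolding moment_def h_def
    using DERIV_mult[OF derivs(4)[OF t, of x] DERIV_diff[OF
        DERIV_mult[OF DERIV_chain2[OF f(1) derivs(3)[OF t, of x]] frame_derivs(3)[OF t, of x]]
        DERIV_mult[OF DERIV_chain2[OF f(2) derivs(3)[OF t, of x]] frame_derivs(4)[OF t, of x]]]]
    by (simp add: mult.commute[of "_ - _" "\<alpha>\<^sub>x t x"])
  have cm: "continuous_on UNIV (moment f f' t)" if t: "t \<ge> 0" for t
  proof -
    have s: "continuous_on UNIV (\<lambda>x. g t x)" if "continuous_on ({0..} \<times> UNIV) (\<lambda>(t, x). g t x)" for g :: "real \<Rightarrow> real \<Rightarrow> 'd :: topological_space"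
      by (rule continuous_on_quadrant_compose[OF that]) (use t in auto)
    have sa: "continuous_on UNIV (\<lambda>x. g (\<alpha> t x))" if "continuous_on UNIV g" for g :: "real \<Rightarrow> 'c :: topological_space"
      by (rule continuous_on_compose2[OF that s[OF cont(1)]]) auto
    show ?thesis
      unfolding moment_def[abs_def]
      by (intro continuous_intros s[OF cont(2)] s[OF cont(5)] sa[OF cf(1)] sa[OF cf(2)] sa[OF cu]
          bounded_linear.continuous_on[OF bounded_linear_rot])
  qed
  have D: "((\<lambda>t. integral {0..2 * pi} (moment f f' t)) has_real_derivative integral {0..2 * pi} (h t)) (at t within {0..})"
    by (rule has_real_derivative_space_integral[OF mt cm ct t])
  define s where "s y = b t y - mean_speed (b t)" for y
  have sd: "(s has_real_derivative vd (b t) y) (at y)" for y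
    unfolding s_def[abs_def] using DERIV_diff[OF bd(3) DERIV_const] by simp
  \<comment> \<open>Integration by parts over the normal angle trades - f' beta_x for \<kappa> f
    (beta - lambda).\<close>
  have 1: "((\<lambda>y. \<kappa> * f y * s y + vd (b t) y * f' y) has_integral 0) {0..2 * pi}"
    by (rule has_integral_periodic_deriv[of "\<lambda>y. f' y * s y"])
      (use DERIV_mult[OF f(2) sd] f(4)[of 0] b(2)[OF t, of 0] in \<open>auto simp: s_def\<close>)
  have cs: "continuous_on UNIV s" unfolding s_def[abs_def] by (intro continuous_intros bd(4))
  have 2: "((\<lambda>y. (1 + \<kappa>) * (s y * f y)) has_integral (1 + \<kappa>) * integral {0..2 * pi} (\<lambda>y. s y * f y)) {0..2 * pi}"
    by (intro has_integral_mult_right integrable_integral integrable_continuous_real continuous_intros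
        continuous_on_subset[OF cs] continuous_on_subset[OF cf(1)]) auto
  have 3: "integral {0..2 * pi} (\<lambda>y. f y * s y - f' y * vd (b t) y) = (1 + \<kappa>) * integral {0..2 * pi} (\<lambda>y. s y * f y)"
    using has_integral_diff[OF 2 1] by (intro integral_unique) (simp add: algebra_simps)
  have 4: "((\<lambda>x. \<alpha>\<^sub>x t x * (f (\<alpha> t x) * s (\<alpha> t x) - f' (\<alpha> t x) * vd (b t) (\<alpha> t x))) has_integral
      (1 + \<kappa>) * integral {0..2 * pi} (\<lambda>y. s y * f y)) {0..2 * pi}"
    unfolding 3[symmetric]
  proof (rule integral_periodic_substitution[where g="\<lambda>y. f y * s y - f' y * vd (b t) y", OF _ _ derivs(1)[OF t] e(1)])
    show "continuous_on UNIV (\<lambda>y. f y * s y - f' y * vd (b t) y)"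
      by (intro continuous_intros cf cs smooth_continuous[OF smooth_vd[OF bd(1)]])
    show "f (y + 2 * pi) * s (y + 2 * pi) - f' (y + 2 * pi) * vd (b t) (y + 2 * pi) = f y * s y - f' y * vd (b t) y" for y
      using f(3,4)[of y] b(2)[OF t, of y] periodic_vd[OF bd(1) b(2)[OF t], of y] by (simp add: s_def)
  qed
  \<comment> \<open>The x-derivative of \<omega> (f gn - f' gm): transport by the moving normal
    angle, which integrates to zero over a period.\<close>
  define \<Psi>' where "\<Psi>' x = \<omega>\<^sub>x t x * (f (\<alpha> t x) * gn t x - f' (\<alpha> t x) * gm t x) +
    ((f' (\<alpha> t x) * \<alpha>\<^sub>x t x * gn t x + \<alpha>\<^sub>x t x * gm t x * f (\<alpha> t x)) -
     (\<kappa> * f (\<alpha> t x) * \<alpha>\<^sub>x t x * gm t x + (\<alpha>\<^sub>x t x * b t (\<alpha> t x) - \<alpha>\<^sub>x t x * gn t x) * f' (\<alpha> t x))) * \<omega> t x" for x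
  have 5: "(\<Psi>' has_integral 0) {0..2 * pi}"
  proof (rule has_integral_periodic_deriv)
    show "((\<lambda>x. \<omega> t x * (f (\<alpha> t x) * gn t x - f' (\<alpha> t x) * gm t x)) has_real_derivative \<Psi>' x) (at x)" for x
      unfolding \<Psi>'_def
      by (rule DERIV_mult[OF derivs(2)[OF t, of x] DERIV_diff[OF
        DERIV_mult[OF DERIV_chain2[OF f(1) derivs(1)[OF t, of x]] frame_derivs(1)[OF t, of x]]
        DERIV_mult[OF DERIV_chain2[OF f(2) derivs(1)[OF t, of x]] frame_derivs(2)[OF t, of x]]]])
    show "\<omega> t (2 * pi) * (f (\<alpha> t (2 * pi)) * gn t (2 * pi) - f' (\<alpha> t (2 * pi)) * gm t (2 * pi)) =
        \<omega> t 0 * (f (\<alpha> t 0) * gn t 0 - f' (\<alpha> t 0) * gm t 0)"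
      using f(3,4)[of "\<alpha> t 0"] e by simp
  qed
  have "h t x = \<Psi>' x + \<alpha>\<^sub>x t x * (f (\<alpha> t x) * s (\<alpha> t x) - f' (\<alpha> t x) * vd (b t) (\<alpha> t x))" for x
  proof -
    define \<tau> where "\<tau> = slip (b t) (\<alpha> t x)"
    have nz: "1 + (b t (\<alpha> t x))\<^sup>2 \<noteq> 0" using zero_le_power2[of "b t (\<alpha> t x)"] by linarith
    have v: "vd (b t) (\<alpha> t x) = \<tau> * (1 + b t (\<alpha> t x) * b t (\<alpha> t x))"
      using nz by (simp add: \<tau>_def slip_def power2_eq_square)
    have g: "\<gamma>\<^sub>t t x \<bullet> unit_vec (\<alpha> t x) = s (\<alpha> t x)" "\<gamma>\<^sub>t t x \<bullet> rot (unit_vec (\<alpha> t x)) = \<tau>"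
      unfolding \<gamma>\<^sub>t[OF t] by (simp_all add: velocity_def s_def \<tau>_def inner_add_left)
    have w: "\<omega> t x = - (b t (\<alpha> t x) * \<tau>)" using \<omega>[OF t] by (simp add: \<tau>_def)
    \<comment> \<open>The identity needs \<omega> = - beta \<tau>: the transport term with \<omega>
      beta f' and the tangential velocity \<tau> combine to \<tau> (1 + beta^2) = beta_x.\<close>
    have ring: "wx * (f0 * p - f1 * q) + ax * ((f1 * w * p + (s0 + w * q) * f0) - (\<kappa> * f0 * w * q + (\<tau> - w * p) * f1)) =
        (wx * (f0 * p - f1 * q) + ((f1 * ax * p + ax * q * f0) - (\<kappa> * f0 * ax * q + (ax * b0 - ax * p) * f1)) * w) +
        ax * (f0 * s0 - f1 * (\<tau> * (1 + b0 * b0)))" if "w = - (b0 * \<tau>)" for wx f0 f1 p q ax w s0 b0 :: real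
      unfolding that by algebra
    show ?thesis unfolding h_def \<Psi>'_def v g by (rule ring[OF w])
  qed
  then have "h t = (\<lambda>x. \<Psi>' x + \<alpha>\<^sub>x t x * (f (\<alpha> t x) * s (\<alpha> t x) - f' (\<alpha> t x) * vd (b t) (\<alpha> t x)))" by blast
  then have "integral {0..2 * pi} (h t) = (1 + \<kappa>) * integral {0..2 * pi} (\<lambda>y. s y * f y)"
    using has_integral_add[OF 5 4] by (simp add: integral_unique)
  then have "((\<lambda>t. integral {0..2 * pi} (moment f f' t)) has_real_derivative
     (1 + \<kappa>) * integral {0..2 * pi} (\<lambda>y. (b t y - mean_speed (b t)) * f y)) (at t within {0..})"
    using D by (simp add: s_def)
  then show ?thesis
    using t by (rule has_real_derivative_cong_halfline) (simp add: integral_moment[OF _ f(1,3)])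
qed

text \<open>The constant lambda is orthogonal to the frequencies k \<ge> 1, which leaves a scalar
  linear equation with rate 1 - k^2.\<close>

lemma fourier_modes:
  assumes t: "t \<ge> 0" and k: "k \<ge> 1"
  shows "fourier_cos (b t) k = fourier_cos (b 0) k * exp ((1 - (of_int k)\<^sup>2) * t)"
    "fourier_sin (b t) k = fourier_sin (b 0) k * exp ((1 - (of_int k)\<^sup>2) * t)"
proof -
  let ?r = "1 - (of_int k :: real)\<^sup>2"
  have p: "cos (of_int k * (y + 2 * pi)) = cos (of_int k * y)" "sin (of_int k * (y + 2 * pi)) = sin (of_int k * y)" for y
    using cos_int_2pin[of k] sin_int_2pin[of k]
    by (simp_all add: distrib_left cos_add sin_add mult.commute[of "of_int k" "2 * pi"])
  have z: "((\<lambda>x. cos (of_int k * x)) has_integral 0) {0..2 * pi}" "((\<lambda>x. sin (of_int k * x)) has_integral 0) {0..2 * pi}"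
    using has_integral_cos_period[of k] has_integral_sin_period[of k] k by simp_all
  have i: "integral {0..2 * pi} (\<lambda>y. (b t y - c) * q y) = integral {0..2 * pi} (\<lambda>y. b t y * q y)"
    if "t \<ge> 0" "(q has_integral 0) {0..2 * pi}" "continuous_on {0..2 * pi} q" for t c q
  proof -
    have "(\<lambda>y. b t y * q y) integrable_on {0..2 * pi}"
      by (intro integrable_continuous_real continuous_intros that(3) Sdecay_static_derivs(4)[OF b(1)[OF that(1)]])
    then have "((\<lambda>y. b t y * q y - c * q y) has_integral integral {0..2 * pi} (\<lambda>y. b t y * q y) - c * 0) {0..2 * pi}"
      by (intro has_integral_diff has_integral_mult_right that(2) integrable_integral)
    from integral_unique[OF this] show ?thesis by (simp add: left_diff_distrib)
  qed
  have q: "continuous_on S (\<lambda>x. cos (of_int k * x))" "continuous_on S (\<lambda>x. sin (of_int k * x))" for S :: "real set"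
    by (intro continuous_intros)+
  have cd: "((\<lambda>y. cos (of_int k * y)) has_real_derivative - of_int k * sin (of_int k * y)) (at y)"
    "((\<lambda>y. - of_int k * sin (of_int k * y)) has_real_derivative - (of_int k)\<^sup>2 * cos (of_int k * y)) (at y)"
    "((\<lambda>y. sin (of_int k * y)) has_real_derivative of_int k * cos (of_int k * y)) (at y)"
    "((\<lambda>y. of_int k * cos (of_int k * y)) has_real_derivative - (of_int k)\<^sup>2 * sin (of_int k * y)) (at y)" for y :: real
    by (auto intro!: derivative_eq_intros simp: power2_eq_square)
  have C: "((\<lambda>t. fourier_cos (b t) k) has_real_derivative ?r * fourier_cos (b t) k) (at t within {0..})" if t: "t \<ge> 0" for t
    using moment_rate[OF t cd(1,2)] unfolding i[OF t z(1) q(1)] fourier_cos_def by (simp add: p)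
  have S: "((\<lambda>t. fourier_sin (b t) k) has_real_derivative ?r * fourier_sin (b t) k) (at t within {0..})" if t: "t \<ge> 0" for t
    using moment_rate[OF t cd(3,4)] unfolding i[OF t z(2) q(2)] fourier_sin_def by (simp add: p)
  show "fourier_cos (b t) k = fourier_cos (b 0) k * exp (?r * t)"
    using linear_ode[of "\<lambda>_. ?r", OF _ C t] t by (simp add: mult.commute)
  show "fourier_sin (b t) k = fourier_sin (b 0) k * exp (?r * t)"
    using linear_ode[of "\<lambda>_. ?r", OF _ S t] t by (simp add: mult.commute)
qed

text \<open>The case f = 1, \<kappa> = 0, the frequency in which lambda survives.\<close>

lemma length_rate:
  assumes t: "t \<ge> 0"
  shows "((\<lambda>t. integral {0..2 * pi} (b t)) has_real_derivative
    integral {0..2 * pi} (b t) - 2 * pi * mean_speed (b t)) (at t within {0..})"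
proof -
  have "integral {0..2 * pi} (\<lambda>y. b t y - mean_speed (b t)) = integral {0..2 * pi} (b t) - 2 * pi * mean_speed (b t)"
    using Sdecay_static_derivs(4)[OF b(1)[OF t]]
    by (subst integral_diff) (auto intro!: integrable_continuous_real)
  then show ?thesis
    using moment_rate[OF t, of "\<lambda>y. 1" "\<lambda>y. 0" 0] by simp
qed

end

section \<open>Identification of an arbitrary solution with the explicit one\<close>

context support_flow
begin

text \<open>The modes k \<ge> 1 of beta solve linear equations and are fixed by the initial curve.
  There remains the length L, whose equation contains 1 / L; it is compared with 2 pi p0 through the
  squares.\<close>

lemma lift_curvature:
  assumes fl: "flow_lift a \<gamma> \<gamma>\<^sub>t \<alpha> \<alpha>\<^sub>x \<omega> \<omega>\<^sub>x b" and \<gamma>0: "\<And>x. \<gamma> 0 x = Gc 0 (x + a)" and t: "t \<ge> 0"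
  shows "b t = bet t"
proof -
  interpret flow_lift a \<gamma> \<gamma>\<^sub>t \<alpha> \<alpha>\<^sub>x \<omega> \<omega>\<^sub>x b by (rule fl)
  define L where "L t = integral {0..2 * pi} (b t)" for t
  \<comment> \<open>Initially alpha is a shift with derivative 1, so beta can be read off from the
    derivative of the curve.\<close>
  have b0: "b 0 = bet 0"
  proof
    fix y
    have "(\<gamma> 0 has_vector_derivative b 0 y *\<^sub>R rot (unit_vec y)) (at (y - a))"
      using curve_deriv[of 0 "y - a"] by (simp add: init)
    moreover have "(\<gamma> 0 has_vector_derivative bet 0 y *\<^sub>R rot (unit_vec y)) (at (y - a))"
    proof -
      have "((\<lambda>x. x + a) has_vector_derivative 1) (at (y - a))"
        by (auto intro!: derivative_eq_intros simp flip: has_real_derivative_iff_has_vector_derivative)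
      from vector_diff_chain_at[OF this Gc_deriv[OF order_refl]]
      have "((\<lambda>x. Gc 0 (x + a)) has_vector_derivative bet 0 y *\<^sub>R rot (unit_vec y)) (at (y - a))" by (simp add: o_def)
      moreover have "(\<lambda>x. Gc 0 (x + a)) = \<gamma> 0" by (simp add: \<gamma>0 fun_eq_iff)
      ultimately show ?thesis by simp
    qed
    ultimately have "b 0 y *\<^sub>R rot (unit_vec y) = bet 0 y *\<^sub>R rot (unit_vec y)"
      by (rule vector_derivative_unique_at)
    moreover have "rot (unit_vec y) \<noteq> 0" using norm_rot[of "unit_vec y"] by (metis norm_unit_vec norm_zero zero_neq_one)
    ultimately show "b 0 y = bet 0 y" by simp
  qed
  have betc: "fourier_cos (bet 0) k = fourier_cos (fser (dT d) 0) k" "fourier_sin (bet 0) k = fourier_sin (fser (dT d) 0) k"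
    if "k \<ge> 1" for k
  proof -
    have eq: "bet 0 = (\<lambda>x. fser (dT d) 0 x - (- p0 0 + (0 * cos x + 0 * sin x)))" by (simp add: bet_def fun_eq_iff)
    have "continuous_on UNIV (\<lambda>x. - p0 0 + (0 * cos x + 0 * sin x))" by (intro continuous_intros)
    from fourier_diff[OF fser_cont[OF order_refl rapid_all(3)] this, of k]
    show "fourier_cos (bet 0) k = fourier_cos (fser (dT d) 0) k" "fourier_sin (bet 0) k = fourier_sin (fser (dT d) 0) k"
      unfolding eq using that by (simp_all only: fourier_low_modes) auto
  qed
  have series: "b t x = L t / (2 * pi) + fser (dT d) t x" if t: "t \<ge> 0" for t x
  proof -
    have "b t x = fourier_cos (b t) 0 / (2 * pi) +
        (fourier_cos (b t) 1 / pi * cos x + fourier_sin (b t) 1 / pi * sin x) + fser (dT d) t x"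
    proof (rule fourier_eq_fser[OF Sdecay_static_derivs(4)[OF b(1)[OF t]] b(2)[OF t] rapid_all(3) t])
      fix n
      have k: "int n + 2 \<ge> 1" "of_int (int n + 2) = real n + 2" by auto
      show "fourier_cos (b t) (int n + 2) = pi * exp ((1 - (real n + 2)\<^sup>2) * t) * Re (dT d n)"
        using fourier_modes(1)[OF t k(1)] fourier_fser(1)[OF rapid_all(3) order_refl, of "int n + 2"]
        unfolding b0 betc[OF k(1)] k(2) by simp
      show "fourier_sin (b t) (int n + 2) = - pi * exp ((1 - (real n + 2)\<^sup>2) * t) * Im (dT d n)"
        using fourier_modes(2)[OF t k(1)] fourier_fser(2)[OF rapid_all(3) order_refl, of "int n + 2"]
        unfolding b0 betc[OF k(1)] k(2) by simp
    qed
    moreover have "fourier_cos (b t) 0 = L t" by (simp add: L_def fourier_cos_def)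
    ultimately show ?thesis by (simp add: b(3,4)[OF t])
  qed
  have square: "integral {0..2 * pi} (\<lambda>x. (b t x)\<^sup>2) = (L t)\<^sup>2 / (2 * pi) + W t" if t: "t \<ge> 0" for t
  proof -
    define \<mu> where "\<mu> = L t / (2 * pi)"
    have k: "((\<lambda>x. c) has_integral (2 * pi * c)) {0..2 * pi}" for c :: real
      using has_integral_const_real[of c 0 "2 * pi"] by simp
    have w: "((\<lambda>x. fser (dT d) t x * fser (dT d) t x) has_integral W t) {0..2 * pi}"
      unfolding W_def
      by (intro integrable_integral integrable_continuous_real continuous_intros fser_cont t rapid_all)
    have "((\<lambda>x. \<mu> * \<mu> + 2 * \<mu> * fser (dT d) t x + fser (dT d) t x * fser (dT d) t x)
        has_integral 2 * pi * (\<mu> * \<mu>) + 2 * \<mu> * 0 + W t) {0..2 * pi}"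
      by (intro has_integral_add has_integral_mult_right k w fser_mean_zero(1)[OF rapid_all(3) t])
    moreover have "(\<lambda>x. \<mu> * \<mu> + 2 * \<mu> * fser (dT d) t x + fser (dT d) t x * fser (dT d) t x) = (\<lambda>x. (b t x)\<^sup>2)"
      unfolding series[OF t] \<mu>_def[symmetric] by (simp add: power2_eq_square algebra_simps)
    ultimately have "integral {0..2 * pi} (\<lambda>x. (b t x)\<^sup>2) = 2 * pi * (\<mu> * \<mu>) + W t" by (simp add: integral_unique)
    also have "2 * pi * (\<mu> * \<mu>) = (L t)\<^sup>2 / (2 * pi)" by (simp add: \<mu>_def power2_eq_square)
    finally show ?thesis .
  qed
  \<comment> \<open>Division by zero gives \<open>mean_speed\<close> the value 0 where L = 0, so the
    rate is 0 at such a time; that L does not vanish is still to be shown.\<close>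
  have L': "(L has_real_derivative (if L t = 0 then 0 else - 2 * pi * W t / L t)) (at t within {0..})" if t: "t \<ge> 0" for t
  proof -
    have "L t - 2 * pi * mean_speed (b t) = (if L t = 0 then 0 else - 2 * pi * W t / L t)"
      unfolding mean_speed_def square[OF t] L_def[symmetric] by (simp add: field_simps power2_eq_square)
    with length_rate[OF t] show ?thesis by (simp add: L_def[abs_def])
  qed
  have p0': "((\<lambda>t. 2 * pi * p0 t) has_real_derivative - 2 * pi * W t / (2 * pi * p0 t)) (at t within {0..})" if t: "t \<ge> 0" for t
  proof -
    have "2 * pi * (- w * i) = - 2 * pi * w * i" for w i :: real by simp
    with DERIV_cmult[OF p0_deriv(1)[OF t], of "2 * pi"] show ?thesis by (simp only: divide_inverse)
  qed
  have L0: "L 0 = 2 * pi * p0 0"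
  proof -
    have "(bet 0 has_integral 2 * pi * p0 0 + 0) {0..2 * pi}"
      unfolding bet_def[abs_def] using has_integral_const_real[of "p0 0" 0 "2 * pi"]
      by (intro has_integral_add fser_mean_zero(1) rapid_all) auto
    then show ?thesis by (simp add: L_def b0 integral_unique)
  qed
  \<comment> \<open>Where L is nonzero the two squares have the same derivative, and where L = 0
    that of D is nonpositive. Hence D \<le> D 0 = 0, so L^2 is at least (2 pi p0)^2 > 0, and then D
    vanishes at all times.\<close>
  define D where "D t = (2 * pi * p0 t)\<^sup>2 - (L t)\<^sup>2" for t
  have D': "(D has_real_derivative (if L t = 0 then - 4 * pi * W t else 0)) (at t within {0..})" if t: "t \<ge> 0" for t
  proof -
    have "(D has_real_derivative 2 * (2 * pi * p0 t) * (- 2 * pi * W t / (2 * pi * p0 t)) -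
        2 * L t * (if L t = 0 then 0 else - 2 * pi * W t / L t)) (at t within {0..})"
    proof -
      have sq: "((\<lambda>t. (f t)\<^sup>2) has_real_derivative 2 * f t * f') (at t within {0..})"
        if "(f has_real_derivative f') (at t within {0..})" for f :: "real \<Rightarrow> real" and f'
        using that by (auto intro!: derivative_eq_intros)
      show ?thesis unfolding D_def[abs_def] by (rule DERIV_diff[OF sq[OF p0'[OF t]] sq[OF L'[OF t]]])
    qed
    moreover have "2 * (2 * pi * p0 t) * (- 2 * pi * W t / (2 * pi * p0 t)) = - 4 * pi * W t"
      using p0_nonzero[OF t] by simp
    moreover have "2 * L t * (if L t = 0 then 0 else - 2 * pi * W t / L t) = (if L t = 0 then 0 else - 4 * pi * W t)"
      by simp
    ultimately show ?thesis by (auto split: if_splits)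
  qed
  have Dle: "D t \<le> 0" if t: "t \<ge> 0" for t
  proof -
    have "D t \<le> D 0"
      by (rule antimono_halfline[OF D']) (use t W_nonneg in auto)
    then show ?thesis by (simp add: D_def L0)
  qed
  have Lnz: "L t \<noteq> 0" if t: "t \<ge> 0" for t
  proof
    assume "L t = 0"
    then have "(2 * pi * p0 t)\<^sup>2 \<le> 0" using Dle[OF t] by (simp add: D_def)
    then show False using p0_nonzero[OF t] by simp
  qed
  have D0: "D t = 0" if t: "t \<ge> 0" for t
    using constant_on_halfline[of D, OF _ t] D' Lnz by (simp add: D_def L0)
  \<comment> \<open>Equality of the squares leaves a sign open; the quotient is constant and equals
    1 at t = 0.\<close>
  have "((\<lambda>t. L t / (2 * pi * p0 t)) has_real_derivative 0) (at t within {0..})" if t: "t \<ge> 0" for t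
  proof -
    have nz: "2 * pi * p0 t \<noteq> 0" using p0_nonzero[OF t] by simp
    have "- 2 * pi * W t / L t * (2 * pi * p0 t) = L t * (- 2 * pi * W t / (2 * pi * p0 t))"
    proof -
      have "x / l * q = l * (x / q)" if "q\<^sup>2 = l\<^sup>2" "l \<noteq> 0" "q \<noteq> 0" for x l q :: real
        using that by (simp add: field_simps power2_eq_square)
      then show ?thesis using D0[OF t] Lnz[OF t] nz by (simp only: D_def eq_iff_diff_eq_0[symmetric])
    qed
    then show ?thesis
      using DERIV_divide[OF L'[OF t] p0'[OF t] nz] Lnz[OF t] by simp
  qed
  from constant_on_halfline[OF this t]
  have "L t / (2 * pi * p0 t) = L 0 / (2 * pi * p0 0)" .
  then have "L t = 2 * pi * p0 t" using p0_nonzero[OF t] p0_nonzero[of 0] by (simp add: L0)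
  then show ?thesis using series[OF t] by (simp add: fun_eq_iff bet_def)
qed

text \<open>Once beta is known, alpha solves the same scalar equation as x + u, so the normals
  agree. Then both curves have the same velocity at each parameter and the same start.\<close>

lemma solution_unique:
  assumes u: "displacement_of a u"
    and fs: "flow_solution (moved_curve u 0) (moved_normal u 0) \<gamma> \<nu>" and t: "t \<ge> 0"
  shows "\<gamma> t = moved_curve u t" "\<nu> t = moved_normal u t"
proof -
  have n0: "moved_normal u 0 \<theta> = unit_vec (\<theta> + a)" and g0: "moved_curve u 0 \<theta> = Gc 0 (\<theta> + a)" for \<theta>
    by (simp_all add: moved_normal_def moved_curve_def displacement_ofD(2)[OF u])
  obtain \<gamma>\<^sub>t \<alpha> \<alpha>\<^sub>x \<omega> \<omega>\<^sub>x b where fl: "flow_lift a \<gamma> \<gamma>\<^sub>t \<alpha> \<alpha>\<^sub>x \<omega> \<omega>\<^sub>x b"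
    and \<nu>: "\<And>t \<theta>. t \<ge> 0 \<Longrightarrow> \<nu> t \<theta> = unit_vec (\<alpha> t \<theta>)"
    using fs n0 by (rule flow_lift_exists) (rule that)
  interpret flow_lift a \<gamma> \<gamma>\<^sub>t \<alpha> \<alpha>\<^sub>x \<omega> \<omega>\<^sub>x b by (rule fl)
  have \<gamma>0: "\<gamma> 0 = moved_curve u 0" using fs by (simp add: flow_solution_def)
  have bb: "b t = bet t" if "t \<ge> 0" for t
    by (rule lift_curvature[OF fl _ that]) (simp add: \<gamma>0 g0)
  have slip: "slip (bet t) y = slide t y" if "t \<ge> 0" for t y
    by (simp add: slip_def slide_def vd_eqI_real[OF space_derivs(3)[OF that]] divide_inverse power2_eq_square)
  have l: "mean_speed (bet t) = lamt t" if "t \<ge> 0" for t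
    using lam_Gc[OF that] by (simp add: lam_def mean_speed_def alg_length_def beta_Gc[OF that])
  have \<alpha>: "\<alpha> t x = x + u t x" if t: "t \<ge> 0" for t x
  proof (rule ode_unique[OF Sdecay_drift _ _ _ t, where a="\<lambda>t. \<alpha> t x"])
    fix t :: real assume t: "t \<ge> 0"
    show "((\<lambda>t. \<alpha> t x) has_real_derivative drift t (\<alpha> t x)) (at t within {0..})"
      using derivs(3)[OF t, of x] unfolding \<omega>[OF t] bb[OF t] slip[OF t] by (simp add: drift_def)
    show "((\<lambda>t. x + u t x) has_real_derivative drift t (x + u t x)) (at t within {0..})"
      by (auto intro!: derivative_eq_intros displacement_ofD(4)[OF u t])
  qed (simp add: init displacement_ofD(2)[OF u])
  show "\<nu> t = moved_normal u t"
    using \<nu>[OF t] \<alpha>[OF t] by (simp add: moved_normal_def fun_eq_iff)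
  show "\<gamma> t = moved_curve u t"
  proof
    fix x
    have "((\<lambda>t. \<gamma> t x - moved_curve u t x) has_vector_derivative 0) (at t within {0..})" if t: "t \<ge> 0" for t
    proof -
      have "\<gamma>\<^sub>t t x = flow_gamma (Gc t) unit_vec (x + u t x)"
        unfolding \<gamma>\<^sub>t[OF t] velocity_def bb[OF t] slip[OF t] l[OF t] \<alpha>[OF t] flow_rhs[OF t] ..
      then show ?thesis
        using has_vector_derivative_diff[OF derivs(5)[OF t, of x] moved_derivs(1)[OF u t, of x]] by simp
    qed
    then have zero: "\<And>t. t \<in> {0..} \<Longrightarrow> ((\<lambda>t. \<gamma> t x - moved_curve u t x) has_vector_derivative 0) (at t within {0..})"
      by simp
    obtain c where "\<And>t. t \<in> {0..} \<Longrightarrow> \<gamma> t x - moved_curve u t x = c"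
      using convex_real_interval(1) zero by (rule has_vector_derivative_zero_constant) (assumption, rule that)
    then have "\<gamma> t x - moved_curve u t x = \<gamma> 0 x - moved_curve u 0 x" using t by auto
    then show "\<gamma> t x = moved_curve u t x" by (simp add: \<gamma>0)
  qed
qed

lemma vd_p: "vd p = Px 0" and p_eq: "p = P 0"
proof -
  show 1: "p = P 0" by (simp add: fun_eq_iff P_def p0_0 p_series[symmetric])
  show "vd p = Px 0"
    by (subst 1, rule vd_eqI_real) (rule space_derivs(1)[OF order_refl])
qed

end

theorem theorem1p1:
  fixes \<gamma>\<^sub>0 \<nu>\<^sub>0 :: curve
  assumes "legendre_curve \<gamma>\<^sub>0 \<nu>\<^sub>0"
    and "\<And>\<theta>. ell \<nu>\<^sub>0 \<theta> = 1"
    and "alg_area \<gamma>\<^sub>0 \<nu>\<^sub>0 > 0"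
  shows "(\<exists>\<gamma> \<nu>. flow_solution \<gamma>\<^sub>0 \<nu>\<^sub>0 \<gamma> \<nu>) \<and>
    (\<forall>\<gamma> \<nu>. flow_solution \<gamma>\<^sub>0 \<nu>\<^sub>0 \<gamma> \<nu> \<longrightarrow>
       (\<forall>t\<ge>0. legendre_curve (\<gamma> t) (\<nu> t) \<and> ell_convex (\<nu> t) \<and>
              alg_area (\<gamma> t) (\<nu> t) = alg_area \<gamma>\<^sub>0 \<nu>\<^sub>0) \<and>
       (\<exists>g. circle_param (sqrt (alg_area \<gamma>\<^sub>0 \<nu>\<^sub>0 / pi)) g \<and> tendsto_smoothly \<gamma> g))"
proof -
  have "norm (\<nu>\<^sub>0 0) = 1" using assms(1) by (simp add: legendre_curve_def)
  \<comment> \<open>The angle a of the normal at parameter 0 is the shift between the parameter and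
    the normal angle.\<close>
  then obtain a where "\<nu>\<^sub>0 0 = unit_vec (0 + a)" using obtain_angle by (metis add_0)
  with assms(1,2) obtain p where p: "Sdecay 0 (\<lambda>t. p)" "\<And>x. p (x + 2 * pi) = p x"
    "\<And>\<theta>. \<nu>\<^sub>0 \<theta> = unit_vec (\<theta> + a)" "\<And>\<theta>. support \<gamma>\<^sub>0 \<nu>\<^sub>0 \<theta> = p (\<theta> + a)"
    "\<And>\<theta>. beta \<gamma>\<^sub>0 \<nu>\<^sub>0 \<theta> = p (\<theta> + a) + vd (vd p) (\<theta> + a)"
    "\<And>\<theta>. \<gamma>\<^sub>0 \<theta> = p (\<theta> + a) *\<^sub>R unit_vec (\<theta> + a) + vd p (\<theta> + a) *\<^sub>R rot (unit_vec (\<theta> + a))"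
    by (rule normal_form) (rule that)
  note p1 = Sdecay_static_derivs[OF p(1)]
  note p2 = Sdecay_static_derivs[OF p1(2)]
  have "integral {0..2 * pi} (\<lambda>\<theta>. p (\<theta> + a) * (p (\<theta> + a) + vd (vd p) (\<theta> + a))) =
      integral {0..2 * pi} (\<lambda>x. p x * (p x + vd (vd p) x))"
  proof (rule periodic_shift_integral[where g="\<lambda>x. p x * (p x + vd (vd p) x)"])
    show "continuous_on UNIV (\<lambda>x. p x * (p x + vd (vd p) x))"
      by (intro continuous_intros p1(4) smooth_continuous[OF smooth_vd[OF p2(1)]])
    show "p (x + 2 * pi) * (p (x + 2 * pi) + vd (vd p) (x + 2 * pi)) = p x * (p x + vd (vd p) x)" for x
      using periodic_vd[OF p2(1) periodic_vd[OF p1(1) p(2)], of x] by (simp add: p(2))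
  qed
  then have area: "alg_area \<gamma>\<^sub>0 \<nu>\<^sub>0 = integral {0..2 * pi} (\<lambda>x. p x * (p x + vd (vd p) x)) / 2"
    by (simp add: alg_area_def p)
  interpret support_flow p
    by standard (use p(1,2) assms(3) area in auto)
  have area': "alg_area \<gamma>\<^sub>0 \<nu>\<^sub>0 = A2 / 2" unfolding area A2_def ..
  obtain u where u: "displacement_of a u" using displacement_exists by blast
  have init: "moved_curve u 0 = \<gamma>\<^sub>0" "moved_normal u 0 = \<nu>\<^sub>0"
    by (simp_all add: fun_eq_iff moved_curve_def moved_normal_def displacement_ofD(2)[OF u] Gc_frame p(3,6) vd_p
        flip: p_eq)
  have ex: "flow_solution \<gamma>\<^sub>0 \<nu>\<^sub>0 (moved_curve u) (moved_normal u)"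
    using moved_flow_solution[OF u] unfolding init .
  obtain g where g: "circle_param (sqrt (A2 / (2 * pi))) g" "tendsto_smoothly (moved_curve u) g"
    using u by (rule moved_limit) (rule that)
  have "(\<forall>t\<ge>0. legendre_curve (\<gamma> t) (\<nu> t) \<and> ell_convex (\<nu> t) \<and> alg_area (\<gamma> t) (\<nu> t) = alg_area \<gamma>\<^sub>0 \<nu>\<^sub>0) \<and>
       (\<exists>g. circle_param (sqrt (alg_area \<gamma>\<^sub>0 \<nu>\<^sub>0 / pi)) g \<and> tendsto_smoothly \<gamma> g)"
    if fs: "flow_solution \<gamma>\<^sub>0 \<nu>\<^sub>0 \<gamma> \<nu>" for \<gamma> \<nu>
  proof -
    \<comment> \<open>Every solution coincides with the explicit one for t \<ge> 0, so the
      invariants and the limit at infinity carry over.\<close>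
    note eq = solution_unique[OF u fs[folded init]]
    have "\<forall>\<^sub>F t in at_top. \<forall>x\<in>UNIV. (vd ^^ k) (moved_curve u t) x = (vd ^^ k) (\<gamma> t) x" for k
      using eventually_ge_at_top[of 0] by eventually_elim (simp add: eq(1))
    from uniform_limit_cong[OF this refl] g(2)
    have "tendsto_smoothly \<gamma> g" unfolding tendsto_smoothly_def by blast
    then show ?thesis using g(1) moved_invariants[OF u] eq by (auto simp: area')
  qed
  with ex show ?thesis by blast
qed

end
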